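(* Let $\mathcal{G}(\mathbf{g},\mathbf{b})=\{M_{lb_k}g_k\}_{k,l\in\mathbb{Z}}$ be an almost painless nonstationary Gabor (NSG) system that is a Bessel sequence in $L^2(\mathbb{R})$, with $I_k=[a_k-(2b_k)^{-1},a_k+(2b_k)^{-1}]$ and $g_k^o=g_k\chi_{I_k}$. Let $A_0=\operatorname{ess\,inf}G_0^{g^o,g^o}$ be the lower frame bound of the painless frame $\mathcal{G}(\mathbf{g^o},\mathbf{b})$, and set $g_k^r=g_k-g_k\chi_{I_k}$. Then the following hold. (i) For $\gamma_k^1=(G_0^{g^o,g^o})^{-1}g_k^o$, $k\in\mathbb{Z}$, $$\|I-S_{g,\gamma^1}\|\le A_0^{-1}\sqrt{R_{g^r,g^o}\cdot R_{g^o,g^r}}.$$ (ii) For $\gamma_k^2=(G_0^{g^o,g^o})^{-1}g_k$, $k\in\mathbb{Z}$, $$\|I-S_{g,\gamma^2}\|\le A_0^{-1}\Big(R_{g^r,g^o}+R_{g^o,g^r}+\operatorname{ess\,sup}\sum_{l\in\mathbb{Z}}G_l^{g^r,g^r}\Big).$$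
   Context: Modulation: $M_{\omega}g(t)=e^{2\pi i\omega t}g(t)$; $\chi_I$ is the characteristic function of $I$. The Wiener space $W(L^\infty,\ell^1)$ consists of all $g\in L^\infty(\mathbb{R})$ with $\sum_{k\in\mathbb{Z}}\operatorname{ess\,sup}_{t\in[0,1]}|g(t+k)|<\infty$. A nonstationary Gabor (NSG) system $\mathcal{G}(\mathbf{g},\mathbf{b})$ is given by windows $\mathbf{g}=\{g_k\in W(L^\infty,\ell^1):k\in\mathbb{Z}\}$ and frequency-shift parameters $\mathbf{b}=\{b_k:k\in\mathbb{Z}\}$ as the set $\{M_{lb_k}g_k:k,l\in\mathbb{Z}\}$. Standing assumptions: $b_k\in[b_L,b_U]\subset\mathbb{R}^+=(0,\infty)$ for all $k$; the time-sampling points $\{a_k:k\in\mathbb{Z}\}\subset\mathbb{R}$ are $\delta$-separated for some $\delta>0$, i.e. $|a_k-a_m|>\delta$ for $k\ne m$. A family $\{f_i\}$ in $L^2(\mathbb{R})$ is a Bessel sequence if there is $B<\infty$ with $\sum_i|\langle f,f_i\rangle|^2\le B\|f\|_2^2$ for all $f\in L^2(\mathbb{R})$. For two systems with the same $\mathbf{b}$ define $$S_{g,\gamma}f=\sum_{k,l\in\mathbb{Z}}\langle f,M_{lb_k}g_k\rangle M_{lb_k}\gamma_k,\qquad G^{g,\gamma}_l(t)=\sum_{k\in\mathbb{Z}}b_k^{-1}|g_k(t-lb_k^{-1})|\,|\gamma_k(t)|\quad(l\in\mathbb{Z}),$$ $$R_{g,\gamma}=\operatorname{ess\,sup}_{t\in\mathbb{R}}\sum_{l\in\mathbb{Z}\setminus\{0\}}\sum_{k\in\mathbb{Z}}b_k^{-1}|g_k(t-lb_k^{-1})|\,|\gamma_k(t)|;$$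 these are applied with $g,\gamma$ replaced by $g^o$, $g^r$, $\gamma^1$, $\gamma^2$. $\|\cdot\|$ is the operator norm on $L^2(\mathbb{R})$. Almost painless NSG system: an NSG system $\mathcal{G}(\mathbf{g},\mathbf{b})$ such that each $g_k$ is essentially bounded away from zero on $I_k=[a_k-(2b_k)^{-1},a_k+(2b_k)^{-1}]$ and, with $g_k^o=g_k\chi_{I_k}$, the system $\mathcal{G}(\mathbf{g^o},\mathbf{b})$ is a frame for $L^2(\mathbb{R})$. Since $|\operatorname{supp}g_k^o|\le 1/b_k$, such a frame is called painless; the frame property means $0<A\le G_0^{g^o,g^o}(t)\le B<\infty$ a.e. for some constants $A,B$. *)

theory Defs
  imports "HOL-Analysis.Analysis" "HOL-Probability.Essential_Supremum"
begin

text \<open>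
  Elements of L^2(R), and windows, are represented by Lebesgue measurable functions
  from the reals to the complex numbers, not by almost-everywhere classes.
  All norms, sums of nonnegative terms, essential suprema and essential infima take values
  in \<^typ>\<open>ennreal\<close>, so the value infinity is permitted.
\<close>

definition ennsqrt :: "ennreal \<Rightarrow> ennreal" where
  "ennsqrt x = (if x = \<infinity> then \<infinity> else ennreal (sqrt (enn2real x)))"

subsection \<open>Square-integrable functions\<close>

definition L2_norm :: "(real \<Rightarrow> complex) \<Rightarrow> ennreal" where
  "L2_norm f = ennsqrt (\<integral>\<^sup>+ t. ennreal ((cmod (f t))\<^sup>2) \<partial>lebesgue)"

definition L2 :: "(real \<Rightarrow> complex) set" where
  "L2 = {f \<in> borel_measurable lebesgue. L2_norm f < \<infinity>}"

definition L2_inner :: "(real \<Rightarrow> complex) \<Rightarrow> (real \<Rightarrow> complex) \<Rightarrow> complex" where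
  "L2_inner f h = (LINT t|lebesgue. f t * cnj (h t))"

text \<open>Unconditional convergence of a series in the L^2 norm.\<close>

definition L2_has_sum :: "('i \<Rightarrow> real \<Rightarrow> complex) \<Rightarrow> (real \<Rightarrow> complex) \<Rightarrow> bool" where
  "L2_has_sum \<phi> h \<longleftrightarrow> h \<in> L2 \<and>
     ((\<lambda>F. L2_norm (\<lambda>t. (\<Sum>i\<in>F. \<phi> i t) - h t)) \<longlongrightarrow> 0) (finite_subsets_at_top UNIV)"

definition L2_summable :: "('i \<Rightarrow> real \<Rightarrow> complex) \<Rightarrow> bool" where
  "L2_summable \<phi> \<longleftrightarrow> (\<exists>h. L2_has_sum \<phi> h)"

text \<open>
  For a summable family, the sum is unique up to equality almost everywhere;
  the choice of representative does not affect L^2 norms. For a family that is not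
  summable, the value is unspecified.
\<close>

definition L2_sum :: "('i \<Rightarrow> real \<Rightarrow> complex) \<Rightarrow> real \<Rightarrow> complex" where
  "L2_sum \<phi> = (SOME h. L2_has_sum \<phi> h)"

definition L2_opnorm :: "((real \<Rightarrow> complex) \<Rightarrow> real \<Rightarrow> complex) \<Rightarrow> ennreal" where
  "L2_opnorm T = (SUP f\<in>{f \<in> L2. L2_norm f \<le> 1}. L2_norm (T f))"

subsection \<open>Bessel sequences and frames\<close>

definition L2_bessel :: "('i \<Rightarrow> real \<Rightarrow> complex) \<Rightarrow> bool" where
  "L2_bessel \<phi> \<longleftrightarrow> range \<phi> \<subseteq> L2 \<and>
     (\<exists>B::real. \<forall>f\<in>L2.
        (\<Sum>\<^sub>\<infinity>i. ennreal ((cmod (L2_inner f (\<phi> i)))\<^sup>2)) \<le> ennreal B * (L2_norm f)\<^sup>2)"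

definition L2_frame :: "('i \<Rightarrow> real \<Rightarrow> complex) \<Rightarrow> bool" where
  "L2_frame \<phi> \<longleftrightarrow> range \<phi> \<subseteq> L2 \<and>
     (\<exists>A B::real. 0 < A \<and> (\<forall>f\<in>L2.
        ennreal A * (L2_norm f)\<^sup>2 \<le> (\<Sum>\<^sub>\<infinity>i. ennreal ((cmod (L2_inner f (\<phi> i)))\<^sup>2)) \<and>
        (\<Sum>\<^sub>\<infinity>i. ennreal ((cmod (L2_inner f (\<phi> i)))\<^sup>2)) \<le> ennreal B * (L2_norm f)\<^sup>2))"

subsection \<open>Nonstationary Gabor systems\<close>

definition modulation :: "real \<Rightarrow> (real \<Rightarrow> complex) \<Rightarrow> real \<Rightarrow> complex" where
  "modulation \<omega> g t = exp (2 * complex_of_real pi * \<i> * complex_of_real (\<omega> * t)) * g t"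

definition wiener_space :: "(real \<Rightarrow> complex) set" where
  "wiener_space = {g \<in> borel_measurable lebesgue.
     esssup lebesgue (\<lambda>t. ennreal (cmod (g t))) < \<infinity> \<and>
     (\<Sum>\<^sub>\<infinity>k::int. esssup (lebesgue_on {0..1}) (\<lambda>t. ennreal (cmod (g (t + of_int k))))) < \<infinity>}"

definition nsg_atoms :: "(int \<Rightarrow> real) \<Rightarrow> (int \<Rightarrow> real \<Rightarrow> complex) \<Rightarrow> int \<times> int \<Rightarrow> real \<Rightarrow> complex" where
  "nsg_atoms b g = (\<lambda>(k, l). modulation (of_int l * b k) (g k))"

definition nsg_system :: "(int \<Rightarrow> real) \<Rightarrow> (int \<Rightarrow> real) \<Rightarrow> (int \<Rightarrow> real \<Rightarrow> complex) \<Rightarrow> bool" where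
  "nsg_system a b g \<longleftrightarrow>
     (\<forall>k. g k \<in> wiener_space) \<and>
     (\<exists>bL bU. 0 < bL \<and> (\<forall>k. b k \<in> {bL..bU})) \<and>
     (\<exists>\<delta>>0. \<forall>k m. k \<noteq> m \<longrightarrow> \<bar>a k - a m\<bar> > \<delta>)"

definition nsg_op ::
  "(int \<Rightarrow> real) \<Rightarrow> (int \<Rightarrow> real \<Rightarrow> complex) \<Rightarrow> (int \<Rightarrow> real \<Rightarrow> complex) \<Rightarrow>
   (real \<Rightarrow> complex) \<Rightarrow> real \<Rightarrow> complex" where
  "nsg_op b g \<gamma> f = L2_sum (\<lambda>i t. L2_inner f (nsg_atoms b g i) * nsg_atoms b \<gamma> i t)"

definition nsg_op_converges ::
  "(int \<Rightarrow> real) \<Rightarrow> (int \<Rightarrow> real \<Rightarrow> complex) \<Rightarrow> (int \<Rightarrow> real \<Rightarrow> complex) \<Rightarrow> bool" where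
  "nsg_op_converges b g \<gamma> \<longleftrightarrow>
     (\<forall>f\<in>L2. L2_summable (\<lambda>i t. L2_inner f (nsg_atoms b g i) * nsg_atoms b \<gamma> i t))"

definition nsg_G ::
  "(int \<Rightarrow> real) \<Rightarrow> (int \<Rightarrow> real \<Rightarrow> complex) \<Rightarrow> (int \<Rightarrow> real \<Rightarrow> complex) \<Rightarrow> int \<Rightarrow> real \<Rightarrow> ennreal" where
  "nsg_G b g \<gamma> l t =
     (\<Sum>\<^sub>\<infinity>k. ennreal (inverse (b k) * cmod (g k (t - of_int l * inverse (b k))) * cmod (\<gamma> k t)))"

definition nsg_R ::
  "(int \<Rightarrow> real) \<Rightarrow> (int \<Rightarrow> real \<Rightarrow> complex) \<Rightarrow> (int \<Rightarrow> real \<Rightarrow> complex) \<Rightarrow> ennreal" where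
  "nsg_R b g \<gamma> = esssup lebesgue (\<lambda>t. \<Sum>\<^sub>\<infinity>l\<in>UNIV - {0}. nsg_G b g \<gamma> l t)"

subsection \<open>Almost painless systems\<close>

definition nsg_interval :: "(int \<Rightarrow> real) \<Rightarrow> (int \<Rightarrow> real) \<Rightarrow> int \<Rightarrow> real set" where
  "nsg_interval a b k = {a k - inverse (2 * b k) .. a k + inverse (2 * b k)}"

definition nsg_core ::
  "(int \<Rightarrow> real) \<Rightarrow> (int \<Rightarrow> real) \<Rightarrow> (int \<Rightarrow> real \<Rightarrow> complex) \<Rightarrow> int \<Rightarrow> real \<Rightarrow> complex" where
  "nsg_core a b g k t = g k t * indicator (nsg_interval a b k) t"

definition almost_painless ::
  "(int \<Rightarrow> real) \<Rightarrow> (int \<Rightarrow> real) \<Rightarrow> (int \<Rightarrow> real \<Rightarrow> complex) \<Rightarrow> bool" where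
  "almost_painless a b g \<longleftrightarrow> nsg_system a b g \<and>
     (\<forall>k. \<exists>c>0. AE t in lebesgue. t \<in> nsg_interval a b k \<longrightarrow> c \<le> cmod (g k t)) \<and>
     L2_frame (nsg_atoms b (nsg_core a b g))"

text \<open>Companion of \<^const>\<open>esssup\<close>, which is the \<open>Limsup\<close> along the same filter.\<close>

definition essinf :: "'a measure \<Rightarrow> ('a \<Rightarrow> ennreal) \<Rightarrow> ennreal" where
  "essinf M f = (if f \<in> borel_measurable M then Liminf (ae_filter M) f else bot)"

end

theory Submission
  imports Defs
begin

text \<open>
  Write \<open>g\<^sub>k = go\<^sub>k + gr\<^sub>k\<close>, where \<open>go\<^sub>k\<close> lives on an interval of length \<open>1/b\<^sub>k\<close>. For compactly
  supported \<open>f\<close> and \<open>h\<close>, folding \<open>f cnj(g\<^sub>k)\<close> and \<open>h cnj(\<gamma>\<^sub>k)\<close> onto that interval and applying Parseval's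
  identity there turns the sum over \<open>l\<close> of the coefficient products into finitely many shifted integrals.
  The unshifted \<open>go\<close>-\<open>go\<close> terms add up over \<open>k\<close> to \<open>\<integral> f cnj(h) G\<^sub>0\<close>, the shifted ones vanish, and the
  remaining cross terms are controlled by the Schur test, which produces the quantities \<open>R\<close> and the essential
  supremum of \<open>\<Sum>\<^sub>l G\<^sub>l\<close>. Bessel continuity of the form extends the estimate to all of \<open>L\<^sup>2\<close>. The dual weight
  \<open>1/G\<^sub>0\<close> is real and can be moved onto \<open>h\<close>, where it costs the factor \<open>1/A\<^sub>0\<close> and turns
  \<open>\<integral> f cnj(h) G\<^sub>0\<close> into \<open>\<langle>f, h\<rangle>\<close>; taking \<open>h = f - S f\<close> gives the bound on the operator norm.
\<close>

subsection \<open>Square-integrable functions\<close>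

text \<open>The bounds involve only the unweighted windows, whereas the weight \<open>1/G0\<close>
  would enter the Schur weights. It is therefore removed before anything is estimated; almost
  everywhere it is at most \<open>1/A0\<close>, and the unweighted form is compared with
  multiplication by \<open>G0\<close>. The shape of the bounds comes from splitting both windows. If
  the synthesis window is \<open>go\<close>, it has no tail, only tail-core products survive, and
  the two halves of the Schur test contribute one factor R each under a square root. If it is
  \<open>g\<close>, core-tail and tail-core products each cost this same geometric mean, twice which
  is at most the sum of the two constants; the tail-tail products remain, including shift 0. Compact
  support makes every fold a finite sum, so that sums and integrals can be exchanged freely. The
  quantities R may be infinite, hence the estimates are done in extended nonnegative reals. The
  constant \<open>A0\<close> is an essential infimum, while the frame inequality only speaks of
  integrals; pointwise bounds are recovered by testing it on indicators of bounded sets.\<close>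

lemma ennsqrt_ennreal: "0 \<le> x \<Longrightarrow> ennsqrt (ennreal x) = ennreal (sqrt x)"
  by (simp add: ennsqrt_def)

lemma ennsqrt_power2: "(ennsqrt x)\<^sup>2 = x"
  by (cases x) (auto simp: ennsqrt_def ennreal_power power2_eq_square ennreal_mult'[symmetric])

lemma ennsqrt_less_top_iff: "ennsqrt x < \<infinity> \<longleftrightarrow> x < \<infinity>"
  by (cases x) (auto simp: ennsqrt_def)

text \<open>A real copy of \<open>L2_norm\<close>, so that norms can be subtracted and cancelled. A
  Bochner integral that does not exist has value 0, so the number is meaningful only together with
  membership in \<open>L2\<close>.\<close>

definition L2n :: "(real \<Rightarrow> complex) \<Rightarrow> real" where
  "L2n f = sqrt (LINT t|lebesgue. (cmod (f t))\<^sup>2)"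

lemma L2_iff:
  "f \<in> L2 \<longleftrightarrow> f \<in> borel_measurable lebesgue \<and> integrable lebesgue (\<lambda>t. (cmod (f t))\<^sup>2)"
  unfolding L2_def L2_norm_def by (auto simp: ennsqrt_less_top_iff integrable_iff_bounded simp del: infinity_ennreal_def)

lemma L2_measurable: "f \<in> L2 \<Longrightarrow> f \<in> borel_measurable lebesgue"
  by (simp add: L2_iff)

lemma L2n_nonneg[simp]: "0 \<le> L2n f"
  by (simp add: L2n_def)

lemma L2n_power2: "(L2n f)\<^sup>2 = (LINT t|lebesgue. (cmod (f t))\<^sup>2)"
  by (simp add: L2n_def)

lemma nn_integral_L2n:
  assumes "f \<in> L2"
  shows "(\<integral>\<^sup>+t. ennreal ((cmod (f t))\<^sup>2) \<partial>lebesgue) = ennreal ((L2n f)\<^sup>2)"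
  using assms by (simp add: L2n_power2 nn_integral_eq_integral L2_iff)

lemma L2_norm_eq: "f \<in> L2 \<Longrightarrow> L2_norm f = ennreal (L2n f)"
  by (simp add: L2_norm_def nn_integral_L2n ennsqrt_ennreal)

lemma L2I:
  assumes "f \<in> borel_measurable lebesgue" "(\<integral>\<^sup>+t. ennreal ((cmod (f t))\<^sup>2) \<partial>lebesgue) \<le> ennreal c"
  shows "f \<in> L2"
proof -
  have "(\<integral>\<^sup>+t. ennreal ((cmod (f t))\<^sup>2) \<partial>lebesgue) < \<infinity>"
    using assms(2) by (auto simp: less_top[symmetric] top_unique)
  with assms(1) show ?thesis by (auto simp: L2_iff integrable_iff_bounded)
qed

lemma L2n_le:
  assumes "f \<in> L2" "(\<integral>\<^sup>+t. ennreal ((cmod (f t))\<^sup>2) \<partial>lebesgue) \<le> ennreal (c\<^sup>2)" "0 \<le> c"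
  shows "L2n f \<le> c"
proof -
  have "(L2n f)\<^sup>2 \<le> c\<^sup>2"
    using assms(2) unfolding nn_integral_L2n[OF assms(1)] by (simp add: ennreal_le_iff)
  then show ?thesis using assms(3) by (rule power2_le_imp_le)
qed

lemma L2_zero[simp]: "(\<lambda>t. 0) \<in> L2"
  by (simp add: L2_iff)

text \<open>Scalars, indicators, modulations, bounded windows and the dual weight all act on
  \<open>L2\<close> as multipliers, and each is an instance of this estimate.\<close>

lemma L2_mult_bounded:
  assumes f: "f \<in> L2" and p: "p \<in> borel_measurable lebesgue" and b: "AE t in lebesgue. cmod (p t) \<le> c" "0 \<le> c"
  shows "(\<lambda>t. p t * f t) \<in> L2" "L2n (\<lambda>t. p t * f t) \<le> c * L2n f"
proof -
  have m[measurable]: "f \<in> borel_measurable lebesgue" using f by (rule L2_measurable)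
  note p[measurable]
  have "(\<integral>\<^sup>+t. ennreal ((cmod (p t * f t))\<^sup>2) \<partial>lebesgue) \<le> (\<integral>\<^sup>+t. ennreal (c\<^sup>2) * ennreal ((cmod (f t))\<^sup>2) \<partial>lebesgue)"
    using b by (intro nn_integral_mono_AE)
      (auto simp: ennreal_mult'[symmetric] norm_mult power_mult_distrib intro!: mult_right_mono power_mono)
  also have "\<dots> = ennreal (c\<^sup>2) * (\<integral>\<^sup>+t. ennreal ((cmod (f t))\<^sup>2) \<partial>lebesgue)"
    by (rule nn_integral_cmult) measurable
  also have "\<dots> = ennreal ((c * L2n f)\<^sup>2)"
    by (simp add: nn_integral_L2n[OF f] ennreal_mult'[symmetric] power_mult_distrib)
  finally have *: "(\<integral>\<^sup>+t. ennreal ((cmod (p t * f t))\<^sup>2) \<partial>lebesgue) \<le> ennreal ((c * L2n f)\<^sup>2)" .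
  show **: "(\<lambda>t. p t * f t) \<in> L2"
    by (rule L2I[OF _ *]) measurable
  show "L2n (\<lambda>t. p t * f t) \<le> c * L2n f"
    by (rule L2n_le[OF ** *]) (simp add: b)
qed

lemma L2_cmult: "f \<in> L2 \<Longrightarrow> (\<lambda>t. c * f t) \<in> L2"
  by (rule L2_mult_bounded(1)[where c = "cmod c"]) auto

lemma L2_add:
  assumes "f \<in> L2" "h \<in> L2"
  shows "(\<lambda>t. f t + h t) \<in> L2"
proof -
  have [measurable]: "f \<in> borel_measurable lebesgue" "h \<in> borel_measurable lebesgue"
    using assms by (auto simp: L2_iff)
  have "integrable lebesgue (\<lambda>t. (cmod (f t + h t))\<^sup>2)"
  proof (rule Bochner_Integration.integrable_bound)
    show "integrable lebesgue (\<lambda>t. 2 * (cmod (f t))\<^sup>2 + 2 * (cmod (h t))\<^sup>2)"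
      using assms by (auto simp: L2_iff)
    show "AE t in lebesgue. norm ((cmod (f t + h t))\<^sup>2) \<le> norm (2 * (cmod (f t))\<^sup>2 + 2 * (cmod (h t))\<^sup>2)"
    proof (rule AE_I2)
      fix t
      have "(cmod (f t + h t))\<^sup>2 \<le> (cmod (f t) + cmod (h t))\<^sup>2"
        by (intro power_mono norm_triangle_ineq) auto
      also have "\<dots> \<le> 2 * (cmod (f t))\<^sup>2 + 2 * (cmod (h t))\<^sup>2"
        using sum_squares_bound[of "cmod (f t)" "cmod (h t)"] by (simp add: power2_sum)
      finally show "norm ((cmod (f t + h t))\<^sup>2) \<le> norm (2 * (cmod (f t))\<^sup>2 + 2 * (cmod (h t))\<^sup>2)"
        by simp
    qed
  qed measurable
  then show ?thesis by (simp add: L2_iff)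
qed

lemma L2_diff: "f \<in> L2 \<Longrightarrow> h \<in> L2 \<Longrightarrow> (\<lambda>t. f t - h t) \<in> L2"
  using L2_add[of f "\<lambda>t. (-1) * h t"] L2_cmult[of h "-1"] by simp

lemma L2_sum_finite:
  assumes "\<And>i. i \<in> F \<Longrightarrow> \<phi> i \<in> L2"
  shows "(\<lambda>t. \<Sum>i\<in>F. \<phi> i t) \<in> L2"
  using assms by (induction F rule: infinite_finite_induct) (auto intro: L2_add)

lemma L2_cnj: "f \<in> L2 \<Longrightarrow> (\<lambda>t. cnj (f t)) \<in> L2"
  by (auto simp: L2_iff intro: measurable_compose[OF _ borel_measurable_continuous_onI])

lemma L2_indicator:
  assumes "f \<in> L2" "A \<in> sets lebesgue"
  shows "(\<lambda>t. f t * indicator A t) \<in> L2" "L2n (\<lambda>t. f t * indicator A t) \<le> L2n f"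
  using L2_mult_bounded[OF assms(1), of "\<lambda>t. indicator A t" 1] assms(2)
  by (auto simp: mult.commute indicator_def)

lemma nn_Cauchy_Schwarz_L2:
  assumes "f \<in> L2" "h \<in> L2"
  shows "(\<integral>\<^sup>+t. ennreal (cmod (f t) * cmod (h t)) \<partial>lebesgue) \<le> ennreal (L2n f * L2n h)"
proof -
  have [measurable]: "f \<in> borel_measurable lebesgue" "h \<in> borel_measurable lebesgue"
    using assms by (auto simp: L2_iff)
  have "(\<integral>\<^sup>+t. ennreal (cmod (f t)) * ennreal (cmod (h t)) \<partial>lebesgue)\<^sup>2
    \<le> (\<integral>\<^sup>+t. (ennreal (cmod (f t)))\<^sup>2 \<partial>lebesgue) * (\<integral>\<^sup>+t. (ennreal (cmod (h t)))\<^sup>2 \<partial>lebesgue)"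
    by (rule Cauchy_Schwarz_nn_integral) measurable
  also have "\<dots> = (ennreal (L2n f * L2n h))\<^sup>2"
    by (simp add: ennreal_power nn_integral_L2n assms ennreal_mult'[symmetric] power_mult_distrib)
  finally have *: "(\<integral>\<^sup>+t. ennreal (cmod (f t) * cmod (h t)) \<partial>lebesgue)\<^sup>2 \<le> (ennreal (L2n f * L2n h))\<^sup>2"
    by (simp add: ennreal_mult)
  show ?thesis
  proof (cases "\<integral>\<^sup>+t. ennreal (cmod (f t) * cmod (h t)) \<partial>lebesgue")
    case (real r)
    with * show ?thesis
      by (auto simp: ennreal_power intro: power2_le_imp_le)
  next
    case top
    with * show ?thesis by (simp add: ennreal_power top_unique)
  qed
qed

lemma L2_integrable_mult:
  assumes "f \<in> L2" "h \<in> L2"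
  shows "integrable lebesgue (\<lambda>t. f t * h t)"
proof -
  have [measurable]: "f \<in> borel_measurable lebesgue" "h \<in> borel_measurable lebesgue"
    using assms by (auto simp: L2_iff)
  have "(\<integral>\<^sup>+t. ennreal (cmod (f t * h t)) \<partial>lebesgue) < \<infinity>"
    using nn_Cauchy_Schwarz_L2[OF assms] by (auto simp: norm_mult less_top[symmetric] top_unique)
  then show ?thesis by (intro integrableI_bounded) auto
qed

lemma L2_integrable: "f \<in> L2 \<Longrightarrow> h \<in> L2 \<Longrightarrow> integrable lebesgue (\<lambda>t. f t * cnj (h t))"
  by (intro L2_integrable_mult L2_cnj)

lemma L2_inner_le:
  assumes "f \<in> L2" "h \<in> L2"
  shows "cmod (L2_inner f h) \<le> L2n f * L2n h"
proof -
  have "ennreal (cmod (L2_inner f h)) \<le> (\<integral>\<^sup>+t. ennreal (cmod (f t * cnj (h t))) \<partial>lebesgue)"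
    unfolding L2_inner_def by (intro integral_norm_bound_ennreal L2_integrable assms)
  also have "\<dots> \<le> ennreal (L2n f * L2n h)"
    using nn_Cauchy_Schwarz_L2[OF assms] by (simp add: norm_mult)
  finally show ?thesis by (simp add: ennreal_le_iff)
qed

lemma L2_inner_cnj: "cnj (L2_inner f h) = L2_inner h f"
  unfolding L2_inner_def by (subst Bochner_Integration.integral_cnj[symmetric]) (simp add: mult.commute)

lemma cmod_L2_inner_commute: "cmod (L2_inner f h) = cmod (L2_inner h f)"
  by (simp add: L2_inner_cnj[symmetric, of f h])

lemma L2_inner_add_left:
  "f \<in> L2 \<Longrightarrow> f' \<in> L2 \<Longrightarrow> h \<in> L2 \<Longrightarrow> L2_inner (\<lambda>t. f t + f' t) h = L2_inner f h + L2_inner f' h"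
  by (simp add: L2_inner_def distrib_right L2_integrable)

lemma L2_inner_diff_left:
  "f \<in> L2 \<Longrightarrow> f' \<in> L2 \<Longrightarrow> h \<in> L2 \<Longrightarrow> L2_inner (\<lambda>t. f t - f' t) h = L2_inner f h - L2_inner f' h"
  by (simp add: L2_inner_def left_diff_distrib L2_integrable)

lemma L2_inner_diff_right:
  "f \<in> L2 \<Longrightarrow> f' \<in> L2 \<Longrightarrow> h \<in> L2 \<Longrightarrow> L2_inner h (\<lambda>t. f t - f' t) = L2_inner h f - L2_inner h f'"
  using L2_inner_diff_left[of f f' h] L2_inner_cnj by (metis complex_cnj_diff)

lemma L2_inner_cmult_left: "L2_inner (\<lambda>t. c * f t) h = c * L2_inner f h"
  by (simp add: L2_inner_def mult.assoc)

lemma L2_inner_sum_left: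
  assumes "\<And>i. i \<in> F \<Longrightarrow> \<phi> i \<in> L2" "h \<in> L2"
  shows "L2_inner (\<lambda>t. \<Sum>i\<in>F. \<phi> i t) h = (\<Sum>i\<in>F. L2_inner (\<phi> i) h)"
  using assms by (simp add: L2_inner_def sum_distrib_right L2_integrable)

lemma L2_inner_self: "f \<in> L2 \<Longrightarrow> L2_inner f f = of_real ((L2n f)\<^sup>2)"
  unfolding L2_inner_def L2n_power2 complex_norm_square[symmetric] by (rule integral_complex_of_real)

lemma L2n_eq: "(L2n f)\<^sup>2 = Re (L2_inner f f)" if "f \<in> L2"
  using L2_inner_self[OF that] by simp

text \<open>Pairing the sum with itself and applying Cauchy-Schwarz to each part bounds its squared
  norm by its norm times the sum of the norms. One factor is cancelled, with norm 0 treated apart;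
  this cancellation recurs in the duality arguments below.\<close>

lemma L2n_triangle:
  assumes "f \<in> L2" "h \<in> L2"
  shows "L2n (\<lambda>t. f t + h t) \<le> L2n f + L2n h"
proof -
  let ?s = "\<lambda>t. f t + h t"
  have s: "?s \<in> L2" using assms by (rule L2_add)
  have "(L2n ?s)\<^sup>2 = cmod (L2_inner f ?s + L2_inner h ?s)"
    unfolding L2_inner_add_left[OF assms s, symmetric] L2_inner_self[OF s] by (simp add: norm_power)
  also have "\<dots> \<le> L2n f * L2n ?s + L2n h * L2n ?s"
    by (intro norm_triangle_mono L2_inner_le assms s)
  finally have *: "L2n ?s * L2n ?s \<le> (L2n f + L2n h) * L2n ?s"
    by (simp add: power2_eq_square algebra_simps)
  show ?thesis
  proof (cases "L2n ?s = 0")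
    case False
    then have "0 < L2n ?s" by (simp add: less_le)
    with * show ?thesis by simp
  qed simp
qed

lemma L2n_minus: "L2n (\<lambda>t. h t - f t) = L2n (\<lambda>t. f t - h t)"
  by (simp add: L2n_def norm_minus_commute)

lemma L2n_triangle_diff:
  assumes "f \<in> L2" "h \<in> L2" "k \<in> L2"
  shows "L2n (\<lambda>t. f t - k t) \<le> L2n (\<lambda>t. f t - h t) + L2n (\<lambda>t. h t - k t)"
  using L2n_triangle[OF L2_diff[OF assms(1,2)] L2_diff[OF assms(2,3)]] by simp

subsection \<open>Riesz-Fischer theorem and Bessel sequences\<close>

text \<open>Completeness in quantitative form: geometric increments force almost everywhere
  convergence, and Fatou's lemma turns the pointwise limit into a norm limit.\<close>

lemma L2_rapidly_Cauchy_converges: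
  fixes u :: "nat \<Rightarrow> real \<Rightarrow> complex"
  assumes u: "\<And>n. u n \<in> L2" and cau: "\<And>n. L2n (\<lambda>t. u (Suc n) t - u n t) \<le> (1/2)^n"
  obtains h where "h \<in> L2" "(\<lambda>n. L2n (\<lambda>t. u n t - h t)) \<longlonglongrightarrow> 0"
proof -
  define d where "d = (\<lambda>n t. u (Suc n) t - u n t)"
  have d: "d n \<in> L2" for n unfolding d_def by (intro L2_diff u)
  have um[measurable]: "u n \<in> borel_measurable lebesgue" for n using u by (rule L2_measurable)
  have dm[measurable]: "d n \<in> borel_measurable lebesgue" for n using d by (rule L2_measurable)
  \<comment> \<open>Where the sequence diverges, \<open>lim\<close> is an unspecified value; this
    happens only on a null set.\<close>
  define h where "h = (\<lambda>t. lim (\<lambda>n. u n t))"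
  have hm[measurable]: "h \<in> borel_measurable lebesgue"
    unfolding h_def by measurable
  have "(\<integral>\<^sup>+t. (\<Sum>n. ennreal (2^n * (cmod (d n t))\<^sup>2)) \<partial>lebesgue) = (\<Sum>n. \<integral>\<^sup>+t. ennreal (2^n * (cmod (d n t))\<^sup>2) \<partial>lebesgue)"
    by (rule nn_integral_suminf) measurable
  also have "\<dots> = (\<Sum>n. ennreal (2^n * (L2n (d n))\<^sup>2))"
    by (simp add: ennreal_mult nn_integral_cmult nn_integral_L2n d)
  also have "\<dots> \<le> (\<Sum>n. ennreal ((1/2)^n))"
  proof (intro suminf_le ennreal_leI)
    fix n
    have "(L2n (d n))\<^sup>2 \<le> ((1/2)^n)\<^sup>2"
      using cau[of n] by (intro power_mono) (auto simp: d_def)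
    then have "2^n * (L2n (d n))\<^sup>2 \<le> 2^n * ((1/2)^n)\<^sup>2" by simp
    also have "\<dots> = (1/2)^n" by (simp add: power2_eq_square power_divide)
    finally show "2^n * (L2n (d n))\<^sup>2 \<le> (1/2)^n" .
  qed auto
  also have "\<dots> < \<infinity>"
    by (subst suminf_ennreal2) auto
  finally have "AE t in lebesgue. (\<Sum>n. ennreal (2^n * (cmod (d n t))\<^sup>2)) \<noteq> \<infinity>"
    by (intro nn_integral_PInf_AE) auto
  then have lim: "AE t in lebesgue. (\<lambda>n. u n t) \<longlonglongrightarrow> h t"
  proof eventually_elim
    case (elim t)
    have s1: "summable (\<lambda>n. 2^n * (cmod (d n t))\<^sup>2)"
      using elim by (intro summable_suminf_not_top) auto
    have "summable (\<lambda>n. (1/2)^n + 2^n * (cmod (d n t))\<^sup>2)"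
      by (intro summable_add s1) simp
    then have "summable (\<lambda>n. d n t)"
    proof (rule summable_comparison_test'[where N = 0])
      fix n :: nat
      \<comment> \<open>weighting the squares by \<open>2^n\<close> replaces Minkowski's inequality for infinite sums\<close>
      show "norm (d n t) \<le> (1/2)^n + 2^n * (cmod (d n t))\<^sup>2"
      proof (cases "norm (d n t) \<le> (1/2)^n")
        case False
        then have "1 \<le> 2^n * cmod (d n t)" by (simp add: power_divide field_simps)
        then have "cmod (d n t) * 1 \<le> cmod (d n t) * (2^n * cmod (d n t))" by (intro mult_left_mono) auto
        also have "\<dots> = 2^n * (cmod (d n t))\<^sup>2" by (simp add: power2_eq_square)
        finally show ?thesis by (simp add: add_increasing)
      qed (simp add: add_increasing2)
    qed
    then have "convergent (\<lambda>n. u 0 t + (\<Sum>i<n. d i t))"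
      by (intro convergent_add convergent_const) (simp add: summable_iff_convergent)
    moreover have "u 0 t + (\<Sum>i<n. d i t) = u n t" for n
      unfolding d_def by (subst sum_lessThan_telescope) simp
    ultimately show ?case
      unfolding h_def by (simp add: convergent_LIMSEQ_iff)
  qed
  have bd: "L2n (\<lambda>t. u m t - u n t) \<le> 2 * (1/2)^n" if "n \<le> m" for m n
  proof -
    \<comment> \<open>The subtracted term makes the bound exact for the geometric sum, so that the
      induction on \<open>m\<close> closes.\<close>
    have "L2n (\<lambda>t. u m t - u n t) \<le> 2 * (1/2)^n - 2 * (1/2)^m"
      using that
    proof (induction m rule: dec_induct)
      case base
      show ?case by (simp add: L2n_def)
    next
      case (step m)
      show ?case
        using L2n_triangle_diff[OF u[of "Suc m"] u[of m] u[of n]] step.IH cau[of m] by simp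
    qed
    also have "\<dots> \<le> 2 * (1/2)^n" by simp
    finally show ?thesis .
  qed
  have le: "(\<integral>\<^sup>+t. ennreal ((cmod (u n t - h t))\<^sup>2) \<partial>lebesgue) \<le> ennreal ((2 * (1/2)^n)\<^sup>2)" for n
  proof -
    have "(\<integral>\<^sup>+t. ennreal ((cmod (u n t - h t))\<^sup>2) \<partial>lebesgue)
      = (\<integral>\<^sup>+t. liminf (\<lambda>m. ennreal ((cmod (u n t - u m t))\<^sup>2)) \<partial>lebesgue)"
      using lim
    proof (intro nn_integral_cong_AE, eventually_elim)
      case (elim t)
      have "(\<lambda>m. ennreal ((cmod (u n t - u m t))\<^sup>2)) \<longlonglongrightarrow> ennreal ((cmod (u n t - h t))\<^sup>2)"
        by (intro tendsto_ennrealI tendsto_intros elim)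
      then show ?case by (rule lim_imp_Liminf[OF trivial_limit_sequentially, symmetric])
    qed
    \<comment> \<open>Fatou's lemma in the variable \<open>m\<close>, with \<open>n\<close>
      fixed.\<close>
    also have "\<dots> \<le> liminf (\<lambda>m. \<integral>\<^sup>+t. ennreal ((cmod (u n t - u m t))\<^sup>2) \<partial>lebesgue)"
      by (rule nn_integral_liminf) measurable
    also have "\<dots> \<le> ennreal ((2 * (1/2)^n)\<^sup>2)"
    proof (rule Liminf_le)
      show "\<forall>\<^sub>F m in sequentially. (\<integral>\<^sup>+t. ennreal ((cmod (u n t - u m t))\<^sup>2) \<partial>lebesgue) \<le> ennreal ((2 * (1/2)^n)\<^sup>2)"
        using eventually_ge_at_top[of n]
      proof eventually_elim
        case (elim m)
        show ?case
          using bd[OF elim] unfolding nn_integral_L2n[OF L2_diff[OF u u]] L2n_minus[of "u n"]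
          by (intro ennreal_leI power_mono) auto
      qed
    qed simp
    finally show ?thesis .
  qed
  have dl: "(\<lambda>t. u n t - h t) \<in> L2" for n
    by (rule L2I[OF _ le]) measurable
  have "h \<in> L2"
    using L2_diff[OF u[of 0] dl[of 0]] by simp
  moreover have "(\<lambda>n. L2n (\<lambda>t. u n t - h t)) \<longlonglongrightarrow> 0"
  proof (rule tendsto_sandwich[where f = "\<lambda>_. 0" and h = "\<lambda>n. 2 * (1/2)^n"])
    show "\<forall>\<^sub>F n in sequentially. L2n (\<lambda>t. u n t - h t) \<le> 2 * (1/2)^n"
      by (intro always_eventually allI L2n_le[OF dl le]) simp
    show "(\<lambda>n. 2 * (1/2)^n :: real) \<longlonglongrightarrow> 0"
      by (intro tendsto_mult_right_zero LIMSEQ_realpow_zero) auto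
  qed auto
  ultimately show ?thesis by (rule that)
qed

text \<open>Cauchy-Schwarz makes the inner product continuous in the norm. Since
  \<open>L2_sum\<close> is defined by choice, pairing with a fixed \<open>h\<close> is how its value
  gets used.\<close>

lemma L2_has_sum_inner:
  assumes \<psi>: "\<And>i. \<psi> i \<in> L2" and s: "L2_has_sum \<psi> s" and h: "h \<in> L2"
  shows "((\<lambda>i. L2_inner (\<psi> i) h) has_sum L2_inner s h) UNIV"
proof -
  have sL: "s \<in> L2" using s by (simp add: L2_has_sum_def)
  have d: "(\<lambda>t. (\<Sum>i\<in>F. \<psi> i t) - s t) \<in> L2" for F
    by (intro L2_diff L2_sum_finite \<psi> sL)
  have "((\<lambda>F. ennreal (L2n (\<lambda>t. (\<Sum>i\<in>F. \<psi> i t) - s t))) \<longlongrightarrow> ennreal 0) (finite_subsets_at_top UNIV)"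
    using s by (simp add: L2_has_sum_def L2_norm_eq d)
  then have "((\<lambda>F. L2n (\<lambda>t. (\<Sum>i\<in>F. \<psi> i t) - s t)) \<longlongrightarrow> 0) (finite_subsets_at_top UNIV)"
    by (subst (asm) tendsto_ennreal_iff) auto
  then have lim: "((\<lambda>F. L2n (\<lambda>t. (\<Sum>i\<in>F. \<psi> i t) - s t) * L2n h) \<longlongrightarrow> 0) (finite_subsets_at_top UNIV)"
    by (rule tendsto_mult_left_zero)
  have "((\<lambda>F. (\<Sum>i\<in>F. L2_inner (\<psi> i) h) - L2_inner s h) \<longlongrightarrow> 0) (finite_subsets_at_top UNIV)"
  proof (rule Lim_null_comparison[OF _ lim], rule always_eventually, rule allI)
    fix F
    have "(\<Sum>i\<in>F. L2_inner (\<psi> i) h) - L2_inner s h = L2_inner (\<lambda>t. (\<Sum>i\<in>F. \<psi> i t) - s t) h"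
      by (simp add: L2_inner_diff_left L2_inner_sum_left L2_sum_finite \<psi> sL h)
    then show "norm ((\<Sum>i\<in>F. L2_inner (\<psi> i) h) - L2_inner s h) \<le> L2n (\<lambda>t. (\<Sum>i\<in>F. \<psi> i t) - s t) * L2n h"
      by (simp add: L2_inner_le d h)
  qed
  then show ?thesis
    unfolding has_sum_def by (simp add: LIM_zero_iff)
qed

lemma ennreal_sum_le_infsum:
  fixes f :: "'i \<Rightarrow> ennreal"
  assumes "finite F" "F \<subseteq> A"
  shows "(\<Sum>i\<in>F. f i) \<le> (\<Sum>\<^sub>\<infinity>i\<in>A. f i)"
  unfolding infsum_finite[OF assms(1), of f, symmetric]
  by (rule infsum_mono_neutral) (use assms in \<open>auto intro: nonneg_summable_on_complete\<close>)

text \<open>Real finite sums in place of an extended infinite one, with the constant explicit and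
  nonnegative, as needed for products and square roots of two such constants.\<close>

definition bessel_bound :: "('i \<Rightarrow> real \<Rightarrow> complex) \<Rightarrow> real \<Rightarrow> bool" where
  "bessel_bound \<phi> B \<longleftrightarrow> (\<forall>i. \<phi> i \<in> L2) \<and> 0 \<le> B \<and>
     (\<forall>f\<in>L2. \<forall>F. finite F \<longrightarrow> (\<Sum>i\<in>F. (cmod (L2_inner f (\<phi> i)))\<^sup>2) \<le> B * (L2n f)\<^sup>2)"

lemma bessel_bound_L2: "bessel_bound \<phi> B \<Longrightarrow> \<phi> i \<in> L2"
  by (simp add: bessel_bound_def)

lemma bessel_boundI:
  assumes "range \<phi> \<subseteq> L2"
    and "\<And>f. f \<in> L2 \<Longrightarrow> (\<Sum>\<^sub>\<infinity>i. ennreal ((cmod (L2_inner f (\<phi> i)))\<^sup>2)) \<le> ennreal B * (L2_norm f)\<^sup>2"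
  shows "bessel_bound \<phi> (max 0 B)"
  unfolding bessel_bound_def
proof (intro conjI allI ballI impI)
  fix f :: "real \<Rightarrow> complex" and F :: "'a set" assume f: "f \<in> L2" and F: "finite F"
  have "ennreal (\<Sum>i\<in>F. (cmod (L2_inner f (\<phi> i)))\<^sup>2) = (\<Sum>i\<in>F. ennreal ((cmod (L2_inner f (\<phi> i)))\<^sup>2))"
    by (simp add: sum_ennreal)
  also have "\<dots> \<le> (\<Sum>\<^sub>\<infinity>i. ennreal ((cmod (L2_inner f (\<phi> i)))\<^sup>2))"
    by (rule ennreal_sum_le_infsum) (use F in auto)
  also have "\<dots> \<le> ennreal B * (L2_norm f)\<^sup>2" by (rule assms(2)[OF f])
  also have "\<dots> = ennreal (max 0 B) * ennreal ((L2n f)\<^sup>2)"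
    by (simp add: L2_norm_eq f ennreal_power ennreal_max_0)
  also have "\<dots> = ennreal (max 0 B * (L2n f)\<^sup>2)"
    by (simp add: ennreal_mult)
  finally show "(\<Sum>i\<in>F. (cmod (L2_inner f (\<phi> i)))\<^sup>2) \<le> max 0 B * (L2n f)\<^sup>2"
    by (simp add: ennreal_le_iff)
qed (use assms(1) in auto)

text \<open>Synthesis is the adjoint of analysis: pair the sum with itself, apply Cauchy-Schwarz to
  the coefficients and the Bessel inequality to the sum, and cancel its squared norm.\<close>

lemma bessel_synthesis_bound:
  assumes B: "bessel_bound \<phi> B" and F: "finite F"
  shows "(L2n (\<lambda>t. \<Sum>i\<in>F. c i * \<phi> i t))\<^sup>2 \<le> B * (\<Sum>i\<in>F. (cmod (c i))\<^sup>2)"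
proof -
  let ?s = "\<lambda>t. \<Sum>i\<in>F. c i * \<phi> i t"
  have \<phi>: "\<phi> i \<in> L2" for i using B by (simp add: bessel_bound_def)
  have s: "?s \<in> L2" by (intro L2_sum_finite L2_cmult \<phi>)
  have "(L2n ?s)\<^sup>2 = cmod (\<Sum>i\<in>F. c i * L2_inner (\<phi> i) ?s)"
    using L2_inner_self[OF s]
    by (subst (asm) L2_inner_sum_left) (auto simp: L2_cmult \<phi> s L2_inner_cmult_left norm_power)
  also have "\<dots> \<le> (\<Sum>i\<in>F. cmod (c i) * cmod (L2_inner ?s (\<phi> i)))"
    by (rule sum_norm_le) (simp add: norm_mult cmod_L2_inner_commute)
  finally have "((L2n ?s)\<^sup>2)\<^sup>2 \<le> (\<Sum>i\<in>F. cmod (c i) * cmod (L2_inner ?s (\<phi> i)))\<^sup>2"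
    by (intro power_mono) auto
  also have "\<dots> \<le> (\<Sum>i\<in>F. (cmod (c i))\<^sup>2) * (\<Sum>i\<in>F. (cmod (L2_inner ?s (\<phi> i)))\<^sup>2)"
    by (rule Cauchy_Schwarz_ineq_sum)
  also have "\<dots> \<le> (\<Sum>i\<in>F. (cmod (c i))\<^sup>2) * (B * (L2n ?s)\<^sup>2)"
    using B F s by (intro mult_left_mono sum_nonneg) (auto simp: bessel_bound_def)
  finally have *: "(L2n ?s)\<^sup>2 * (L2n ?s)\<^sup>2 \<le> (B * (\<Sum>i\<in>F. (cmod (c i))\<^sup>2)) * (L2n ?s)\<^sup>2"
    by (simp add: power2_eq_square algebra_simps)
  show ?thesis
  proof (cases "(L2n ?s)\<^sup>2 = 0")
    case True
    then show ?thesis using B by (simp add: bessel_bound_def sum_nonneg)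
  next
    case False
    then have "0 < (L2n ?s)\<^sup>2" by simp
    with * show ?thesis by (rule mult_right_le_imp_le)
  qed
qed

text \<open>Unconditional convergence is convergence along a net of finite sets, while the
  completeness result is sequential. An increasing sequence of finite sets \<open>E n\<close> with
  geometrically small tails supplies a limit, and every finite set above \<open>E n\<close> has a
  partial sum close to that of \<open>E n\<close>.\<close>

lemma bessel_synthesis_summable:
  assumes B: "bessel_bound \<phi> B" and c: "(\<lambda>i. (cmod (c i))\<^sup>2) summable_on UNIV"
  shows "L2_summable (\<lambda>i t. c i * \<phi> i t)"
proof -
  have \<phi>: "\<phi> i \<in> L2" for i using B by (auto simp: bessel_bound_def)
  have B0: "0 \<le> B" using B by (auto simp: bessel_bound_def)
  define S where "S = (\<lambda>F t. \<Sum>i\<in>F. c i * \<phi> i t)"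
  have S: "S F \<in> L2" for F unfolding S_def by (intro L2_sum_finite L2_cmult \<phi>)
  define q where "q = (\<lambda>F. \<Sum>i\<in>F. (cmod (c i))\<^sup>2)"
  define Q where "Q = (\<Sum>\<^sub>\<infinity>i. (cmod (c i))\<^sup>2)"
  have lim: "(q \<longlongrightarrow> Q) (finite_subsets_at_top UNIV)"
    unfolding q_def Q_def using has_sum_infsum[OF c] by (simp add: has_sum_def)
  have qle: "q F \<le> Q" if "finite F" for F
    unfolding q_def Q_def using that by (intro finite_sum_le_infsum c) auto
  have dif: "(L2n (\<lambda>t. S F t - S E t))\<^sup>2 \<le> B * (Q - q E)" if "finite F" "E \<subseteq> F" for E F
  proof -
    have fE: "finite E" using that finite_subset by blast
    have "S F t - S E t = S (F - E) t" for t
      unfolding S_def using that fE by (simp add: sum_diff)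
    then have "(L2n (\<lambda>t. S F t - S E t))\<^sup>2 \<le> B * q (F - E)"
      using bessel_synthesis_bound[OF B, of "F - E" c] that by (simp add: S_def q_def)
    also have "q (F - E) = q F - q E" unfolding q_def using that fE by (simp add: sum_diff)
    also have "B * (q F - q E) \<le> B * (Q - q E)" using qle[OF that(1)] B0 by (intro mult_left_mono) auto
    finally show ?thesis .
  qed
  have ex: "\<exists>E. finite E \<and> B * (Q - q E) \<le> e" if "0 < e" for e
  proof -
    have "((\<lambda>F. B * (Q - q F)) \<longlongrightarrow> B * (Q - Q)) (finite_subsets_at_top UNIV)"
      by (intro tendsto_intros lim)
    then have "\<forall>\<^sub>F F in finite_subsets_at_top UNIV. B * (Q - q F) < e"
      using that by (intro order_tendstoD(2)) auto
    then show ?thesis unfolding eventually_finite_subsets_at_top by (meson less_imp_le order_refl subset_UNIV)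
  qed
  have mono: "B * (Q - q F) \<le> B * (Q - q E)" if "finite F" "E \<subseteq> F" for E F
    unfolding q_def using that B0 by (intro mult_left_mono diff_left_mono sum_mono2) auto
  \<comment> \<open>The threshold is squared because \<open>dif\<close> controls the square of the
    norm.\<close>
  define G where "G = (\<lambda>n. SOME E. finite E \<and> B * (Q - q E) \<le> ((1/2)^n)\<^sup>2)"
  have G: "finite (G n)" "B * (Q - q (G n)) \<le> ((1/2)^n)\<^sup>2" for n
    using someI_ex[OF ex[of "((1/2)^n)\<^sup>2"]] by (auto simp: G_def)
  \<comment> \<open>Unions make the chosen sets increasing, which the choice alone does not ensure;
    enlarging a set only shrinks its tail.\<close>
  define E where "E = (\<lambda>n. \<Union>i\<le>n. G i)"
  have E: "finite (E n)" "E n \<subseteq> E (Suc n)" "B * (Q - q (E n)) \<le> ((1/2)^n)\<^sup>2" for n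
  proof -
    show f: "finite (E n)" unfolding E_def using G by auto
    show "E n \<subseteq> E (Suc n)" unfolding E_def by (rule UN_mono) simp_all
    have "G n \<subseteq> E n" unfolding E_def by auto
    from mono[OF f this] G(2)[of n] show "B * (Q - q (E n)) \<le> ((1/2)^n)\<^sup>2" by linarith
  qed
  have near: "L2n (\<lambda>t. S F t - S (E n) t) \<le> (1/2)^n" if "finite F" "E n \<subseteq> F" for n F
    by (rule power2_le_imp_le[OF order_trans[OF dif[OF that] E(3)]]) simp
  obtain h where h: "h \<in> L2" "(\<lambda>n. L2n (\<lambda>t. S (E n) t - h t)) \<longlonglongrightarrow> 0"
    by (rule L2_rapidly_Cauchy_converges[of "\<lambda>n. S (E n)", OF S near[OF E(1) E(2)]])
  have "((\<lambda>F. L2n (\<lambda>t. S F t - h t)) \<longlongrightarrow> 0) (finite_subsets_at_top UNIV)"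
  proof (rule tendstoI)
    fix e :: real assume e: "0 < e"
    have "(\<lambda>n. (1/2)^n + L2n (\<lambda>t. S (E n) t - h t)) \<longlonglongrightarrow> 0 + 0"
      by (intro tendsto_add h LIMSEQ_realpow_zero) auto
    then have "\<forall>\<^sub>F n in sequentially. (1/2)^n + L2n (\<lambda>t. S (E n) t - h t) < e"
      using e by (intro order_tendstoD(2)) auto
    then obtain n where n: "(1/2)^n + L2n (\<lambda>t. S (E n) t - h t) < e"
      by (auto simp: eventually_sequentially)
    show "\<forall>\<^sub>F F in finite_subsets_at_top UNIV. dist (L2n (\<lambda>t. S F t - h t)) 0 < e"
      unfolding eventually_finite_subsets_at_top
    proof (intro exI[of _ "E n"] conjI allI impI)
      fix F assume "finite F \<and> E n \<subseteq> F \<and> F \<subseteq> UNIV"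
      then have "L2n (\<lambda>t. S F t - h t) < e"
        using L2n_triangle_diff[OF S[of F] S[of "E n"] h(1)] near[of F n] n by linarith
      then show "dist (L2n (\<lambda>t. S F t - h t)) 0 < e" by simp
    qed (auto simp: E)
  qed
  then have "((\<lambda>F. ennreal (L2n (\<lambda>t. S F t - h t))) \<longlongrightarrow> ennreal 0) (finite_subsets_at_top UNIV)"
    by (rule tendsto_ennrealI)
  then show ?thesis
    unfolding L2_summable_def L2_has_sum_def
    using h(1) L2_norm_eq[OF L2_diff[OF S h(1)]] by (auto simp: S_def)
qed

lemma bessel_coeffs_summable:
  assumes B: "bessel_bound \<phi> B" and f: "f \<in> L2"
  shows "(\<lambda>i. (cmod (L2_inner f (\<phi> i)))\<^sup>2) summable_on UNIV"
proof (rule nonneg_bdd_above_summable_on)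
  show "bdd_above (sum (\<lambda>i. (cmod (L2_inner f (\<phi> i)))\<^sup>2) ` {F. F \<subseteq> UNIV \<and> finite F})"
    using B f by (intro bdd_aboveI2[where M = "B * (L2n f)\<^sup>2"]) (auto simp: bessel_bound_def)
qed auto

text \<open>Cauchy-Schwarz for the two coefficient sequences. This makes the form jointly
  continuous, which later removes the restriction to compact supports.\<close>

lemma bessel_form_bound:
  assumes A: "bessel_bound \<phi> A" and B: "bessel_bound \<psi> B" and f: "f \<in> L2" and h: "h \<in> L2"
    and s: "((\<lambda>i. L2_inner f (\<phi> i) * L2_inner (\<psi> i) h) has_sum s) UNIV"
  shows "cmod s \<le> sqrt (A * B) * L2n f * L2n h"
proof (rule tendsto_upperbound)
  show "((\<lambda>F. cmod (\<Sum>i\<in>F. L2_inner f (\<phi> i) * L2_inner (\<psi> i) h)) \<longlongrightarrow> cmod s) (finite_subsets_at_top UNIV)"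
    using s by (intro tendsto_norm) (simp add: has_sum_def)
  show "\<forall>\<^sub>F F in finite_subsets_at_top UNIV. cmod (\<Sum>i\<in>F. L2_inner f (\<phi> i) * L2_inner (\<psi> i) h) \<le> sqrt (A * B) * L2n f * L2n h"
  proof (rule eventually_finite_subsets_at_top_weakI)
    fix F :: "'a set" assume F: "finite F"
    have "cmod (\<Sum>i\<in>F. L2_inner f (\<phi> i) * L2_inner (\<psi> i) h) \<le> (\<Sum>i\<in>F. cmod (L2_inner f (\<phi> i)) * cmod (L2_inner h (\<psi> i)))"
      by (rule sum_norm_le) (simp add: norm_mult cmod_L2_inner_commute)
    also have "\<dots> \<le> sqrt ((A * (L2n f)\<^sup>2) * (B * (L2n h)\<^sup>2))"
    proof (rule real_le_rsqrt, rule order_trans[OF Cauchy_Schwarz_ineq_sum], rule mult_mono)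
      show "(\<Sum>i\<in>F. (cmod (L2_inner f (\<phi> i)))\<^sup>2) \<le> A * (L2n f)\<^sup>2"
        "(\<Sum>i\<in>F. (cmod (L2_inner h (\<psi> i)))\<^sup>2) \<le> B * (L2n h)\<^sup>2"
        "0 \<le> A * (L2n f)\<^sup>2"
        using A B f h F by (auto simp: bessel_bound_def)
    qed (simp add: sum_nonneg)
    also have "\<dots> = sqrt (A * B) * L2n f * L2n h"
      by (simp add: real_sqrt_mult)
    finally show "cmod (\<Sum>i\<in>F. L2_inner f (\<phi> i) * L2_inner (\<psi> i) h) \<le> sqrt (A * B) * L2n f * L2n h" .
  qed
qed simp

subsection \<open>Completeness of the exponentials on an interval\<close>

definition expo :: "real \<Rightarrow> real \<Rightarrow> complex" where
  "expo \<omega> t = exp (2 * complex_of_real pi * \<i> * complex_of_real (\<omega> * t))"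

lemma modulation_expo: "modulation \<omega> g t = expo \<omega> t * g t"
  by (simp add: modulation_def expo_def)

lemma expo_cis: "expo \<omega> t = cis (2 * pi * \<omega> * t)"
  by (simp add: expo_def cis_conv_exp mult_ac)

lemma norm_expo[simp]: "cmod (expo \<omega> t) = 1"
  by (simp add: expo_cis)

lemma cnj_expo: "cnj (expo \<omega> t) = expo (- \<omega>) t"
  by (simp add: expo_cis cis_cnj)

lemma expo_0[simp]: "expo 0 t = 1"
  by (simp add: expo_def)

lemma expo_add: "expo (x + y) t = expo x t * expo y t"
  by (simp add: expo_cis cis_mult algebra_simps)

lemma continuous_expo: "continuous_on A (expo \<omega>)"
  unfolding expo_def by (intro continuous_intros)

lemma measurable_expo_lborel[measurable]: "expo \<omega> \<in> borel_measurable borel"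
  by (intro borel_measurable_continuous_onI continuous_expo)

lemma measurable_expo[measurable]: "expo \<omega> \<in> borel_measurable lebesgue"
  using measurable_expo_lborel[of \<omega>] by (intro measurable_completion) simp

lemma L2_modulation: "f \<in> L2 \<Longrightarrow> modulation \<omega> f \<in> L2"
  unfolding modulation_expo[abs_def] by (rule L2_mult_bounded(1)[where c = 1]) auto

lemma integral_expo_period:
  assumes T: "0 < T" "T = inverse b"
  shows "(LINT t|lebesgue. expo (of_int n * b) t * indicator {\<alpha>..\<alpha>+T} t) = (if n = 0 then of_real T else 0)"
proof (cases "n = 0")
  case True
  have "(LINT t|lebesgue. complex_of_real (indicator {\<alpha>..\<alpha>+T} t)) = of_real T"
    unfolding integral_complex_of_real using T(1) by simp
  then have "(LINT t|lebesgue. (indicator {\<alpha>..\<alpha>+T} t :: complex)) = of_real T"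
    by (simp add: of_real_indicator)
  with True show ?thesis by simp
next
  case False
  define c where "c = 2 * complex_of_real pi * \<i> * complex_of_real (of_int n * b)"
  have b: "b \<noteq> 0" using T by auto
  have c: "c \<noteq> 0" using False b by (simp add: c_def)
  have e: "expo (of_int n * b) t = exp (c * of_real t)" for t
    by (simp add: expo_def c_def mult_ac)
  have "(LINT t|lborel. indicator {\<alpha>..\<alpha>+T} t *\<^sub>R exp (c * of_real t)) = exp (c * of_real (\<alpha> + T)) / c - exp (c * of_real \<alpha>) / c"
  proof (rule integral_FTC_atLeastAtMost)
    show "\<alpha> \<le> \<alpha> + T" using T by simp
    show "((\<lambda>t. exp (c * of_real t) / c) has_vector_derivative exp (c * of_real x)) (at x within {\<alpha>..\<alpha> + T})" for x
      by (rule has_vector_derivative_real_field) (use c in \<open>auto intro!: derivative_eq_intros\<close>)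
    show "continuous_on {\<alpha>..\<alpha> + T} (\<lambda>t. exp (c * of_real t))" by (intro continuous_intros)
  qed
  \<comment> \<open>\<open>T\<close> is the inverse of \<open>b\<close>, so a full period changes
    the exponent by an integral multiple of \<open>2 * pi * \<i>\<close>.\<close>
  also have "exp (c * of_real (\<alpha> + T)) = exp (c * of_real \<alpha>)"
  proof -
    have "c * of_real (\<alpha> + T) = c * of_real \<alpha> + of_real (of_int (2 * n) * pi) * \<i>"
      using T b by (simp add: c_def algebra_simps)
    then show ?thesis unfolding exp_eq by blast
  qed
  finally have "(LINT t|lborel. indicator {\<alpha>..\<alpha>+T} t *\<^sub>R exp (c * of_real t)) = 0" by simp
  moreover have "(LINT t|lebesgue. indicator {\<alpha>..\<alpha>+T} t *\<^sub>R exp (c * of_real t)) = (LINT t|lborel. indicator {\<alpha>..\<alpha>+T} t *\<^sub>R exp (c * of_real t))"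
    by (intro integral_completion) measurable
  ultimately have "(LINT t|lebesgue. exp (c * of_real t) * indicator {\<alpha>..\<alpha>+T} t) = 0"
    by (simp add: scaleR_conv_of_real of_real_indicator mult.commute)
  then show ?thesis
    using False by (simp only: e if_False)
qed

section \<open>Integrable functions with vanishing Fourier coefficients\<close>

lemma borel_measurable_mult_indicator:
  fixes f :: "'a \<Rightarrow> 'b::{second_countable_topology, real_normed_algebra_1}"
  assumes "f \<in> borel_measurable M" "A \<in> sets M"
  shows "(\<lambda>t. f t * indicator A t) \<in> borel_measurable M"
  using assms by measurable

text \<open>The positive and the negative part of the function are densities of finite measures that
  agree on all half-lines and hence coincide. Uniqueness of densities makes the two parts equal
  almost everywhere, so both vanish.\<close>

lemma AE_zero_if_integral_greaterThan_zero:
  fixes r :: "real \<Rightarrow> real"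
  assumes r: "integrable lebesgue r" and z: "\<And>x. (LINT t|lebesgue. r t * indicator {x<..} t) = 0"
  shows "AE t in lebesgue. r t = 0"
proof -
  \<comment> \<open>Half-lines generate the Borel sets only, so the function is replaced by a Borel
    version.\<close>
  obtain q where q[measurable]: "q \<in> borel_measurable lborel" and rq: "AE t in lborel. r t = q t"
    using completion_ex_borel_measurable_real[of r lborel] r by auto
  have rq': "AE t in lebesgue. r t = q t" using rq by (rule AE_completion)
  have iq: "integrable lborel q"
  proof -
    have "integrable lebesgue q"
      by (rule integrable_cong_AE_imp[OF r measurable_completion[OF q]])
        (use rq' in eventually_elim, simp)
    then show ?thesis by (simp add: integrable_completion)
  qed
  have zq: "(LINT t|lborel. q t * indicator {x<..} t) = 0" for x
  proof -
    have "(LINT t|lborel. q t * indicator {x<..} t) = (LINT t|lebesgue. q t * indicator {x<..} t)"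
      by (rule integral_completion[symmetric]) measurable
    also have "\<dots> = (LINT t|lebesgue. r t * indicator {x<..} t)"
    proof (rule integral_cong_AE)
      note measurable_completion[OF q, measurable] borel_measurable_integrable[OF r, measurable]
      show "(\<lambda>t. q t * indicator {x<..} t) \<in> borel_measurable lebesgue"
        "(\<lambda>t. r t * indicator {x<..} t) \<in> borel_measurable lebesgue"
        by (rule borel_measurable_mult_indicator; simp)+
    qed (use rq' in eventually_elim, simp)
    finally show ?thesis using z by simp
  qed
  \<comment> \<open>\<open>ennreal\<close> sends negative numbers to 0, so \<open>s = 1\<close> and
    \<open>s = -1\<close> give the positive and the negative part of \<open>q\<close> as
    densities.\<close>
  define M where "M = (\<lambda>s. density lborel (\<lambda>t. ennreal (s * q t)))"
  have eM: "emeasure (M s) {x<..} = ennreal (LINT t|lborel. max 0 (s * q t) * indicator {x<..} t)" for s x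
  proof -
    have "emeasure (M s) {x<..} = (\<integral>\<^sup>+t. ennreal (max 0 (s * q t) * indicator {x<..} t) \<partial>lborel)"
      unfolding M_def by (subst emeasure_density) (auto intro!: nn_integral_cong simp: indicator_def ennreal_max_0)
    also have "\<dots> = ennreal (LINT t|lborel. max 0 (s * q t) * indicator {x<..} t)"
      using iq by (intro nn_integral_eq_integral integrable_real_mult_indicator integrable_max) auto
    finally show ?thesis .
  qed
  have "M 1 = M (-1)"
  proof (rule measure_eqI_lessThan)
    fix x
    have "(LINT t|lborel. max 0 (q t) * indicator {x<..} t) - (LINT t|lborel. max 0 (- q t) * indicator {x<..} t)
       = (LINT t|lborel. max 0 (q t) * indicator {x<..} t - max 0 (- q t) * indicator {x<..} t)"
      using iq by (intro Bochner_Integration.integral_diff[symmetric] integrable_real_mult_indicator integrable_max) auto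
    also have "\<dots> = (LINT t|lborel. q t * indicator {x<..} t)"
      by (intro Bochner_Integration.integral_cong) (auto simp: indicator_def)
    finally show "emeasure (M 1) {x<..} = emeasure (M (-1)) {x<..}"
      using zq[of x] by (simp add: eM)
    show "emeasure (M 1) {x<..} < \<infinity>" by (simp add: eM)
  qed (simp_all add: M_def)
  then have "AE t in lborel. ennreal (1 * q t) = ennreal (-1 * q t)"
    unfolding M_def by (intro sigma_finite_measure.density_unique[OF sigma_finite_lborel]) auto
  then have "AE t in lborel. q t = 0"
  proof eventually_elim
    case (elim t)
    show ?case
    proof (cases "0 \<le> q t")
      case True
      then have "ennreal (q t) = 0" using elim by (simp add: ennreal_neg)
      then show ?thesis using True by (simp add: ennreal_eq_0_iff)
    next
      case False
      then have "ennreal (- q t) = 0" using elim by (simp add: ennreal_neg)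
      then show ?thesis using False by (simp add: ennreal_eq_0_iff)
    qed
  qed
  then have "AE t in lebesgue. q t = 0" by (rule AE_completion)
  with rq' show ?thesis by eventually_elim simp
qed

text \<open>The functions annihilated by all exponentials of period \<open>1/b\<close>. Since
  \<open>l\<close> runs through both signs, the integrals without conjugate are the Fourier
  coefficients up to reindexing. The support condition that forces such a function to vanish is
  imposed only at the end.\<close>

definition fourier_null :: "real \<Rightarrow> (real \<Rightarrow> complex) set" where
  "fourier_null b = {d. integrable lebesgue d \<and> (\<forall>l::int. (LINT t|lebesgue. d t * expo (of_int l * b) t) = 0)}"

text \<open>
  The functions whose multiplication preserves vanishing of all Fourier coefficients form an algebra that
  contains the exponentials, hence all polynomials on the circle; no explicit trigonometric sums are needed
  before applying the Stone-Weierstrass theorem.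
\<close>

definition null_multiplier :: "real \<Rightarrow> (real \<Rightarrow> complex) \<Rightarrow> bool" where
  "null_multiplier b q \<longleftrightarrow> (\<forall>d\<in>fourier_null b. (\<lambda>t. d t * q t) \<in> fourier_null b)"

lemma integrable_mult_expo: "integrable lebesgue d \<Longrightarrow> integrable lebesgue (\<lambda>t. d t * expo \<omega> t)"
  by (rule Bochner_Integration.integrable_bound[OF _ borel_measurable_times[OF borel_measurable_integrable measurable_expo]])
    (auto simp: norm_mult)

lemma fourier_null_cmult: "d \<in> fourier_null b \<Longrightarrow> (\<lambda>t. d t * c) \<in> fourier_null b"
  unfolding fourier_null_def by (auto simp: mult.assoc mult.left_commute[of _ c] mult.commute[of _ c])

lemma fourier_null_add:
  assumes "d \<in> fourier_null b" "e \<in> fourier_null b"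
  shows "(\<lambda>t. d t + e t) \<in> fourier_null b"
  using assms unfolding fourier_null_def by (auto simp: distrib_right integrable_mult_expo)

lemma null_multiplier_const: "null_multiplier b (\<lambda>t. c)"
  by (simp add: null_multiplier_def fourier_null_cmult)

lemma null_multiplier_add:
  "null_multiplier b p \<Longrightarrow> null_multiplier b q \<Longrightarrow> null_multiplier b (\<lambda>t. p t + q t)"
  unfolding null_multiplier_def by (auto simp: distrib_left intro: fourier_null_add)

lemma null_multiplier_mult:
  "null_multiplier b p \<Longrightarrow> null_multiplier b q \<Longrightarrow> null_multiplier b (\<lambda>t. p t * q t)"
  unfolding null_multiplier_def by (auto simp: mult.assoc[symmetric])

lemma null_multiplier_expo: "null_multiplier b (expo (of_int n * b))"
  unfolding null_multiplier_def fourier_null_def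
proof (intro ballI CollectI conjI allI; elim CollectE conjE)
  fix d :: "real \<Rightarrow> complex" and l :: int
  assume d: "integrable lebesgue d" and z: "\<forall>l::int. (LINT t|lebesgue. d t * expo (of_int l * b) t) = 0"
  show "integrable lebesgue (\<lambda>t. d t * expo (of_int n * b) t)" using d by (rule integrable_mult_expo)
  have "expo (of_int n * b) t * expo (of_int l * b) t = expo (of_int (n + l) * b) t" for t
    by (simp add: expo_add[symmetric] distrib_right)
  then show "(LINT t|lebesgue. d t * expo (of_int n * b) t * expo (of_int l * b) t) = 0"
    using z[rule_format, of "n + l"] by (simp add: mult.assoc)
qed

lemma null_multiplier_polynomial:
  assumes "real_polynomial_function p"
  shows "null_multiplier b (\<lambda>t. of_real (p (expo b t)))"
  using assms
proof (induction p rule: real_polynomial_function.induct)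
  case (linear f)
  interpret f: bounded_linear f by (rule linear)
  \<comment> \<open>A real-linear functional on the complex plane has the form
    \<open>z * c + cnj z * cnj c\<close>; on the circle \<open>cnj z\<close> is the exponential of
    frequency \<open>-b\<close>, so \<open>f\<close> becomes a sum of two known multipliers.\<close>
  define c where "c = (of_real (f 1) - \<i> * of_real (f \<i>)) / 2"
  have *: "of_real (f (expo b t)) = expo (of_int 1 * b) t * c + expo (of_int (-1) * b) t * cnj c" for t
  proof -
    define z where "z = expo b t"
    have "f z = f (Re z *\<^sub>R 1 + Im z *\<^sub>R \<i>)"
      by (simp add: complex_eq[symmetric] scaleR_conv_of_real mult.commute)
    also have "\<dots> = Re z * f 1 + Im z * f \<i>" by (simp add: f.add f.scaleR)
    finally have "of_real (f z) = z * c + cnj z * cnj c"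
      by (simp add: c_def complex_eq_iff field_simps)
    then show ?thesis by (simp add: z_def cnj_expo)
  qed
  show ?case
    unfolding * by (intro null_multiplier_add null_multiplier_mult null_multiplier_const null_multiplier_expo)
next
  case (const c)
  show ?case by (rule null_multiplier_const)
next
  case (add f g)
  then show ?case by (simp add: null_multiplier_add)
next
  case (mult f g)
  then show ?case by (simp add: null_multiplier_mult)
qed

lemma fourier_null_integral_polynomial:
  assumes "d \<in> fourier_null b" "real_polynomial_function p"
  shows "integrable lebesgue (\<lambda>t. d t * of_real (p (expo b t)))" "(LINT t|lebesgue. d t * of_real (p (expo b t))) = 0"
proof -
  have "(\<lambda>t. d t * of_real (p (expo b t))) \<in> fourier_null b"
    using null_multiplier_polynomial[OF assms(2)] assms(1) by (simp add: null_multiplier_def)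
  then show "integrable lebesgue (\<lambda>t. d t * of_real (p (expo b t)))" "(LINT t|lebesgue. d t * of_real (p (expo b t))) = 0"
    by (auto simp: fourier_null_def dest: spec[of _ 0])
qed

text \<open>Polynomials are uniformly dense in the continuous functions on the circle, and
  \<open>d\<close> is integrable, so the integral against \<phi> is within any positive distance of
  0.\<close>

lemma fourier_null_integral_continuous:
  fixes \<phi> :: "complex \<Rightarrow> real"
  assumes d: "d \<in> fourier_null b" and \<phi>: "continuous_on UNIV \<phi>"
  shows "(LINT t|lebesgue. d t * of_real (\<phi> (expo b t))) = 0"
proof -
  have di: "integrable lebesgue d" using d by (simp add: fourier_null_def)
  note borel_measurable_integrable[OF di, measurable]
  have \<phi>m[measurable]: "\<phi> \<in> borel_measurable borel" using \<phi> by (rule borel_measurable_continuous_onI)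
  obtain K where K: "\<And>t. \<bar>\<phi> (expo b t)\<bar> \<le> K"
  proof -
    have "bounded (\<phi> ` sphere 0 1)"
      using \<phi> by (intro compact_imp_bounded compact_continuous_image) (auto intro: continuous_on_subset)
    then obtain K where "\<forall>x\<in>sphere 0 1. \<bar>\<phi> x\<bar> \<le> K" unfolding bounded_iff by fastforce
    then show ?thesis by (intro that[of K]) simp
  qed
  have i\<phi>: "integrable lebesgue (\<lambda>t. d t * of_real (\<phi> (expo b t)))"
  proof (rule Bochner_Integration.integrable_bound)
    show "integrable lebesgue (\<lambda>t. d t * of_real K)" using di by simp
    show "AE t in lebesgue. norm (d t * of_real (\<phi> (expo b t))) \<le> norm (d t * of_real K)"
    proof (rule AE_I2)
      fix t show "norm (d t * of_real (\<phi> (expo b t))) \<le> norm (d t * of_real K)"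
        unfolding norm_mult norm_of_real by (rule mult_left_mono) (use K[of t] in auto)
    qed
  qed measurable
  have "cmod (LINT t|lebesgue. d t * of_real (\<phi> (expo b t))) \<le> 0"
  proof (rule field_le_epsilon)
    fix e :: real assume e: "0 < e"
    define N where "N = (LINT t|lebesgue. cmod (d t))"
    have N: "0 \<le> N" by (simp add: N_def)
    \<comment> \<open>Adding 1 keeps the quotient defined when \<open>N\<close> is 0, and
      \<open>N * \<epsilon>\<close> is still at most \<open>e\<close>.\<close>
    define \<epsilon> where "\<epsilon> = e / (N + 1)"
    have \<epsilon>: "0 < \<epsilon>" using e N by (simp add: \<epsilon>_def)
    obtain p where p: "real_polynomial_function p" "\<And>x. x \<in> sphere 0 1 \<Longrightarrow> \<bar>\<phi> x - p x\<bar> < \<epsilon>"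
      using Stone_Weierstrass_real_polynomial_function[of "sphere (0::complex) 1" \<phi> \<epsilon>] \<phi> \<epsilon>
      by (metis compact_sphere continuous_on_subset subset_UNIV)
    have ip: "integrable lebesgue (\<lambda>t. d t * of_real (p (expo b t)))"
      and zp: "(LINT t|lebesgue. d t * of_real (p (expo b t))) = 0"
      using fourier_null_integral_polynomial[OF d p(1)] by auto
    have "(LINT t|lebesgue. d t * of_real (\<phi> (expo b t)))
      = (LINT t|lebesgue. d t * of_real (\<phi> (expo b t)) - d t * of_real (p (expo b t)))"
      using zp by (simp add: i\<phi> ip)
    also have "cmod \<dots> \<le> (LINT t|lebesgue. cmod (d t) * \<epsilon>)"
    proof (rule Bochner_Integration.integral_norm_bound_integral)
      show "integrable lebesgue (\<lambda>t. d t * of_real (\<phi> (expo b t)) - d t * of_real (p (expo b t)))"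
        using i\<phi> ip by (rule Bochner_Integration.integrable_diff)
      show "integrable lebesgue (\<lambda>t. cmod (d t) * \<epsilon>)" using di by simp
      fix t
      have "cmod (d t * of_real (\<phi> (expo b t)) - d t * of_real (p (expo b t))) = cmod (d t) * \<bar>\<phi> (expo b t) - p (expo b t)\<bar>"
        by (simp add: right_diff_distrib[symmetric] norm_mult of_real_diff[symmetric] del: of_real_diff)
      also have "\<dots> \<le> cmod (d t) * \<epsilon>"
        using p(2)[of "expo b t"] by (intro mult_left_mono) auto
      finally show "cmod (d t * of_real (\<phi> (expo b t)) - d t * of_real (p (expo b t))) \<le> cmod (d t) * \<epsilon>" .
    qed
    also have "\<dots> = N * \<epsilon>" by (simp add: N_def)
    also have "\<dots> \<le> e" using N e by (simp add: \<epsilon>_def field_simps)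
    finally show "cmod (LINT t|lebesgue. d t * of_real (\<phi> (expo b t))) \<le> 0 + e" by simp
  qed
  then show ?thesis by simp
qed

text \<open>The indicator of a closed set is the pointwise limit of the continuous functions
  \<open>max 0 (1 - n * infdist z C)\<close>, and \<open>cmod (d t)\<close> dominates. Nonemptiness
  matters since \<open>infdist\<close> to the empty set is 0.\<close>

lemma fourier_null_integral_closed:
  assumes d: "d \<in> fourier_null b" and C: "closed C" "C \<noteq> {}"
  shows "(LINT t|lebesgue. d t * indicator C (expo b t)) = 0"
proof -
  have di: "integrable lebesgue d" using d by (simp add: fourier_null_def)
  note borel_measurable_integrable[OF di, measurable]
  define \<phi> where "\<phi> = (\<lambda>n z. max 0 (1 - real n * infdist z C))"
  have \<phi>: "continuous_on UNIV (\<phi> n)" for n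
    unfolding \<phi>_def by (intro continuous_intros)
  have [measurable]: "\<phi> n \<in> borel_measurable borel" for n using \<phi> by (rule borel_measurable_continuous_onI)
  have [measurable]: "C \<in> sets borel" using C by auto
  have "(\<lambda>n. LINT t|lebesgue. d t * of_real (\<phi> n (expo b t))) \<longlonglongrightarrow> (LINT t|lebesgue. d t * indicator C (expo b t))"
  proof (rule integral_dominated_convergence[where w = "\<lambda>t. cmod (d t)"])
    show "AE t in lebesgue. (\<lambda>n. d t * of_real (\<phi> n (expo b t))) \<longlonglongrightarrow> d t * indicator C (expo b t)"
    proof (intro AE_I2 tendsto_mult_left)
      fix t
      define z where "z = expo b t"
      have "(\<lambda>n. \<phi> n z) \<longlonglongrightarrow> indicator C z"
      proof (cases "z \<in> C")
        case True
        then show ?thesis by (simp add: \<phi>_def)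
      next
        case False
        then have pos: "0 < infdist z C" using C by (simp add: infdist_pos_not_in_closed)
        obtain n0 where n0: "1 < real n0 * infdist z C" using reals_Archimedean3[OF pos] by blast
        have "\<forall>\<^sub>F n in sequentially. \<phi> n z = 0"
          using eventually_ge_at_top[of n0]
        proof eventually_elim
          case (elim n)
          have "real n0 * infdist z C \<le> real n * infdist z C" using elim pos by (intro mult_right_mono) auto
          then show ?case using n0 by (simp add: \<phi>_def)
        qed
        then show ?thesis using False by (simp add: tendsto_eventually)
      qed
      then have "(\<lambda>n. complex_of_real (\<phi> n z)) \<longlonglongrightarrow> of_real (indicator C z)" by (rule tendsto_of_real)
      then show "(\<lambda>n. complex_of_real (\<phi> n (expo b t))) \<longlonglongrightarrow> indicator C (expo b t)"
        by (simp add: z_def of_real_indicator)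
    qed
    show "integrable lebesgue (\<lambda>t. cmod (d t))" using di by simp
    fix n
    show "AE t in lebesgue. norm (d t * of_real (\<phi> n (expo b t))) \<le> cmod (d t)"
      by (rule AE_I2) (auto simp: norm_mult \<phi>_def infdist_nonneg intro!: mult_left_le)
  qed measurable
  then show ?thesis
    using LIMSEQ_unique[OF _ tendsto_const] by (simp add: fourier_null_integral_continuous[OF d \<phi>])
qed

text \<open>On one period the map \<open>expo b\<close> is injective up to end points, so cutting
  \<open>d\<close> at a half-line amounts to restricting it to a closed arc of the circle. All
  half-line integrals of \<open>d\<close> therefore vanish, and the half-line criterion applies to
  the real and imaginary parts.\<close>

lemma fourier_null_AE_zero:
  assumes b: "0 < b" and d: "d \<in> fourier_null b" and supp: "\<And>t. t \<notin> {\<alpha>..\<alpha> + inverse b} \<Longrightarrow> d t = 0"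
  shows "AE t in lebesgue. d t = 0"
proof -
  have di: "integrable lebesgue d" using d by (simp add: fourier_null_def)
  note borel_measurable_integrable[OF di, measurable]
  have nullpt: "AE t in lebesgue. t \<noteq> c" for c :: real
    using AE_completion[OF AE_lborel_singleton[of c]] .
  have z: "(LINT t|lebesgue. d t * indicator {x<..} t) = 0" for x
  proof (cases "x < \<alpha> + inverse b")
    case False
    have "(\<lambda>t. d t * indicator {x<..} t) = (\<lambda>t. 0)"
    proof
      fix t show "d t * indicator {x<..} t = 0" using supp[of t] False by (auto simp: indicator_def)
    qed
    then show ?thesis by simp
  next
    case x: True
    \<comment> \<open>The part of the half-line inside the period, made closed; its image under
      \<open>expo b\<close> is the arc, which is closed because it is compact.\<close>
    define J where "J = {max x \<alpha>..\<alpha> + inverse b}"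
    define C where "C = expo b ` J"
    have "\<alpha> + inverse b \<in> J" using x b by (auto simp: J_def)
    then have Cne: "C \<noteq> {}" by (auto simp: C_def)
    have "compact C" unfolding C_def J_def by (intro compact_continuous_image continuous_expo compact_Icc)
    then have Cc: "closed C" by (rule compact_imp_closed)
    have [measurable]: "C \<in> sets borel" using Cc by auto
    have "(LINT t|lebesgue. d t * indicator {x<..} t) = (LINT t|lebesgue. d t * indicator C (expo b t))"
    proof (rule integral_cong_AE)
      show "AE t in lebesgue. d t * indicator {x<..} t = d t * indicator C (expo b t)"
        \<comment> \<open>Three points are discarded: the two end points of the period, which have
          the same image on the circle, and the boundary \<open>x\<close> of the half-line, which
          \<open>J\<close> may contain.\<close>
        using nullpt[of \<alpha>] nullpt[of "\<alpha> + inverse b"] nullpt[of x]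
      proof eventually_elim
        case (elim t)
        show ?case
        proof (cases "t \<in> {\<alpha>..\<alpha> + inverse b}")
          case True
          have "expo b t \<in> C \<longleftrightarrow> x < t"
          proof
            assume "x < t"
            then have "t \<in> J" using True by (auto simp: J_def)
            then show "expo b t \<in> C" by (simp add: C_def)
          next
            assume "expo b t \<in> C"
            then obtain s where s: "s \<in> J" "expo b t = expo b s" by (auto simp: C_def)
            have "exp (\<i> * of_real (2 * pi * b * t)) = exp (\<i> * of_real (2 * pi * b * s))"
              using s(2) by (simp add: expo_cis cis_conv_exp)
            then obtain n :: int where "\<i> * complex_of_real (2 * pi * b * t) = \<i> * of_real (2 * pi * b * s) + (of_int (2 * n) * of_real pi) * \<i>"
              by (auto simp: exp_eq)
            then have "\<i> * complex_of_real (2 * pi * b * t) = \<i> * of_real (2 * pi * b * s + 2 * of_int n * pi)"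
              by (simp add: algebra_simps)
            then have "2 * pi * b * t = 2 * pi * b * s + 2 * of_int n * pi"
              by (simp only: mult_cancel_left of_real_eq_iff) simp
            then have "2 * pi * (b * (t - s)) = 2 * pi * of_int n" by (simp add: algebra_simps)
            then have n: "b * (t - s) = of_int n" by (simp only: mult_cancel_left) simp
            \<comment> \<open>Strict because \<open>t\<close> is neither end point of the period;
              this excludes every nonzero integer \<open>n\<close>.\<close>
            have "\<bar>t - s\<bar> < inverse b" using s(1) True elim by (auto simp: J_def)
            then have "b * \<bar>t - s\<bar> < b * inverse b" using b by (intro mult_strict_left_mono)
            then have "\<bar>real_of_int n\<bar> < 1" using b n[symmetric] by (simp add: abs_mult)
            then have "n = 0" by linarith
            then have "t = s" using n b by simp
            then show "x < t" using s(1) elim by (auto simp: J_def)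
          qed
          then show ?thesis by (simp add: indicator_def)
        qed (simp add: supp)
      qed
      show "(\<lambda>t. d t * indicator {x<..} t) \<in> borel_measurable lebesgue"
        by (rule borel_measurable_mult_indicator) auto
    qed measurable
    also have "\<dots> = 0" by (rule fourier_null_integral_closed[OF d Cc Cne])
    finally show ?thesis .
  qed
  have i: "integrable lebesgue (\<lambda>t. d t * indicator {x<..} t)" for x
    by (rule integrable_mult_indicator[OF _ di, of "{x<..}", simplified scaleR_conv_of_real of_real_indicator mult.commute[of "indicator _ _"]]) auto
  have "AE t in lebesgue. Re (d t) = 0"
  proof (rule AE_zero_if_integral_greaterThan_zero)
    fix x
    have "(LINT t|lebesgue. Re (d t) * indicator {x<..} t) = (LINT t|lebesgue. Re (d t * indicator {x<..} t))"
      by (rule Bochner_Integration.integral_cong) (auto simp: indicator_def)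
    also have "\<dots> = 0" using z[of x] integral_Re[OF i[of x]] by simp
    finally show "(LINT t|lebesgue. Re (d t) * indicator {x<..} t) = 0" .
  qed (use di in simp)
  moreover have "AE t in lebesgue. Im (d t) = 0"
  proof (rule AE_zero_if_integral_greaterThan_zero)
    fix x
    have "(LINT t|lebesgue. Im (d t) * indicator {x<..} t) = (LINT t|lebesgue. Im (d t * indicator {x<..} t))"
      by (rule Bochner_Integration.integral_cong) (auto simp: indicator_def)
    also have "\<dots> = 0" using z[of x] integral_Im[OF i[of x]] by simp
    finally show "(LINT t|lebesgue. Im (d t) * indicator {x<..} t) = 0" .
  qed (use di in simp)
  ultimately show ?thesis by eventually_elim (simp add: complex_eq_iff)
qed

section \<open>Bessel inequality and Parseval identity for exponentials on an interval\<close>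

lemma L2_indicator_Icc: "(indicator {x..y} :: real \<Rightarrow> complex) \<in> L2"
proof -
  have "integrable lebesgue (\<lambda>t. (cmod (indicator {x..y} t :: complex))\<^sup>2)"
    by (rule Bochner_Integration.integrable_cong[THEN iffD1, OF refl, of lebesgue "indicator {x..y}"])
      (auto simp: indicator_def integrable_indicator_iff emeasure_lborel_cbox_finite[of x y, unfolded cbox_interval infinity_ennreal_def])
  moreover have "(indicator {x..y} :: real \<Rightarrow> complex) \<in> borel_measurable lebesgue"
    by (rule borel_measurable_indicator) simp
  ultimately show ?thesis by (simp add: L2_iff)
qed

lemma exponentials_inner:
  assumes b: "0 < b"
  shows "L2_inner (modulation (of_int m * b) (indicator {\<alpha>..\<alpha> + inverse b})) (modulation (of_int l * b) (indicator {\<alpha>..\<alpha> + inverse b}))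
    = (if m = l then of_real (inverse b) else 0)"
proof -
  have "L2_inner (modulation (of_int m * b) (indicator {\<alpha>..\<alpha> + inverse b})) (modulation (of_int l * b) (indicator {\<alpha>..\<alpha> + inverse b}))
    = (LINT t|lebesgue. expo (of_int (m - l) * b) t * indicator {\<alpha>..\<alpha> + inverse b} t)"
    unfolding L2_inner_def
  proof (rule Bochner_Integration.integral_cong[OF refl])
    fix t
    have "expo (of_int m * b) t * cnj (expo (of_int l * b) t) = expo (of_int (m - l) * b) t"
      by (simp add: cnj_expo expo_add[symmetric] left_diff_distrib)
    then show "modulation (of_int m * b) (indicator {\<alpha>..\<alpha> + inverse b}) t * cnj (modulation (of_int l * b) (indicator {\<alpha>..\<alpha> + inverse b}) t)
      = expo (of_int (m - l) * b) t * indicator {\<alpha>..\<alpha> + inverse b} t"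
      by (simp add: modulation_expo indicator_def)
  qed
  also have "\<dots> = (if m = l then of_real (inverse b) else 0)"
    using integral_expo_period[of "inverse b" b "m - l" \<alpha>] b by simp
  finally show ?thesis .
qed

text \<open>With \<open>X\<close> the sum of the squared coefficients and \<open>s\<close> the
  corresponding synthesis, orthogonality gives \<open>L2_inner s f = X\<close> and squared norm
  \<open>T * X\<close> for \<open>s\<close>. Cauchy-Schwarz bounds \<open>X * X\<close> by
  \<open>T * X\<close> times the squared norm of \<open>f\<close>, and one factor \<open>X\<close>
  is cancelled.\<close>

lemma orthogonal_bessel_bound:
  fixes e :: "'i \<Rightarrow> real \<Rightarrow> complex"
  assumes T: "0 < T" and e: "\<And>i. e i \<in> L2" and orth: "\<And>i j. L2_inner (e i) (e j) = (if i = j then of_real T else 0)"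
  shows "bessel_bound e T"
  unfolding bessel_bound_def
proof (intro conjI allI ballI impI e)
  fix f :: "real \<Rightarrow> complex" and F :: "'i set" assume f: "f \<in> L2" and F: "finite F"
  define c where "c = (\<lambda>i. L2_inner f (e i))"
  define X where "X = (\<Sum>i\<in>F. (cmod (c i))\<^sup>2)"
  define s where "s = (\<lambda>t. \<Sum>i\<in>F. c i * e i t)"
  have X0: "0 \<le> X" by (simp add: X_def sum_nonneg)
  have sL: "s \<in> L2" unfolding s_def by (intro L2_sum_finite L2_cmult e)
  have si: "L2_inner s h = (\<Sum>i\<in>F. c i * L2_inner (e i) h)" if "h \<in> L2" for h
    unfolding s_def using that by (subst L2_inner_sum_left) (auto simp: L2_cmult e L2_inner_cmult_left)
  have "L2_inner s f = (\<Sum>i\<in>F. c i * cnj (c i))"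
    unfolding si[OF f] c_def by (simp add: L2_inner_cnj)
  then have sf: "L2_inner s f = of_real X" by (simp only: X_def of_real_sum complex_norm_square)
  have ej: "L2_inner (e j) s = of_real T * cnj (c j)" if "j \<in> F" for j
  proof -
    have "L2_inner s (e j) = (\<Sum>i\<in>F. if i = j then c i * of_real T else 0)"
      unfolding si[OF e] by (intro sum.cong) (auto simp: orth)
    also have "\<dots> = c j * of_real T" using F that by (simp add: sum.delta)
    finally have "L2_inner s (e j) = c j * of_real T" .
    from arg_cong[OF this, of cnj] show ?thesis by (simp add: L2_inner_cnj mult.commute)
  qed
  have "L2_inner s s = (\<Sum>i\<in>F. c i * (of_real T * cnj (c i)))"
    unfolding si[OF sL] by (intro sum.cong) (auto simp: ej)
  also have "\<dots> = of_real (T * X)"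
    unfolding X_def of_real_mult of_real_sum complex_norm_square sum_distrib_left by (simp add: mult_ac)
  finally have ss: "(L2n s)\<^sup>2 = T * X" using L2n_eq[OF sL] by simp
  have "X \<le> L2n s * L2n f" using L2_inner_le[OF sL f] X0 by (simp add: sf)
  then have "X\<^sup>2 \<le> (L2n s * L2n f)\<^sup>2" using X0 by (intro power_mono) auto
  then have "X\<^sup>2 \<le> T * X * (L2n f)\<^sup>2" by (simp only: power_mult_distrib ss)
  then have *: "X * X \<le> (T * (L2n f)\<^sup>2) * X" by (simp add: power2_eq_square mult_ac)
  have "X \<le> T * (L2n f)\<^sup>2"
  proof (cases "X = 0")
    case True
    then show ?thesis using T by simp
  next
    case False
    then have "0 < X" using X0 by simp
    with * show ?thesis by (rule mult_right_le_imp_le)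
  qed
  then show "(\<Sum>i\<in>F. (cmod (L2_inner f (e i)))\<^sup>2) \<le> T * (L2n f)\<^sup>2" by (simp add: X_def c_def)
qed (use T in simp)

text \<open>The Fourier series \<open>G\<close> of \<open>f\<close> converges because the
  exponentials are Bessel; it has the same coefficients as \<open>f\<close>, so by completeness the
  two agree on \<open>I\<close>. Pairing the series with \<open>h\<close> cut to \<open>I\<close>
  gives the sum. The exponentials are not normalised, which leaves the factor
  \<open>1/b\<close>.\<close>

lemma exponentials_parseval:
  fixes b \<alpha> :: real
  defines "I \<equiv> {\<alpha>..\<alpha> + inverse b}"
  assumes b: "0 < b" and f: "f \<in> L2" and h: "h \<in> L2"
  shows "((\<lambda>l::int. L2_inner f (modulation (of_int l * b) (indicator I)) * L2_inner (modulation (of_int l * b) (indicator I)) h)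
    has_sum of_real (inverse b) * (LINT t|lebesgue. f t * cnj (h t) * indicator I t)) UNIV"
proof -
  define e where "e = (\<lambda>l::int. modulation (of_int l * b) (indicator I))"
  define T where "T = inverse b"
  have T: "0 < T" using b by (simp add: T_def)
  have e: "e l \<in> L2" for l unfolding e_def I_def by (intro L2_modulation L2_indicator_Icc)
  have orth: "L2_inner (e i) (e j) = (if i = j then of_real T else 0)" for i j
    unfolding e_def I_def T_def by (rule exponentials_inner[OF b])
  have B: "bessel_bound e T" by (rule orthogonal_bessel_bound[OF T e orth])
  \<comment> \<open>Each exponential has squared norm \<open>T\<close>, so the coefficient is
    divided by \<open>T\<close>.\<close>
  define c where "c = (\<lambda>l. L2_inner f (e l) / of_real T)"
  have "(\<lambda>l. (cmod (L2_inner f (e l)))\<^sup>2 * inverse (T\<^sup>2)) summable_on UNIV"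
    by (intro summable_on_cmult_left bessel_coeffs_summable[OF B f])
  then have "(\<lambda>l. (cmod (c l))\<^sup>2) summable_on UNIV"
    by (simp add: c_def norm_divide power_divide field_simps)
  then obtain G where G: "L2_has_sum (\<lambda>l t. c l * e l t) G"
    using bessel_synthesis_summable[OF B, of c] by (auto simp: L2_summable_def)
  have GL: "G \<in> L2" using G by (simp add: L2_has_sum_def)
  have Gh: "((\<lambda>l. c l * L2_inner (e l) h) has_sum L2_inner G h) UNIV" if "h \<in> L2" for h
    using L2_has_sum_inner[OF _ G that] by (simp add: L2_cmult e L2_inner_cmult_left)
  have Ge: "L2_inner G (e m) = L2_inner f (e m)" for m
  proof -
    have "((\<lambda>l. c l * L2_inner (e l) (e m)) has_sum c m * of_real T) {m}"
      by (rule has_sum_finiteI) (auto simp: orth)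
    then have "((\<lambda>l. c l * L2_inner (e l) (e m)) has_sum c m * of_real T) UNIV"
      by (rule has_sum_cong_neutral[THEN iffD1, rotated -1]) (auto simp: orth)
    with Gh[OF e] have "L2_inner G (e m) = c m * of_real T" by (rule has_sum_unique)
    then show ?thesis using T by (simp add: c_def)
  qed
  have fG: "(\<lambda>t. f t - G t) \<in> L2" by (rule L2_diff[OF f GL])
  define d where "d = (\<lambda>t. (f t - G t) * indicator I t)"
  have "d \<in> fourier_null b"
    unfolding fourier_null_def
  proof (intro CollectI conjI allI)
    show "integrable lebesgue d"
      unfolding d_def I_def by (rule L2_integrable_mult[OF fG L2_indicator_Icc])
    fix l :: int
    \<comment> \<open>The integral carries no conjugate, hence the index \<open>- l\<close>.\<close>
    have "(LINT t|lebesgue. d t * expo (of_int l * b) t) = L2_inner (\<lambda>t. f t - G t) (e (- l))"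
      unfolding L2_inner_def
      by (rule Bochner_Integration.integral_cong) (auto simp: d_def e_def modulation_expo indicator_def cnj_expo)
    also have "\<dots> = 0" by (simp add: L2_inner_diff_left f GL e Ge)
    finally show "(LINT t|lebesgue. d t * expo (of_int l * b) t) = 0" .
  qed
  then have "AE t in lebesgue. d t = 0"
    by (rule fourier_null_AE_zero[OF b, where \<alpha> = \<alpha>]) (auto simp: d_def I_def)
  then have AE: "AE t in lebesgue. f t * indicator I t = G t * indicator I t"
    by eventually_elim (auto simp: d_def indicator_def)
  \<comment> \<open>\<open>G\<close> is known to equal \<open>f\<close> only on \<open>I\<close>;
    cutting \<open>h\<close> to \<open>I\<close> confines the pairing to it without changing any
    coefficient.\<close>
  define k where "k = (\<lambda>t. h t * indicator I t)"
  have Is: "I \<in> sets lebesgue" by (simp add: I_def)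
  have k: "k \<in> L2" unfolding k_def using h Is by (rule L2_indicator)
  have ek: "L2_inner (e l) k = L2_inner (e l) h" for l
    unfolding L2_inner_def
    by (rule Bochner_Integration.integral_cong) (auto simp: k_def e_def modulation_expo indicator_def)
  note L2_measurable[OF f, measurable] L2_measurable[OF h, measurable] L2_measurable[OF GL, measurable] Is[measurable]
  have "L2_inner G k = (LINT t|lebesgue. f t * cnj (h t) * indicator I t)"
    unfolding L2_inner_def
  proof (rule integral_cong_AE)
    show "AE t in lebesgue. G t * cnj (k t) = f t * cnj (h t) * indicator I t"
      using AE by eventually_elim (auto simp: k_def indicator_def)
    show "(\<lambda>t. G t * cnj (k t)) \<in> borel_measurable lebesgue"
      by (rule borel_measurable_integrable[OF L2_integrable[OF GL k]])
    show "(\<lambda>t. f t * cnj (h t) * indicator I t) \<in> borel_measurable lebesgue"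
      by (rule borel_measurable_mult_indicator[OF borel_measurable_integrable[OF L2_integrable[OF f h]] Is])
  qed
  with Gh[OF k] have "((\<lambda>l. c l * L2_inner (e l) h) has_sum (LINT t|lebesgue. f t * cnj (h t) * indicator I t)) UNIV"
    by (simp add: ek)
  then have "((\<lambda>l. of_real T * (c l * L2_inner (e l) h)) has_sum of_real T * (LINT t|lebesgue. f t * cnj (h t) * indicator I t)) UNIV"
    by (rule has_sum_cmult_right)
  then show ?thesis using T by (simp add: c_def e_def T_def)
qed

section \<open>Translation invariance of Lebesgue measure\<close>

lemma measurable_shift[measurable]: "(\<lambda>t::real. t + c) \<in> lebesgue \<rightarrow>\<^sub>M lebesgue"
  using lebesgue_affine_measurable[of "\<lambda>_. 1::real" c] by (simp add: add.commute)

lemma distr_lebesgue_shift: "distr lebesgue lebesgue (\<lambda>t::real. t + c) = lebesgue"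
  using lebesgue_real_affine[of 1 c] by (simp add: density_1 add.commute)

lemma measurable_lebesgue_shift:
  fixes c :: real
  shows "F \<in> borel_measurable lebesgue \<Longrightarrow> (\<lambda>t. F (t + c)) \<in> borel_measurable lebesgue"
  by (rule measurable_compose[OF measurable_shift])

lemma nn_integral_lebesgue_shift:
  fixes c :: real
  assumes "F \<in> borel_measurable lebesgue"
  shows "(\<integral>\<^sup>+t. F (t + c) \<partial>lebesgue) = (\<integral>\<^sup>+t. F t \<partial>lebesgue)"
  using nn_integral_distr[OF measurable_shift, of F c] assms by (simp add: distr_lebesgue_shift)

lemma integral_lebesgue_shift:
  fixes c :: real and F :: "real \<Rightarrow> complex"
  assumes "F \<in> borel_measurable lebesgue"
  shows "(LINT t|lebesgue. F (t + c)) = (LINT t|lebesgue. F t)"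
  using integral_distr[OF measurable_shift, of F c] assms by (simp add: distr_lebesgue_shift)

lemma L2_shift:
  assumes "f \<in> L2"
  shows "(\<lambda>t. f (t + c)) \<in> L2"
proof (rule L2I)
  note L2_measurable[OF assms, measurable]
  show "(\<lambda>t. f (t + c)) \<in> borel_measurable lebesgue" by (intro measurable_lebesgue_shift) measurable
  show "(\<integral>\<^sup>+t. ennreal ((cmod (f (t + c)))\<^sup>2) \<partial>lebesgue) \<le> ennreal ((L2n f)\<^sup>2)"
    using nn_integral_lebesgue_shift[of "\<lambda>t. ennreal ((cmod (f t))\<^sup>2)" c] by (simp add: nn_integral_L2n[OF assms])
qed

subsection \<open>Folding a single window\<close>

text \<open>Closed tiles share end points. Off this countable set every point lies in exactly one
  translate of the tile.\<close>

lemma AE_not_lattice: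
  fixes \<alpha> T :: real
  shows "AE s in lebesgue. \<forall>j::int. s \<noteq> \<alpha> + of_int j * T"
proof (subst AE_all_countable, intro allI)
  fix j :: int
  show "AE s in lebesgue. s \<noteq> \<alpha> + of_int j * T"
    by (rule AE_completion[OF AE_lborel_singleton])
qed

lemma tile_unique:
  fixes \<alpha> T s :: real
  assumes T: "0 < T" and s: "\<forall>j::int. s \<noteq> \<alpha> + of_int j * T"
  obtains j0 :: int where "\<And>j::int. s - of_int j * T \<in> {\<alpha>..\<alpha> + T} \<longleftrightarrow> j = j0"
proof
  define j0 where "j0 = \<lfloor>(s - \<alpha>) / T\<rfloor>"
  have fl: "of_int j0 \<le> (s - \<alpha>) / T" "(s - \<alpha>) / T < of_int j0 + 1"
    unfolding j0_def by linarith+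
  then have lo: "of_int j0 * T \<le> s - \<alpha>" and hi: "s - \<alpha> < (of_int j0 + 1) * T"
    using T by (simp_all add: field_simps)
  fix j :: int
  show "s - of_int j * T \<in> {\<alpha>..\<alpha> + T} \<longleftrightarrow> j = j0"
  proof
    assume "s - of_int j * T \<in> {\<alpha>..\<alpha> + T}"
    then have 1: "of_int j * T \<le> s - \<alpha>" and 2: "s - \<alpha> \<le> (of_int j + 1) * T" by (auto simp: algebra_simps)
    have "s - \<alpha> \<noteq> (of_int j + 1) * T"
      using s[rule_format, of "j + 1"] by (auto simp: algebra_simps)
    with 2 have 3: "s - \<alpha> < (of_int j + 1) * T" by simp
    have "of_int j * T < (of_int j0 + 1) * T" using 1 hi by linarith
    then have "j < j0 + 1" using T by (simp add: mult_less_cancel_right) 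
    moreover have "of_int j0 * T < (of_int j + 1) * T" using lo 3 by linarith
    then have "j0 < j + 1" using T by (simp add: mult_less_cancel_right)
    ultimately show "j = j0" by linarith
  next
    assume "j = j0"
    then show "s - of_int j * T \<in> {\<alpha>..\<alpha> + T}" using lo hi by (auto simp: algebra_simps)
  qed
qed

lemma sum_tile_le_one:
  fixes \<alpha> T s :: real and J :: "int set"
  assumes T: "0 < T" and s: "\<forall>j::int. s \<noteq> \<alpha> + of_int j * T" and J: "finite J"
  shows "(\<Sum>j\<in>J. indicator {\<alpha>..\<alpha> + T} (s - of_int j * T) :: ennreal) \<le> 1"
proof -
  obtain j0 where j0: "\<And>j::int. s - of_int j * T \<in> {\<alpha>..\<alpha> + T} \<longleftrightarrow> j = j0"
    by (rule tile_unique[OF T s]) (rule that)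
  have "(\<Sum>j\<in>J. indicator {\<alpha>..\<alpha> + T} (s - of_int j * T) :: ennreal) = (\<Sum>j\<in>J. if j = j0 then 1 else 0)"
    unfolding indicator_def j0 by (simp add: of_bool_def)
  also have "\<dots> \<le> 1" using J by (simp add: sum.delta)
  finally show ?thesis .
qed

lemma expo_periodic:
  assumes "b \<noteq> 0"
  shows "expo (of_int l * b) (t + of_int j * inverse b) = expo (of_int l * b) t"
proof -
  have "2 * pi * (of_int l * b) * (t + of_int j * inverse b) = 2 * pi * (of_int l * b) * t + 2 * pi * of_int (l * j)"
    using assms by (simp add: algebra_simps)
  then have "expo (of_int l * b) (t + of_int j * inverse b) = expo (of_int l * b) t * cis (2 * pi * of_int (l * j))"
    by (simp only: expo_cis cis_mult)
  then show ?thesis by (simp add: cis_multiple_2pi del: of_int_mult)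
qed

text \<open>The periodisation of \<open>w\<close>, read on one tile. Only the translates in
  \<open>J\<close> are summed, which gives the full periodisation once they cover the
  support.\<close>

definition fold_period :: "real \<Rightarrow> real \<Rightarrow> int set \<Rightarrow> (real \<Rightarrow> complex) \<Rightarrow> real \<Rightarrow> complex" where
  "fold_period \<alpha> T J w t = (\<Sum>j\<in>J. w (t + of_int j * T) * indicator {\<alpha>..\<alpha> + T} t)"

lemma fold_period_L2: "w \<in> L2 \<Longrightarrow> fold_period \<alpha> T J w \<in> L2"
  unfolding fold_period_def by (intro L2_sum_finite L2_indicator L2_shift) auto

text \<open>The exponentials have period \<open>1/b\<close>, so translating the summand of index
  \<open>j\<close> by \<open>j/b\<close> leaves its exponential unchanged. The translated tiles
  cover the support of \<open>w\<close>, and the pieces add up to an integral over the line.\<close>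

lemma inner_fold_period:
  fixes b \<alpha> :: real and J :: "int set"
  assumes b: "0 < b" and w: "w \<in> L2" and J: "finite J"
    and supp: "\<And>t j. t \<in> {\<alpha>..\<alpha> + inverse b} \<Longrightarrow> j \<notin> J \<Longrightarrow> w (t + of_int j * inverse b) = 0"
  shows "L2_inner (fold_period \<alpha> (inverse b) J w) (modulation (of_int l * b) (indicator {\<alpha>..\<alpha> + inverse b}))
    = (LINT t|lebesgue. w t * cnj (expo (of_int l * b) t))"
proof -
  define T where "T = inverse b"
  define I where "I = {\<alpha>..\<alpha> + T}"
  define E where "E = expo (of_int l * b)"
  have T: "0 < T" using b by (simp add: T_def)
  \<comment> \<open>The part of the integrand on the tile of index \<open>j\<close>.\<close>
  define F where "F = (\<lambda>j::int. \<lambda>s. w s * (cnj (E s) * indicator I (s - of_int j * T)))"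
  have indL: "(\<lambda>s. cnj (E s) * indicator I (s - of_int j * T)) \<in> L2" for j :: int
  proof -
    have "(\<lambda>s. indicator I (s - of_int j * T)) = (indicator {\<alpha> + of_int j * T..\<alpha> + T + of_int j * T} :: real \<Rightarrow> complex)"
      by (auto simp: I_def indicator_def fun_eq_iff)
    then have "(\<lambda>s. indicator I (s - of_int j * T) :: complex) \<in> L2" using L2_indicator_Icc by metis
    then show ?thesis
      unfolding E_def cnj_expo using L2_mult_bounded(1)[of _ "expo (- (of_int l * b))" 1] by simp
  qed
  have Fi: "integrable lebesgue (F j)" for j unfolding F_def by (rule L2_integrable_mult[OF w indL])
  have Fshift: "F j (t + of_int j * T) = w (t + of_int j * T) * cnj (E t) * indicator I t" for j t
    using b unfolding F_def E_def T_def by (simp add: expo_periodic)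
  have "L2_inner (fold_period \<alpha> T J w) (modulation (of_int l * b) (indicator I))
     = (LINT t|lebesgue. (\<Sum>j\<in>J. F j (t + of_int j * T)))"
    unfolding L2_inner_def Fshift
    by (rule Bochner_Integration.integral_cong[OF refl])
      (auto simp: fold_period_def modulation_expo I_def E_def indicator_def sum_distrib_right)
  also have "\<dots> = (\<Sum>j\<in>J. LINT t|lebesgue. F j (t + of_int j * T))"
  proof (rule Bochner_Integration.integral_sum)
    fix j
    have "integrable (distr lebesgue lebesgue (\<lambda>t. t + of_int j * T)) (F j)"
      by (subst distr_lebesgue_shift) (rule Fi)
    then show "integrable lebesgue (\<lambda>t. F j (t + of_int j * T))"
      by (rule integrable_distr[OF measurable_shift])
  qed
  also have "\<dots> = (\<Sum>j\<in>J. LINT t|lebesgue. F j t)"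
    by (intro sum.cong refl integral_lebesgue_shift borel_measurable_integrable Fi)
  also have "\<dots> = (LINT t|lebesgue. (\<Sum>j\<in>J. F j t))"
    by (rule Bochner_Integration.integral_sum[symmetric]) (rule Fi)
  also have "\<dots> = (LINT t|lebesgue. w t * cnj (E t))"
  proof (rule integral_cong_AE)
    show "AE t in lebesgue. (\<Sum>j\<in>J. F j t) = w t * cnj (E t)"
      using AE_not_lattice[of \<alpha> T]
    proof eventually_elim
      case (elim s)
      obtain j0 where j0: "\<And>j::int. s - of_int j * T \<in> I \<longleftrightarrow> j = j0"
        using tile_unique[OF T elim] unfolding I_def by metis
      have "(\<Sum>j\<in>J. F j s) = (\<Sum>j\<in>J. if j = j0 then w s * cnj (E s) else 0)"
        by (rule sum.cong) (auto simp: F_def indicator_def j0)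
      also have "\<dots> = (if j0 \<in> J then w s * cnj (E s) else 0)" using J by (simp add: sum.delta)
      \<comment> \<open>If the tile containing \<open>s\<close> has an index outside
        \<open>J\<close>, then \<open>w\<close> vanishes at \<open>s\<close> by the support
        hypothesis.\<close>
      also have "\<dots> = w s * cnj (E s)"
        using supp[of "s - of_int j0 * T" j0] j0[of j0] by (auto simp: I_def T_def)
      finally show ?case .
    qed
    show "(\<lambda>t. \<Sum>j\<in>J. F j t) \<in> borel_measurable lebesgue"
      by (intro borel_measurable_sum borel_measurable_integrable Fi)
    show "(\<lambda>t. w t * cnj (E t)) \<in> borel_measurable lebesgue"
      unfolding E_def cnj_expo by (intro borel_measurable_times L2_measurable[OF w] measurable_expo)
  qed
  finally show ?thesis by (simp add: T_def I_def E_def)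
qed

section \<open>The form of one window: core, tail and shifted products\<close>

definition shift_term ::
  "real \<Rightarrow> (real \<Rightarrow> complex) \<Rightarrow> (real \<Rightarrow> complex) \<Rightarrow> (real \<Rightarrow> complex) \<Rightarrow> (real \<Rightarrow> complex) \<Rightarrow> int \<Rightarrow> ennreal" where
  "shift_term b p q f h l = (\<integral>\<^sup>+t. ennreal (cmod (f (t - of_int l * inverse b)) * cmod (p (t - of_int l * inverse b))
     * (cmod (q t) * cmod (h t))) \<partial>lebesgue)"

text \<open>Sums over the indices are handled as integrals over counting measures, so that Tonelli's
  theorem and the Cauchy-Schwarz inequality for integrals cover sums and integrals together.\<close>

lemma sum_le_nn_integral_count_space:
  fixes g :: "'a \<Rightarrow> ennreal"
  assumes "finite F" "F \<subseteq> A"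
  shows "(\<Sum>i\<in>F. g i) \<le> (\<integral>\<^sup>+i. g i \<partial>count_space A)"
proof -
  have "(\<Sum>i\<in>F. g i) = (\<integral>\<^sup>+i. g i \<partial>count_space F)"
    using assms by (simp add: nn_integral_count_space_finite)
  also have "\<dots> = (\<integral>\<^sup>+i. g i * indicator F i \<partial>count_space A)"
    using assms(2) by (subst (1 2) nn_integral_count_space_indicator)
      (auto intro!: nn_integral_cong simp: indicator_def split: if_splits)
  also have "\<dots> \<le> (\<integral>\<^sup>+i. g i \<partial>count_space A)"
    by (intro nn_integral_mono) (auto simp: indicator_def)
  finally show ?thesis .
qed

text \<open>One index \<open>k\<close>, with \<open>f\<close> and \<open>h\<close> compactly
  supported: translates of the tile by more than \<open>n\<close> periods miss both supports, so all
  folds are finite. The constant \<open>C\<close> puts the products of \<open>f\<close> and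
  \<open>h\<close> with the windows into \<open>L2\<close>.\<close>

locale single_window =
  fixes b \<alpha> :: real and f h p q :: "real \<Rightarrow> complex" and n :: nat and C :: real
  assumes b: "0 < b" and f: "f \<in> L2" and h: "h \<in> L2"
    and p[measurable]: "p \<in> borel_measurable lebesgue" and q[measurable]: "q \<in> borel_measurable lebesgue"
    and C: "0 \<le> C" "AE t in lebesgue. cmod (p t) \<le> C" "AE t in lebesgue. cmod (q t) \<le> C"
    and supp: "\<And>t j. t \<in> {\<alpha>..\<alpha> + inverse b} \<Longrightarrow> int n < \<bar>j\<bar> \<Longrightarrow> f (t + of_int j * inverse b) = 0 \<and> h (t + of_int j * inverse b) = 0"
begin

definition "T = inverse b"
definition "I = {\<alpha>..\<alpha> + T}"
definition "po t = p t * indicator I t"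
definition "pr t = p t - p t * indicator I t"
definition "qo t = q t * indicator I t"
definition "qr t = q t - q t * indicator I t"
definition "u t = f t * cnj (p t)"
definition "v t = h t * cnj (q t)"
definition "J = {- int n..int n}"
definition "J' = J - {0}"
definition "U = fold_period \<alpha> T J u"
definition "V = fold_period \<alpha> T J v"
text \<open>\<open>Q\<close> is the complete form of this window, by Parseval on the tile.
  \<open>D\<close> retains the unshifted product of \<open>u\<close> and \<open>v\<close> on the
  tile, where each window equals its core.\<close>

definition "Q = of_real T * (LINT t|lebesgue. U t * cnj (V t) * indicator I t)"
definition "D = of_real T * (LINT t|lebesgue. u t * cnj (v t) * indicator I t)"

lemma T: "0 < T" using b by (simp add: T_def)

lemma finJ: "finite J" "finite J'" by (auto simp: J_def J'_def)

lemma Ilebesgue[measurable]: "I \<in> sets lebesgue" by (simp add: I_def)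

lemma meas[measurable]: "f \<in> borel_measurable lebesgue" "h \<in> borel_measurable lebesgue"
  "po \<in> borel_measurable lebesgue" "pr \<in> borel_measurable lebesgue"
  "qo \<in> borel_measurable lebesgue" "qr \<in> borel_measurable lebesgue"
  using f h unfolding po_def[abs_def] pr_def[abs_def] qo_def[abs_def] qr_def[abs_def]
  by (auto intro!: borel_measurable_mult_indicator borel_measurable_diff L2_measurable)

lemma measurable_cnj: "w \<in> borel_measurable lebesgue \<Longrightarrow> (\<lambda>t. cnj (w t)) \<in> borel_measurable lebesgue"
  by (rule measurable_compose[OF _ borel_measurable_continuous_onI]) (auto intro: continuous_intros)

lemma u: "u \<in> L2"
  using L2_mult_bounded(1)[OF f measurable_cnj[OF p], of C] C by (simp add: u_def[abs_def] mult.commute)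

lemma v: "v \<in> L2"
  using L2_mult_bounded(1)[OF h measurable_cnj[OF q], of C] C by (simp add: v_def[abs_def] mult.commute)

lemma U: "U \<in> L2" and V: "V \<in> L2"
  unfolding U_def V_def by (intro fold_period_L2 u v)+

lemma coeff_f: "L2_inner f (modulation (of_int l * b) p) = L2_inner U (modulation (of_int l * b) (indicator I))"
proof -
  have "L2_inner U (modulation (of_int l * b) (indicator I)) = (LINT t|lebesgue. u t * cnj (expo (of_int l * b) t))"
    unfolding U_def I_def T_def using supp
    by (intro inner_fold_period b u finJ) (auto simp: J_def u_def)
  also have "\<dots> = L2_inner f (modulation (of_int l * b) p)"
    unfolding L2_inner_def by (rule Bochner_Integration.integral_cong) (auto simp: u_def modulation_expo mult_ac)
  finally show ?thesis by simp
qed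

lemma coeff_h: "L2_inner (modulation (of_int l * b) q) h = L2_inner (modulation (of_int l * b) (indicator I)) V"
proof -
  have "L2_inner V (modulation (of_int l * b) (indicator I)) = (LINT t|lebesgue. v t * cnj (expo (of_int l * b) t))"
    unfolding V_def I_def T_def using supp
    by (intro inner_fold_period b v finJ) (auto simp: J_def v_def)
  also have "\<dots> = L2_inner h (modulation (of_int l * b) q)"
    unfolding L2_inner_def by (rule Bochner_Integration.integral_cong) (auto simp: v_def modulation_expo mult_ac)
  finally show ?thesis by (metis L2_inner_cnj)
qed

lemma has_sum_Q:
  "((\<lambda>l::int. L2_inner f (modulation (of_int l * b) p) * L2_inner (modulation (of_int l * b) q) h) has_sum Q) UNIV"
  unfolding coeff_f coeff_h Q_def I_def T_def
  by (rule exponentials_parseval[OF b U V])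

definition "uo t = cmod (f t) * cmod (po t)"
definition "ur t = cmod (f t) * cmod (pr t)"
definition "vo t = cmod (qo t) * cmod (h t)"
definition "vr t = cmod (qr t) * cmod (h t)"

lemma nonneg: "0 \<le> uo t" "0 \<le> ur t" "0 \<le> vo t" "0 \<le> vr t"
  by (auto simp: uo_def ur_def vo_def vr_def)

lemma meas_uv[measurable]: "uo \<in> borel_measurable lebesgue" "ur \<in> borel_measurable lebesgue"
  "vo \<in> borel_measurable lebesgue" "vr \<in> borel_measurable lebesgue"
  unfolding uo_def[abs_def] ur_def[abs_def] vo_def[abs_def] vr_def[abs_def] by measurable

lemma meas_shift[measurable]: "(\<lambda>t. uo (t + c)) \<in> borel_measurable lebesgue" "(\<lambda>t. ur (t + c)) \<in> borel_measurable lebesgue"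
  "(\<lambda>t. vo (t + c)) \<in> borel_measurable lebesgue" "(\<lambda>t. vr (t + c)) \<in> borel_measurable lebesgue"
  by (intro measurable_lebesgue_shift meas_uv)+

lemma in_interior_shift:
  assumes "t \<in> I" "t \<noteq> \<alpha>" "t \<noteq> \<alpha> + T" "j \<noteq> (0::int)"
  shows "t + of_int j * T \<notin> I"
proof (cases "0 < j")
  case True
  then have "T \<le> of_int j * T" using T by simp
  moreover have "\<alpha> < t" using assms by (auto simp: I_def)
  ultimately have "\<alpha> + T < t + of_int j * T" by linarith
  then show ?thesis by (simp add: I_def)
next
  case False
  then have "of_int j \<le> (-1::real)" using assms(4) by linarith
  from mult_right_mono[OF this, of T] have "of_int j * T \<le> - T" using T by simp
  moreover have "t < \<alpha> + T" using assms by (auto simp: I_def)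
  ultimately have "t + of_int j * T < \<alpha>" by linarith
  then show ?thesis by (simp add: I_def)
qed

text \<open>Both folds split into the unshifted value on \<open>I\<close> and a sum \<open>a\<close>
  or \<open>c\<close> over nonzero shifts. Nonzero shifts leave the tile, so only tails enter
  \<open>a\<close> and \<open>c\<close>, while the unshifted values involve only cores; expanding
  the product leaves no shifted core-core term. The end points are excluded because a shift by
  \<open>T\<close> carries one to the other.\<close>

lemma pointwise_bound:
  assumes t: "t \<in> I" "t \<noteq> \<alpha>" "t \<noteq> \<alpha> + T"
  shows "cmod (U t * cnj (V t) - u t * cnj (v t)) \<le> (\<Sum>j\<in>J'. uo t * vr (t + of_int j * T))
     + (\<Sum>i\<in>J'. ur (t + of_int i * T) * vo t) + (\<Sum>j\<in>J'. \<Sum>i\<in>J'. ur (t + of_int i * T) * vr (t + of_int j * T))"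
proof -
  define a where "a = (\<Sum>j\<in>J'. u (t + of_int j * T))"
  define c where "c = (\<Sum>j\<in>J'. v (t + of_int j * T))"
  have J0: "0 \<in> J" by (simp add: J_def)
  have U: "U t = u t + a"
    using t(1) finJ J0 unfolding U_def fold_period_def a_def J'_def I_def by (simp add: sum.remove)
  have V: "V t = v t + c"
    using t(1) finJ J0 unfolding V_def fold_period_def c_def J'_def I_def by (simp add: sum.remove)
  have ut: "cmod (u t) = uo t" and vt: "cmod (v t) = vo t"
    using t(1) by (auto simp: u_def v_def uo_def vo_def po_def qo_def norm_mult)
  have out: "t + of_int j * T \<notin> I" if "j \<in> J'" for j
    using that by (intro in_interior_shift t) (auto simp: J'_def)
  have al: "cmod a \<le> (\<Sum>i\<in>J'. ur (t + of_int i * T))"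
    unfolding a_def by (rule sum_norm_le) (auto simp: u_def ur_def pr_def norm_mult dest: out)
  have cl: "cmod c \<le> (\<Sum>i\<in>J'. vr (t + of_int i * T))"
    unfolding c_def by (rule sum_norm_le) (auto simp: v_def vr_def qr_def norm_mult dest: out)
  have a0: "0 \<le> (\<Sum>i\<in>J'. ur (t + of_int i * T))" by (intro sum_nonneg nonneg)
  have "cmod (U t * cnj (V t) - u t * cnj (v t)) = cmod (u t * cnj c + a * cnj (v t) + a * cnj c)"
    by (simp add: U V algebra_simps)
  also have "\<dots> \<le> cmod (u t) * cmod c + cmod a * cmod (v t) + cmod a * cmod c"
    by (intro norm_triangle_mono) (auto simp: norm_mult)
  also have "\<dots> \<le> uo t * (\<Sum>i\<in>J'. vr (t + of_int i * T)) + (\<Sum>i\<in>J'. ur (t + of_int i * T)) * vo t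
     + (\<Sum>i\<in>J'. ur (t + of_int i * T)) * (\<Sum>i\<in>J'. vr (t + of_int i * T))"
    unfolding ut vt by (intro add_mono mult_mono al cl a0 nonneg norm_ge_zero order_refl)
  also have "\<dots> = (\<Sum>j\<in>J'. uo t * vr (t + of_int j * T))
     + (\<Sum>i\<in>J'. ur (t + of_int i * T) * vo t) + (\<Sum>j\<in>J'. \<Sum>i\<in>J'. ur (t + of_int i * T) * vr (t + of_int j * T))"
    by (simp add: sum_distrib_left sum_distrib_right)
  finally show ?thesis .
qed

lemma shift_term_eqs:
  "shift_term b po qr f h l = (\<integral>\<^sup>+t. ennreal (uo (t + (- of_int l * T)) * vr t) \<partial>lebesgue)"
  "shift_term b pr qo f h l = (\<integral>\<^sup>+t. ennreal (ur (t + (- of_int l * T)) * vo t) \<partial>lebesgue)"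
  "shift_term b pr qr f h l = (\<integral>\<^sup>+t. ennreal (ur (t + (- of_int l * T)) * vr t) \<partial>lebesgue)"
  by (simp_all add: shift_term_def uo_def ur_def vo_def vr_def T_def)

lemma core_tail_term: "(\<integral>\<^sup>+t. ennreal (uo t * vr (t + of_int j * T)) \<partial>lebesgue) = shift_term b po qr f h j"
proof -
  have "(\<lambda>t. ennreal (uo (t + (- of_int j * T)) * vr t)) \<in> borel_measurable lebesgue" by measurable
  from nn_integral_lebesgue_shift[OF this, of "of_int j * T"] show ?thesis
    unfolding shift_term_eqs by simp
qed

lemma tail_core_term: "(\<integral>\<^sup>+t. ennreal (ur (t + of_int i * T) * vo t) \<partial>lebesgue) = shift_term b pr qo f h (- i)"
  unfolding shift_term_eqs by simp

text \<open>After translation the product depends on \<open>i\<close> and \<open>j\<close> only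
  through \<open>l = j - i\<close>, apart from the indicator of the tile of index \<open>j\<close>.
  For fixed \<open>l\<close> these indicators sum to at most 1, so each shift is counted once in
  spite of the double sum. The case \<open>i = j\<close> gives \<open>l = 0\<close>, which is why
  the sum extends over all integers.\<close>

lemma tail_tail_term:
  "(\<Sum>j\<in>J'. \<Sum>i\<in>J'. \<integral>\<^sup>+t. ennreal (ur (t + of_int i * T) * vr (t + of_int j * T)) * indicator I t \<partial>lebesgue)
    \<le> (\<integral>\<^sup>+l. shift_term b pr qr f h l \<partial>count_space UNIV)"
proof -
  \<comment> \<open>Differences of two indices in \<open>J'\<close> have modulus at most
    \<open>2 * n\<close>.\<close>
  define L where "L = {- 2 * int n..2 * int n}"
  define w where "w = (\<lambda>l s. ennreal (ur (s + (- of_int l * T)) * vr s))"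
  have wm[measurable]: "w l \<in> borel_measurable lebesgue" for l unfolding w_def by measurable
  have Im[measurable]: "(\<lambda>s. indicator I (s - of_int j * T) :: ennreal) \<in> borel_measurable lebesgue" for j :: int
    using measurable_lebesgue_shift[of "indicator I" "- of_int j * T"] by simp
  have 1: "(\<integral>\<^sup>+t. ennreal (ur (t + of_int i * T) * vr (t + of_int j * T)) * indicator I t \<partial>lebesgue)
    = (\<integral>\<^sup>+s. w (j - i) s * indicator I (s - of_int j * T) \<partial>lebesgue)" for i j
  proof -
    have "(\<lambda>s. w (j - i) s * indicator I (s - of_int j * T)) \<in> borel_measurable lebesgue" by measurable
    from nn_integral_lebesgue_shift[OF this, of "of_int j * T"] show ?thesis
      by (simp add: w_def algebra_simps)
  qed
  have "(\<Sum>j\<in>J'. \<Sum>i\<in>J'. \<integral>\<^sup>+s. w (j - i) s * indicator I (s - of_int j * T) \<partial>lebesgue)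
    \<le> (\<Sum>j\<in>J'. \<Sum>l\<in>L. \<integral>\<^sup>+s. w l s * indicator I (s - of_int j * T) \<partial>lebesgue)"
  proof (rule sum_mono)
    fix j assume j: "j \<in> J'"
    have "(\<Sum>i\<in>J'. \<integral>\<^sup>+s. w (j - i) s * indicator I (s - of_int j * T) \<partial>lebesgue)
      = (\<Sum>l\<in>(\<lambda>i. j - i) ` J'. \<integral>\<^sup>+s. w l s * indicator I (s - of_int j * T) \<partial>lebesgue)"
      by (subst sum.reindex) (auto simp: inj_on_def)
    also have "\<dots> \<le> (\<Sum>l\<in>L. \<integral>\<^sup>+s. w l s * indicator I (s - of_int j * T) \<partial>lebesgue)"
      using j by (intro sum_mono2) (auto simp: L_def J'_def J_def)
    finally show "(\<Sum>i\<in>J'. \<integral>\<^sup>+s. w (j - i) s * indicator I (s - of_int j * T) \<partial>lebesgue)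
      \<le> (\<Sum>l\<in>L. \<integral>\<^sup>+s. w l s * indicator I (s - of_int j * T) \<partial>lebesgue)" .
  qed
  also have "\<dots> = (\<Sum>l\<in>L. \<integral>\<^sup>+s. (\<Sum>j\<in>J'. w l s * indicator I (s - of_int j * T)) \<partial>lebesgue)"
    by (subst sum.swap) (simp add: nn_integral_sum)
  also have "\<dots> \<le> (\<Sum>l\<in>L. \<integral>\<^sup>+s. w l s \<partial>lebesgue)"
  proof (intro sum_mono nn_integral_mono_AE)
    fix l
    show "AE s in lebesgue. (\<Sum>j\<in>J'. w l s * indicator I (s - of_int j * T)) \<le> w l s"
      using AE_not_lattice[of \<alpha> T]
    proof eventually_elim
      case (elim s)
      have "(\<Sum>j\<in>J'. w l s * indicator I (s - of_int j * T)) = w l s * (\<Sum>j\<in>J'. indicator I (s - of_int j * T))"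
        by (simp add: sum_distrib_left)
      also have "\<dots> \<le> w l s * 1"
        unfolding I_def by (intro mult_left_mono sum_tile_le_one T elim finJ) simp
      finally show ?case by simp
    qed
  qed
  also have "\<dots> = (\<Sum>l\<in>L. shift_term b pr qr f h l)" by (simp add: w_def shift_term_eqs)
  also have "\<dots> \<le> (\<integral>\<^sup>+l. shift_term b pr qr f h l \<partial>count_space UNIV)"
    by (rule sum_le_nn_integral_count_space) (auto simp: L_def)
  finally show ?thesis by (simp add: 1)
qed

lemma Q_minus_D:
  "ennreal (cmod (Q - D)) \<le> ennreal T *
    ((\<integral>\<^sup>+l. shift_term b po qr f h l \<partial>count_space (UNIV - {0}))
   + (\<integral>\<^sup>+l. shift_term b pr qo f h l \<partial>count_space (UNIV - {0}))
   + (\<integral>\<^sup>+l. shift_term b pr qr f h l \<partial>count_space UNIV))"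
proof -
  have i1: "integrable lebesgue (\<lambda>t. U t * cnj (V t) * indicator I t)"
    using integrable_mult_indicator[OF Ilebesgue L2_integrable[OF U V]]
    by (simp add: scaleR_conv_of_real of_real_indicator mult.commute)
  have i2: "integrable lebesgue (\<lambda>t. u t * cnj (v t) * indicator I t)"
    using integrable_mult_indicator[OF Ilebesgue L2_integrable[OF u v]]
    by (simp add: scaleR_conv_of_real of_real_indicator mult.commute)
  have "Q - D = of_real T * (LINT t|lebesgue. U t * cnj (V t) * indicator I t - u t * cnj (v t) * indicator I t)"
    unfolding Q_def D_def by (subst Bochner_Integration.integral_diff[OF i1 i2]) (simp add: right_diff_distrib)
  then have "ennreal (cmod (Q - D)) = ennreal T * ennreal (cmod (LINT t|lebesgue. U t * cnj (V t) * indicator I t - u t * cnj (v t) * indicator I t))"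
    using T by (simp add: norm_mult ennreal_mult)
  also have "\<dots> \<le> ennreal T * (\<integral>\<^sup>+t. ennreal (cmod (U t * cnj (V t) * indicator I t - u t * cnj (v t) * indicator I t)) \<partial>lebesgue)"
    by (intro mult_left_mono integral_norm_bound_ennreal Bochner_Integration.integrable_diff i1 i2) simp
  also have "(\<integral>\<^sup>+t. ennreal (cmod (U t * cnj (V t) * indicator I t - u t * cnj (v t) * indicator I t)) \<partial>lebesgue)
    \<le> (\<integral>\<^sup>+t. (\<Sum>j\<in>J'. ennreal (uo t * vr (t + of_int j * T)))
     + (\<Sum>i\<in>J'. ennreal (ur (t + of_int i * T) * vo t))
     + (\<Sum>j\<in>J'. \<Sum>i\<in>J'. ennreal (ur (t + of_int i * T) * vr (t + of_int j * T)) * indicator I t) \<partial>lebesgue)"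
  proof (rule nn_integral_mono_AE)
    show "AE t in lebesgue. ennreal (cmod (U t * cnj (V t) * indicator I t - u t * cnj (v t) * indicator I t))
      \<le> (\<Sum>j\<in>J'. ennreal (uo t * vr (t + of_int j * T)))
     + (\<Sum>i\<in>J'. ennreal (ur (t + of_int i * T) * vo t))
     + (\<Sum>j\<in>J'. \<Sum>i\<in>J'. ennreal (ur (t + of_int i * T) * vr (t + of_int j * T)) * indicator I t)"
      using AE_not_lattice[of \<alpha> T]
    proof eventually_elim
      case (elim t)
      show ?case
      proof (cases "t \<in> I")
        case True
        have ne: "t \<noteq> \<alpha>" "t \<noteq> \<alpha> + T" using elim[rule_format, of 0] elim[rule_format, of 1] by auto
        have "ennreal (cmod (U t * cnj (V t) - u t * cnj (v t))) \<le> ennreal ((\<Sum>j\<in>J'. uo t * vr (t + of_int j * T))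
     + (\<Sum>i\<in>J'. ur (t + of_int i * T) * vo t) + (\<Sum>j\<in>J'. \<Sum>i\<in>J'. ur (t + of_int i * T) * vr (t + of_int j * T)))"
          by (rule ennreal_leI[OF pointwise_bound[OF True ne]])
        also have "\<dots> = (\<Sum>j\<in>J'. ennreal (uo t * vr (t + of_int j * T)))
     + (\<Sum>i\<in>J'. ennreal (ur (t + of_int i * T) * vo t))
     + (\<Sum>j\<in>J'. \<Sum>i\<in>J'. ennreal (ur (t + of_int i * T) * vr (t + of_int j * T)))"
          by (simp add: ennreal_plus sum_nonneg nonneg sum_ennreal)
        finally show ?thesis using True by simp
      qed simp
    qed
  qed
  also have "\<dots> = (\<Sum>j\<in>J'. \<integral>\<^sup>+t. ennreal (uo t * vr (t + of_int j * T)) \<partial>lebesgue)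
     + (\<Sum>i\<in>J'. \<integral>\<^sup>+t. ennreal (ur (t + of_int i * T) * vo t) \<partial>lebesgue)
     + (\<Sum>j\<in>J'. \<Sum>i\<in>J'. \<integral>\<^sup>+t. ennreal (ur (t + of_int i * T) * vr (t + of_int j * T)) * indicator I t \<partial>lebesgue)"
    by (simp add: nn_integral_add nn_integral_sum)
  also have "\<dots> \<le> (\<integral>\<^sup>+l. shift_term b po qr f h l \<partial>count_space (UNIV - {0}))
   + (\<integral>\<^sup>+l. shift_term b pr qo f h l \<partial>count_space (UNIV - {0}))
   + (\<integral>\<^sup>+l. shift_term b pr qr f h l \<partial>count_space UNIV)"
  proof (intro add_mono tail_tail_term)
    show "(\<Sum>j\<in>J'. \<integral>\<^sup>+t. ennreal (uo t * vr (t + of_int j * T)) \<partial>lebesgue) \<le> (\<integral>\<^sup>+l. shift_term b po qr f h l \<partial>count_space (UNIV - {0}))"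
      unfolding core_tail_term by (rule sum_le_nn_integral_count_space) (use finJ in \<open>auto simp: J'_def\<close>)
    \<comment> \<open>The shift enters with opposite sign here; reindexing by negation keeps the
      indices nonzero.\<close>
    have "(\<Sum>i\<in>J'. \<integral>\<^sup>+t. ennreal (ur (t + of_int i * T) * vo t) \<partial>lebesgue) = (\<Sum>l\<in>uminus ` J'. shift_term b pr qo f h l)"
      unfolding tail_core_term by (subst sum.reindex) (auto simp: inj_on_def)
    also have "\<dots> \<le> (\<integral>\<^sup>+l. shift_term b pr qo f h l \<partial>count_space (UNIV - {0}))"
      by (rule sum_le_nn_integral_count_space) (use finJ in \<open>auto simp: J'_def\<close>)
    finally show "(\<Sum>i\<in>J'. \<integral>\<^sup>+t. ennreal (ur (t + of_int i * T) * vo t) \<partial>lebesgue) \<le> (\<integral>\<^sup>+l. shift_term b pr qo f h l \<partial>count_space (UNIV - {0}))" .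
  qed
  finally show ?thesis by (simp add: mult_left_mono)
qed

end

subsection \<open>Schur test for the shifted cross terms\<close>

text \<open>Links the unordered sums in the definitions to counting-measure integrals. Countability
  lets the integral be enumerated as a series, whose partial sums are finite subsums.\<close>

lemma infsum_ennreal_eq_nn_integral:
  fixes f :: "'a \<Rightarrow> ennreal"
  assumes "countable A"
  shows "(\<Sum>\<^sub>\<infinity>i\<in>A. f i) = (\<integral>\<^sup>+i. f i \<partial>count_space A)"
proof (rule antisym)
  show "(\<Sum>\<^sub>\<infinity>i\<in>A. f i) \<le> (\<integral>\<^sup>+i. f i \<partial>count_space A)"
    by (rule infsum_le_finite_sums) (auto intro: nonneg_summable_on_complete sum_le_nn_integral_count_space)
  show "(\<integral>\<^sup>+i. f i \<partial>count_space A) \<le> (\<Sum>\<^sub>\<infinity>i\<in>A. f i)"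
  proof (cases "finite A")
    case True
    then show ?thesis by (simp add: nn_integral_count_space_finite)
  next
    case False
    note bij = bij_betw_from_nat_into[OF assms False]
    have "(\<integral>\<^sup>+i. f i \<partial>count_space A) = (\<Sum>n. f (from_nat_into A n))"
      by (simp add: nn_integral_bij_count_space[symmetric, OF bij] nn_integral_count_space_nat)
    also have "\<dots> \<le> (\<Sum>\<^sub>\<infinity>i\<in>A. f i)"
    proof (rule suminf_le_const)
      fix n
      have "(\<Sum>m<n. f (from_nat_into A m)) = (\<Sum>i\<in>from_nat_into A ` {..<n}. f i)"
        using bij by (subst sum.reindex) (auto simp: bij_betw_def intro: inj_on_subset)
      also have "\<dots> \<le> (\<Sum>\<^sub>\<infinity>i\<in>A. f i)"
        using bij by (intro ennreal_sum_le_infsum) (auto simp: bij_betw_def)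
      finally show "(\<Sum>m<n. f (from_nat_into A m)) \<le> (\<Sum>\<^sub>\<infinity>i\<in>A. f i)" .
    qed simp
    finally show ?thesis .
  qed
qed

lemma nn_integral_count_space_Times:
  assumes "countable A" "countable B"
  shows "(\<integral>\<^sup>+x. \<integral>\<^sup>+y. F (x, y) \<partial>count_space B \<partial>count_space A) = (\<integral>\<^sup>+z. F z \<partial>count_space (A \<times> B))"
proof -
  interpret B: sigma_finite_measure "count_space B"
    using assms(2) by (rule sigma_finite_measure_count_space_countable)
  have eq: "count_space A \<Otimes>\<^sub>M count_space B = count_space (A \<times> B)"
    using assms by (rule pair_measure_countable)
  have "F \<in> borel_measurable (count_space A \<Otimes>\<^sub>M count_space B)" unfolding eq by simp
  from B.nn_integral_fst[OF this] show ?thesis unfolding eq .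
qed

lemma sigma_finite_lebesgue: "sigma_finite_measure (lebesgue :: real measure)"
proof
  have "(\<Union>n::nat. {- real n..real n}) = UNIV"
  proof safe
    fix x :: real
    obtain n :: nat where "\<bar>x\<bar> \<le> real n" using real_arch_simple by blast
    then show "x \<in> (\<Union>n::nat. {- real n..real n})" by (intro UN_I[of n]) auto
  qed simp
  then show "\<exists>A::real set set. countable A \<and> A \<subseteq> sets lebesgue \<and> \<Union> A = space lebesgue \<and> (\<forall>a\<in>A. emeasure lebesgue a \<noteq> \<infinity>)"
    by (intro exI[of _ "range (\<lambda>n::nat. {- real n..real n})"]) auto
qed

text \<open>Cauchy-Schwarz on the product of counting measure and Lebesgue measure, so that the sum
  over the indices and the integral are estimated in one stroke. Countability of \<open>A\<close>
  gives joint measurability.\<close>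

lemma Cauchy_Schwarz_sum_nn_integral:
  fixes F G :: "'i \<Rightarrow> real \<Rightarrow> ennreal"
  assumes A: "countable A"
    and [measurable]: "\<And>i. i \<in> A \<Longrightarrow> F i \<in> borel_measurable lebesgue" "\<And>i. i \<in> A \<Longrightarrow> G i \<in> borel_measurable lebesgue"
  shows "(\<integral>\<^sup>+i. \<integral>\<^sup>+t. F i t * G i t \<partial>lebesgue \<partial>count_space A)\<^sup>2
    \<le> (\<integral>\<^sup>+i. \<integral>\<^sup>+t. (F i t)\<^sup>2 \<partial>lebesgue \<partial>count_space A) * (\<integral>\<^sup>+i. \<integral>\<^sup>+t. (G i t)\<^sup>2 \<partial>lebesgue \<partial>count_space A)"
proof -
  interpret lebesgue: sigma_finite_measure "lebesgue :: real measure"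
    by (rule sigma_finite_lebesgue)
  have FM: "case_prod F \<in> borel_measurable (count_space A \<Otimes>\<^sub>M lebesgue)"
    and GM: "case_prod G \<in> borel_measurable (count_space A \<Otimes>\<^sub>M lebesgue)"
    by (rule measurable_pair_measure_countable1[OF A]; simp)+
  note FM[measurable] GM[measurable]
  have 1: "(\<integral>\<^sup>+i. \<integral>\<^sup>+t. F i t * G i t \<partial>lebesgue \<partial>count_space A) = (\<integral>\<^sup>+z. case_prod F z * case_prod G z \<partial>(count_space A \<Otimes>\<^sub>M lebesgue))"
    by (subst lebesgue.nn_integral_fst[symmetric]) simp_all
  have 2: "(\<integral>\<^sup>+i. \<integral>\<^sup>+t. (F i t)\<^sup>2 \<partial>lebesgue \<partial>count_space A) = (\<integral>\<^sup>+z. (case_prod F z)\<^sup>2 \<partial>(count_space A \<Otimes>\<^sub>M lebesgue))"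
    by (subst lebesgue.nn_integral_fst[symmetric]) simp_all
  have 3: "(\<integral>\<^sup>+i. \<integral>\<^sup>+t. (G i t)\<^sup>2 \<partial>lebesgue \<partial>count_space A) = (\<integral>\<^sup>+z. (case_prod G z)\<^sup>2 \<partial>(count_space A \<Otimes>\<^sub>M lebesgue))"
    by (subst lebesgue.nn_integral_fst[symmetric]) simp_all
  show ?thesis unfolding 1 2 3 by (rule Cauchy_Schwarz_nn_integral[OF FM GM])
qed

lemma measurable_shift_comp:
  fixes c :: real
  assumes "F \<in> borel_measurable lebesgue"
  shows "(\<lambda>t. F (t - c)) \<in> borel_measurable lebesgue"
  using measurable_lebesgue_shift[OF assms, of "- c"] by simp

text \<open>The summand of \<open>nsg_G\<close> with both indices in one pair. It is real-valued
  because the Schur test splits it into two square roots.\<close>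

definition cross_weight :: "(int \<Rightarrow> real) \<Rightarrow> (int \<Rightarrow> real \<Rightarrow> complex) \<Rightarrow> (int \<Rightarrow> real \<Rightarrow> complex) \<Rightarrow> int \<times> int \<Rightarrow> real \<Rightarrow> real" where
  "cross_weight b p q = (\<lambda>(k, l) t. inverse (b k) * cmod (p k (t - of_int l * inverse (b k))) * cmod (q k t))"

definition shift_total ::
  "(int \<Rightarrow> real) \<Rightarrow> (int \<Rightarrow> real \<Rightarrow> complex) \<Rightarrow> (int \<Rightarrow> real \<Rightarrow> complex) \<Rightarrow> (real \<Rightarrow> complex) \<Rightarrow> (real \<Rightarrow> complex) \<Rightarrow> int set \<Rightarrow> ennreal" where
  "shift_total b p q f h L =
     (\<integral>\<^sup>+k. ennreal (inverse (b k)) * (\<integral>\<^sup>+l. shift_term (b k) (p k) (q k) f h l \<partial>count_space L) \<partial>count_space UNIV)"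

locale window_pair =
  fixes b :: "int \<Rightarrow> real" and p q :: "int \<Rightarrow> real \<Rightarrow> complex"
  assumes b: "\<And>k. 0 < b k" and p[measurable]: "\<And>k. p k \<in> borel_measurable lebesgue"
    and q[measurable]: "\<And>k. q k \<in> borel_measurable lebesgue"
begin

lemma measurable_cross_weight[measurable]:
  "cross_weight b p q i \<in> borel_measurable lebesgue"
proof (cases i)
  case (Pair k l)
  have [measurable]: "(\<lambda>t. p k (t - of_int l * inverse (b k))) \<in> borel_measurable lebesgue"
    by (intro measurable_shift_comp p)
  show ?thesis unfolding Pair cross_weight_def by simp
qed

lemma cross_weight_nonneg[simp]: "0 \<le> cross_weight b p q i t"
  using b by (auto simp: cross_weight_def split_def less_imp_le)

lemma nsg_G_sum:
  "(\<Sum>\<^sub>\<infinity>l\<in>L. nsg_G b p q l t) = (\<integral>\<^sup>+i. ennreal (cross_weight b p q i t) \<partial>count_space (UNIV \<times> L))"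
proof -
  have "(\<Sum>\<^sub>\<infinity>l\<in>L. nsg_G b p q l t) = (\<integral>\<^sup>+l. \<integral>\<^sup>+k. ennreal (cross_weight b p q (k, l) t) \<partial>count_space UNIV \<partial>count_space L)"
    by (simp add: nsg_G_def infsum_ennreal_eq_nn_integral cross_weight_def)
  also have "\<dots> = (\<integral>\<^sup>+k. \<integral>\<^sup>+l. ennreal (cross_weight b p q (k, l) t) \<partial>count_space L \<partial>count_space UNIV)"
    by (intro nn_integral_count_space_nn_integral[symmetric]) auto
  also have "\<dots> = (\<integral>\<^sup>+i. ennreal (cross_weight b p q i t) \<partial>count_space (UNIV \<times> L))"
    by (rule nn_integral_count_space_Times) auto
  finally show ?thesis .
qed

text \<open>By Tonelli the weights may be summed at fixed \<open>t\<close>; their sum is the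
  function whose essential supremum appears, so this supremum can be pulled out of the
  integral.\<close>

lemma weighted_le_esssup:
  assumes h: "h \<in> borel_measurable lebesgue"
  shows "(\<integral>\<^sup>+i. \<integral>\<^sup>+t. ennreal (cross_weight b p q i t * (cmod (h t))\<^sup>2) \<partial>lebesgue \<partial>count_space (UNIV \<times> L))
    \<le> esssup lebesgue (\<lambda>t. \<Sum>\<^sub>\<infinity>l\<in>L. nsg_G b p q l t) * (\<integral>\<^sup>+t. ennreal ((cmod (h t))\<^sup>2) \<partial>lebesgue)"
proof -
  note h[measurable]
  have "(\<integral>\<^sup>+i. \<integral>\<^sup>+t. ennreal (cross_weight b p q i t * (cmod (h t))\<^sup>2) \<partial>lebesgue \<partial>count_space (UNIV \<times> L))
    = (\<integral>\<^sup>+t. \<integral>\<^sup>+i. ennreal (cross_weight b p q i t * (cmod (h t))\<^sup>2) \<partial>count_space (UNIV \<times> L) \<partial>lebesgue)"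
    by (rule nn_integral_count_space_nn_integral[symmetric]) auto
  also have "\<dots> = (\<integral>\<^sup>+t. (\<Sum>\<^sub>\<infinity>l\<in>L. nsg_G b p q l t) * ennreal ((cmod (h t))\<^sup>2) \<partial>lebesgue)"
    by (simp add: nsg_G_sum ennreal_mult nn_integral_multc)
  also have "\<dots> \<le> (\<integral>\<^sup>+t. esssup lebesgue (\<lambda>t. \<Sum>\<^sub>\<infinity>l\<in>L. nsg_G b p q l t) * ennreal ((cmod (h t))\<^sup>2) \<partial>lebesgue)"
    using esssup_AE[of "\<lambda>t. \<Sum>\<^sub>\<infinity>l\<in>L. nsg_G b p q l t" lebesgue]
    by (intro nn_integral_mono_AE) (auto elim!: eventually_mono intro!: mult_right_mono)
  also have "\<dots> = esssup lebesgue (\<lambda>t. \<Sum>\<^sub>\<infinity>l\<in>L. nsg_G b p q l t) * (\<integral>\<^sup>+t. ennreal ((cmod (h t))\<^sup>2) \<partial>lebesgue)"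
    by (rule nn_integral_cmult) measurable
  finally show ?thesis .
qed

lemma shift_total_pairs:
  "shift_total b p q f h L = (\<integral>\<^sup>+i. \<integral>\<^sup>+t. ennreal (cross_weight b p q i t * (cmod (f (t - of_int (snd i) * inverse (b (fst i)))) * cmod (h t)))
     \<partial>lebesgue \<partial>count_space (UNIV \<times> L))"
  if fh: "f \<in> borel_measurable lebesgue" "h \<in> borel_measurable lebesgue"
proof -
  have [measurable]: "(\<lambda>t. f (t - c)) \<in> borel_measurable lebesgue" for c by (intro measurable_shift_comp fh)
  have [measurable]: "(\<lambda>t. p k (t - c)) \<in> borel_measurable lebesgue" for c k by (intro measurable_shift_comp p)
  note fh(2)[measurable]
  have 1: "ennreal (inverse (b k)) * shift_term (b k) (p k) (q k) f h l
    = (\<integral>\<^sup>+t. ennreal (cross_weight b p q (k, l) t * (cmod (f (t - of_int l * inverse (b k))) * cmod (h t))) \<partial>lebesgue)" for k l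
    unfolding shift_term_def using b[of k]
    by (subst nn_integral_cmult[symmetric])
      (auto intro!: nn_integral_cong simp: cross_weight_def ennreal_mult[symmetric] mult_ac less_imp_le)
  have "shift_total b p q f h L = (\<integral>\<^sup>+k. \<integral>\<^sup>+l. ennreal (inverse (b k)) * shift_term (b k) (p k) (q k) f h l \<partial>count_space L \<partial>count_space UNIV)"
    by (simp add: shift_total_def nn_integral_cmult)
  also have "\<dots> = (\<integral>\<^sup>+i. \<integral>\<^sup>+t. ennreal (cross_weight b p q i t * (cmod (f (t - of_int (snd i) * inverse (b (fst i)))) * cmod (h t)))
     \<partial>lebesgue \<partial>count_space (UNIV \<times> L))"
    unfolding 1 by (subst nn_integral_count_space_Times[symmetric]) auto
  finally show ?thesis .
qed

end

text \<open>Translating by \<open>l/b\<close> moves the shift from the first window to the second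
  and reverses its sign. This exchange is the reason why \<open>nsg_R\<close> occurs with both
  orders of its arguments.\<close>

lemma cross_weight_swap:
  "(\<integral>\<^sup>+t. ennreal (cross_weight b p q (k, l) t * (cmod (f (t - of_int l * inverse (b k))))\<^sup>2) \<partial>lebesgue)
  = (\<integral>\<^sup>+t. ennreal (cross_weight b q p (k, - l) t * (cmod (f t))\<^sup>2) \<partial>lebesgue)"
  if "window_pair b p q" "f \<in> borel_measurable lebesgue"
proof -
  interpret window_pair b p q by fact
  interpret qp: window_pair b q p using b p q by unfold_locales
  note that(2)[measurable]
  have m: "(\<lambda>t. ennreal (cross_weight b q p (k, - l) t * (cmod (f t))\<^sup>2)) \<in> borel_measurable lebesgue" by measurable
  show ?thesis
    using nn_integral_lebesgue_shift[OF m, of "- (of_int l * inverse (b k))"]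
    by (simp add: cross_weight_def mult_ac)
qed

text \<open>The weight is written as a product of two equal square roots, one attached to the
  shifted \<open>f\<close>, the other to \<open>h\<close>. The factor with \<open>h\<close> is
  bounded directly, the factor with \<open>f\<close> after a translation that exchanges the
  windows.\<close>

lemma Schur_test:
  assumes "window_pair b p q" and f: "f \<in> borel_measurable lebesgue" and h: "h \<in> borel_measurable lebesgue"
    and L: "uminus ` L = L"
  shows "(shift_total b p q f h L)\<^sup>2
    \<le> (esssup lebesgue (\<lambda>t. \<Sum>\<^sub>\<infinity>l\<in>L. nsg_G b q p l t) * (\<integral>\<^sup>+t. ennreal ((cmod (f t))\<^sup>2) \<partial>lebesgue))
    * (esssup lebesgue (\<lambda>t. \<Sum>\<^sub>\<infinity>l\<in>L. nsg_G b p q l t) * (\<integral>\<^sup>+t. ennreal ((cmod (h t))\<^sup>2) \<partial>lebesgue))"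
proof -
  interpret window_pair b p q by fact
  interpret qp: window_pair b q p using b p q by unfold_locales
  have fs[measurable]: "(\<lambda>t. f (t - c)) \<in> borel_measurable lebesgue" for c by (intro measurable_shift_comp f)
  note f[measurable] h[measurable]
  define F where "F = (\<lambda>i t. ennreal (sqrt (cross_weight b p q i t) * cmod (f (t - of_int (snd i) * inverse (b (fst i))))))"
  define H where "H = (\<lambda>i t. ennreal (sqrt (cross_weight b p q i t) * cmod (h t)))"
  have FH: "F i t * H i t = ennreal (cross_weight b p q i t * (cmod (f (t - of_int (snd i) * inverse (b (fst i)))) * cmod (h t)))" for i t
    unfolding F_def H_def by (simp add: ennreal_mult[symmetric] mult.left_commute mult.assoc[symmetric])
  have F2: "(F i t)\<^sup>2 = ennreal (cross_weight b p q i t * (cmod (f (t - of_int (snd i) * inverse (b (fst i)))))\<^sup>2)" for i t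
    unfolding F_def by (simp add: ennreal_power power_mult_distrib)
  have H2: "(H i t)\<^sup>2 = ennreal (cross_weight b p q i t * (cmod (h t))\<^sup>2)" for i t
    unfolding H_def by (simp add: ennreal_power power_mult_distrib)
  have "(shift_total b p q f h L)\<^sup>2 \<le> (\<integral>\<^sup>+i. \<integral>\<^sup>+t. (F i t)\<^sup>2 \<partial>lebesgue \<partial>count_space (UNIV \<times> L))
    * (\<integral>\<^sup>+i. \<integral>\<^sup>+t. (H i t)\<^sup>2 \<partial>lebesgue \<partial>count_space (UNIV \<times> L))"
    unfolding shift_total_pairs[OF f h] FH[symmetric]
    by (rule Cauchy_Schwarz_sum_nn_integral) (auto simp: F_def H_def)
  also have "\<dots> \<le> (esssup lebesgue (\<lambda>t. \<Sum>\<^sub>\<infinity>l\<in>L. nsg_G b q p l t) * (\<integral>\<^sup>+t. ennreal ((cmod (f t))\<^sup>2) \<partial>lebesgue))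
    * (esssup lebesgue (\<lambda>t. \<Sum>\<^sub>\<infinity>l\<in>L. nsg_G b p q l t) * (\<integral>\<^sup>+t. ennreal ((cmod (h t))\<^sup>2) \<partial>lebesgue))"
  proof (rule mult_mono)
    \<comment> \<open>Undoes the sign change of \<open>l\<close> caused by the translation; it maps
      the index set onto itself because \<open>L\<close> is symmetric.\<close>
    define g where "g = (\<lambda>(k :: int, l :: int). (k, - l))"
    have bij: "bij_betw g (UNIV \<times> L) (UNIV \<times> L)"
      unfolding bij_betw_def
    proof
      show "inj_on g (UNIV \<times> L)" by (auto simp: g_def inj_on_def)
      show "g ` (UNIV \<times> L) = UNIV \<times> L"
      proof safe
        fix k l assume "l \<in> L"
        then have "l \<in> uminus ` L" using L by simp
        then obtain m where "m \<in> L" "l = - m" by auto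
        then have "(k, l) = g (k, m)" "(k, m) \<in> UNIV \<times> L" by (auto simp: g_def)
        then show "(k, l) \<in> g ` (UNIV \<times> L)" by blast
      next
        fix k l k' l' assume "l' \<in> L" "(k, l) = g (k', l')"
        then have "l \<in> uminus ` L" by (auto simp: g_def)
        then show "l \<in> L" using L by simp
      qed simp
    qed
    have "(\<integral>\<^sup>+i. \<integral>\<^sup>+t. (F i t)\<^sup>2 \<partial>lebesgue \<partial>count_space (UNIV \<times> L))
      = (\<integral>\<^sup>+i. \<integral>\<^sup>+t. ennreal (cross_weight b q p (g i) t * (cmod (f t))\<^sup>2) \<partial>lebesgue \<partial>count_space (UNIV \<times> L))"
      unfolding F2 by (rule nn_integral_cong) (auto simp: g_def cross_weight_swap[OF assms(1) f])
    also have "\<dots> = (\<integral>\<^sup>+i. \<integral>\<^sup>+t. ennreal (cross_weight b q p i t * (cmod (f t))\<^sup>2) \<partial>lebesgue \<partial>count_space (UNIV \<times> L))"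
      by (rule nn_integral_bij_count_space[OF bij])
    also have "\<dots> \<le> esssup lebesgue (\<lambda>t. \<Sum>\<^sub>\<infinity>l\<in>L. nsg_G b q p l t) * (\<integral>\<^sup>+t. ennreal ((cmod (f t))\<^sup>2) \<partial>lebesgue)"
      by (rule qp.weighted_le_esssup[OF f])
    finally show "(\<integral>\<^sup>+i. \<integral>\<^sup>+t. (F i t)\<^sup>2 \<partial>lebesgue \<partial>count_space (UNIV \<times> L))
      \<le> esssup lebesgue (\<lambda>t. \<Sum>\<^sub>\<infinity>l\<in>L. nsg_G b q p l t) * (\<integral>\<^sup>+t. ennreal ((cmod (f t))\<^sup>2) \<partial>lebesgue)" .
    show "(\<integral>\<^sup>+i. \<integral>\<^sup>+t. (H i t)\<^sup>2 \<partial>lebesgue \<partial>count_space (UNIV \<times> L))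
      \<le> esssup lebesgue (\<lambda>t. \<Sum>\<^sub>\<infinity>l\<in>L. nsg_G b p q l t) * (\<integral>\<^sup>+t. ennreal ((cmod (h t))\<^sup>2) \<partial>lebesgue)"
      unfolding H2 by (rule weighted_le_esssup[OF h])
  qed auto
  finally show ?thesis .
qed

subsection \<open>Frame operator of a painless system\<close>

lemma has_sum_ennreal:
  fixes g :: "'i \<Rightarrow> real"
  assumes "(g has_sum s) A" "\<And>i. i \<in> A \<Longrightarrow> 0 \<le> g i"
  shows "(\<Sum>\<^sub>\<infinity>i\<in>A. ennreal (g i)) = ennreal s"
proof (rule infsumI)
  have "((\<lambda>F. ennreal (\<Sum>i\<in>F. g i)) \<longlongrightarrow> ennreal s) (finite_subsets_at_top A)"
    using assms(1) by (intro tendsto_ennrealI) (simp add: has_sum_def)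
  then show "((\<lambda>i. ennreal (g i)) has_sum ennreal s) A"
    unfolding has_sum_def
    by (rule Lim_transform_eventually)
      (auto intro!: eventually_finite_subsets_at_top_weakI sum_ennreal[symmetric] assms(2))
qed

lemma borel_measurable_nn_integral_count_space:
  fixes f :: "'i \<Rightarrow> 'a \<Rightarrow> ennreal"
  assumes A: "countable A" and f: "\<And>i. i \<in> A \<Longrightarrow> f i \<in> borel_measurable M"
  shows "(\<lambda>t. \<integral>\<^sup>+i. f i t \<partial>count_space A) \<in> borel_measurable M"
proof (cases "finite A")
  case True
  then show ?thesis using f by (simp add: nn_integral_count_space_finite)
next
  case False
  note bij = bij_betw_from_nat_into[OF A False]
  have "from_nat_into A n \<in> A" for n using bij by (auto simp: bij_betw_def)
  then show ?thesis
    unfolding nn_integral_bij_count_space[OF bij, symmetric] nn_integral_count_space_nat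
    using f by (intro borel_measurable_suminf_order) auto
qed

text \<open>The window lives on a single tile, so its coefficients are directly the Fourier
  coefficients of \<open>cnj p * f\<close> on that tile, and Parseval with equal arguments
  applies.\<close>

lemma painless_coeff_sum:
  fixes b \<alpha> :: real and p :: "real \<Rightarrow> complex"
  defines "I \<equiv> {\<alpha>..\<alpha> + inverse b}"
  assumes b: "0 < b" and f: "f \<in> L2" and p: "p \<in> borel_measurable lebesgue"
    and C: "0 \<le> C" "AE t in lebesgue. cmod (p t) \<le> C"
  shows "(\<Sum>\<^sub>\<infinity>l::int. ennreal ((cmod (L2_inner f (modulation (of_int l * b) (\<lambda>t. p t * indicator I t))))\<^sup>2))
    = (\<integral>\<^sup>+t. ennreal (inverse b * (cmod (p t * indicator I t))\<^sup>2) * ennreal ((cmod (f t))\<^sup>2) \<partial>lebesgue)"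
proof -
  define u where "u = (\<lambda>t. cnj (p t) * f t)"
  have pc: "(\<lambda>t. cnj (p t)) \<in> borel_measurable lebesgue"
    by (rule measurable_compose[OF p borel_measurable_continuous_onI]) (auto intro: continuous_intros)
  have u: "u \<in> L2" unfolding u_def by (rule L2_mult_bounded(1)[OF f pc, of C]) (use C in auto)
  define e where "e = (\<lambda>l::int. modulation (of_int l * b) (indicator I))"
  have fe: "L2_inner f (modulation (of_int l * b) (\<lambda>t. p t * indicator I t)) = L2_inner u (e l)" for l
    unfolding L2_inner_def
    by (rule Bochner_Integration.integral_cong) (auto simp: u_def e_def modulation_expo indicator_def)
  have Is: "I \<in> sets lebesgue" by (simp add: I_def)
  have i: "integrable lebesgue (\<lambda>t. (cmod (u t * indicator I t))\<^sup>2)"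
    using L2_indicator(1)[OF u Is] by (simp add: L2_iff)
  have "((\<lambda>l. L2_inner u (e l) * L2_inner (e l) u) has_sum
    of_real (inverse b) * (LINT t|lebesgue. u t * cnj (u t) * indicator I t)) UNIV"
    unfolding e_def I_def by (rule exponentials_parseval[OF b u u])
  moreover have "L2_inner u (e l) * L2_inner (e l) u = of_real ((cmod (L2_inner u (e l)))\<^sup>2)" for l
    unfolding L2_inner_cnj[of u "e l", symmetric] by (rule complex_norm_square[symmetric])
  moreover have "of_real (inverse b) * (LINT t|lebesgue. u t * cnj (u t) * indicator I t)
    = of_real (inverse b * (LINT t|lebesgue. (cmod (u t * indicator I t))\<^sup>2))"
  proof -
    have "(LINT t|lebesgue. u t * cnj (u t) * indicator I t) = (LINT t|lebesgue. of_real ((cmod (u t * indicator I t))\<^sup>2))"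
      by (rule Bochner_Integration.integral_cong) (auto simp: indicator_def complex_norm_square simp del: of_real_power)
    then show ?thesis by (simp only: integral_complex_of_real of_real_mult)
  qed
  ultimately have "((\<lambda>l. complex_of_real ((cmod (L2_inner u (e l)))\<^sup>2)) has_sum
    of_real (inverse b * (LINT t|lebesgue. (cmod (u t * indicator I t))\<^sup>2))) UNIV"
    by (simp only:)
  then have "((\<lambda>l. (cmod (L2_inner u (e l)))\<^sup>2) has_sum inverse b * (LINT t|lebesgue. (cmod (u t * indicator I t))\<^sup>2)) UNIV"
    by (simp only: has_sum_of_real_iff)
  then have "(\<Sum>\<^sub>\<infinity>l. ennreal ((cmod (L2_inner u (e l)))\<^sup>2)) = ennreal (inverse b * (LINT t|lebesgue. (cmod (u t * indicator I t))\<^sup>2))"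
    by (rule has_sum_ennreal) simp
  also have "\<dots> = (\<integral>\<^sup>+t. ennreal (inverse b * (cmod (u t * indicator I t))\<^sup>2) \<partial>lebesgue)"
    using i b by (subst nn_integral_eq_integral) (auto simp: less_imp_le)
  also have "\<dots> = (\<integral>\<^sup>+t. ennreal (inverse b * (cmod (p t * indicator I t))\<^sup>2) * ennreal ((cmod (f t))\<^sup>2) \<partial>lebesgue)"
    using b by (intro nn_integral_cong) (auto simp: u_def norm_mult power_mult_distrib ennreal_mult[symmetric] less_imp_le mult_ac)
  finally show ?thesis by (simp add: fe)
qed

text \<open>Test on the part \<open>E\<close> of a bounded interval where the claim fails: there
  \<open>H\<close> is at most \<open>c\<close>, so its integral is finite and can be subtracted, and
  the excess has integral 0. The bound is required only where \<open>H < F\<close>, so that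
  \<open>H\<close> may be \<open>G0\<close> as well as a constant.\<close>

lemma AE_le_if_integrals_le:
  fixes F H :: "real \<Rightarrow> ennreal"
  assumes F: "F \<in> borel_measurable lebesgue" and H: "H \<in> borel_measurable lebesgue"
    and c: "c < \<infinity>" "\<And>t. H t < F t \<Longrightarrow> H t \<le> c"
    and le: "\<And>E n. E \<in> sets lebesgue \<Longrightarrow> E \<subseteq> {- real n..real n} \<Longrightarrow>
      (\<integral>\<^sup>+t. F t * indicator E t \<partial>lebesgue) \<le> (\<integral>\<^sup>+t. H t * indicator E t \<partial>lebesgue)"
  shows "AE t in lebesgue. F t \<le> H t"
proof -
  note F[measurable] H[measurable]
  have "AE t in lebesgue. t \<in> {- real n..real n} \<longrightarrow> F t \<le> H t" for n :: nat
  proof -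
    define E where "E = {t \<in> space lebesgue. H t < F t} \<inter> {- real n..real n}"
    have E[measurable]: "E \<in> sets lebesgue" unfolding E_def by (rule sets.Int) (measurable, simp)
    have Hfin: "(\<integral>\<^sup>+t. H t * indicator E t \<partial>lebesgue) \<noteq> \<infinity>"
    proof -
      have "(\<integral>\<^sup>+t. H t * indicator E t \<partial>lebesgue) \<le> (\<integral>\<^sup>+t. c * indicator {- real n..real n} t \<partial>lebesgue)"
        by (intro nn_integral_mono) (auto simp: E_def indicator_def c(2))
      also have "\<dots> = c * ennreal (2 * real n)" by (subst nn_integral_cmult_indicator) auto
      also have "\<dots> < \<infinity>" using c(1) by (simp add: ennreal_mult_less_top)
      finally show ?thesis by simp
    qed
    have "(\<integral>\<^sup>+t. F t * indicator E t \<partial>lebesgue) = (\<integral>\<^sup>+t. H t * indicator E t + (F t - H t) * indicator E t \<partial>lebesgue)"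
      by (intro nn_integral_cong) (auto simp: E_def indicator_def add_diff_inverse_ennreal less_imp_le)
    also have "\<dots> = (\<integral>\<^sup>+t. H t * indicator E t \<partial>lebesgue) + (\<integral>\<^sup>+t. (F t - H t) * indicator E t \<partial>lebesgue)"
      by (rule nn_integral_add) measurable
    finally have "(\<integral>\<^sup>+t. H t * indicator E t \<partial>lebesgue) + (\<integral>\<^sup>+t. (F t - H t) * indicator E t \<partial>lebesgue)
      \<le> (\<integral>\<^sup>+t. H t * indicator E t \<partial>lebesgue) + 0"
      using le[OF E, of n] by (simp add: E_def)
    then have "(\<integral>\<^sup>+t. (F t - H t) * indicator E t \<partial>lebesgue) \<le> 0"
      using Hfin by (simp only: ennreal_add_left_cancel_le) auto
    then have "(\<integral>\<^sup>+t. (F t - H t) * indicator E t \<partial>lebesgue) = 0" by simp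
    then have "AE t in lebesgue. (F t - H t) * indicator E t = 0"
      by (subst (asm) nn_integral_0_iff_AE) auto
    then show ?thesis
    proof eventually_elim
      case (elim t)
      show ?case
      proof (intro impI, rule ccontr)
        assume t: "t \<in> {- real n..real n}" "\<not> F t \<le> H t"
        then have "t \<in> E" by (auto simp: E_def)
        with elim have "F t - H t = 0" by simp
        with t(2) show False by (auto simp: ennreal_minus_eq_0 diff_eq_0_iff_ennreal)
      qed
    qed
  qed
  then have "AE t in lebesgue. \<forall>n::nat. t \<in> {- real n..real n} \<longrightarrow> F t \<le> H t"
    by (simp only: AE_all_countable) blast
  then show ?thesis
  proof eventually_elim
    case (elim t)
    obtain n :: nat where "\<bar>t\<bar> \<le> real n" using real_arch_simple by blast
    then have "t \<in> {- real n..real n}" by auto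
    with elim show ?case by blast
  qed
qed

text \<open>A \<open>Liminf\<close> bounds \<open>f\<close> directly only by constants strictly
  below it; a sequence of such constants tending to it costs countably many null sets.\<close>

lemma essinf_AE:
  assumes "f \<in> borel_measurable M"
  shows "AE x in M. essinf M f \<le> f x"
proof (cases "essinf M f = 0")
  case False
  then obtain u where u: "\<And>n::nat. u n < essinf M f" "u \<longlonglongrightarrow> essinf M f"
    using approx_from_below_dense_linorder[of 0 "essinf M f"] by (auto simp: zero_less_iff_neq_zero)
  have "AE x in M. \<forall>n. u n < f x"
    unfolding AE_all_countable
  proof
    fix n
    show "AE x in M. u n < f x"
      using u(1)[of n] assms by (simp add: essinf_def less_LiminfD)
  qed
  then show ?thesis
  proof eventually_elim
    case (elim x)
    then show ?case using u(2) by (intro LIMSEQ_le_const2[OF u(2)]) (auto intro: less_imp_le)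
  qed
qed simp

lemma essinf_greatest:
  assumes "f \<in> borel_measurable M" "AE x in M. c \<le> f x"
  shows "c \<le> essinf M f"
  using assms by (simp add: essinf_def Liminf_bounded)

lemma nsg_interval_eq:
  assumes "b k \<noteq> 0"
  shows "nsg_interval a b k = {a k - inverse (2 * b k)..a k - inverse (2 * b k) + inverse (b k)}"
  using assms by (auto simp: nsg_interval_def field_simps)

text \<open>Summing the single-window identities over \<open>k\<close> shows that the frame operator
  is multiplication by \<open>G0\<close>; this is its quadratic form.\<close>

lemma painless_frame_operator:
  fixes a b :: "int \<Rightarrow> real" and g :: "int \<Rightarrow> real \<Rightarrow> complex"
  assumes b: "\<And>k. 0 < b k" and g: "\<And>k. g k \<in> borel_measurable lebesgue"
    and C: "\<And>k. 0 \<le> C k" "\<And>k. AE t in lebesgue. cmod (g k t) \<le> C k" and f: "f \<in> L2"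
  shows "(\<Sum>\<^sub>\<infinity>i. ennreal ((cmod (L2_inner f (nsg_atoms b (nsg_core a b g) i)))\<^sup>2))
    = (\<integral>\<^sup>+t. nsg_G b (nsg_core a b g) (nsg_core a b g) 0 t * ennreal ((cmod (f t))\<^sup>2) \<partial>lebesgue)"
proof -
  define go where "go = nsg_core a b g"
  have go: "go k = (\<lambda>t. g k t * indicator {a k - inverse (2 * b k)..a k - inverse (2 * b k) + inverse (b k)} t)" for k
    using nsg_interval_eq[of b k a] b[of k] by (auto simp: go_def nsg_core_def fun_eq_iff)
  have gom[measurable]: "go k \<in> borel_measurable lebesgue" for k
    unfolding go by (rule borel_measurable_mult_indicator[OF g]) simp
  have [measurable]: "f \<in> borel_measurable lebesgue" using f by (rule L2_measurable)
  have "(\<Sum>\<^sub>\<infinity>i. ennreal ((cmod (L2_inner f (nsg_atoms b go i)))\<^sup>2))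
    = (\<integral>\<^sup>+k. \<integral>\<^sup>+l. ennreal ((cmod (L2_inner f (nsg_atoms b go (k, l))))\<^sup>2) \<partial>count_space UNIV \<partial>count_space UNIV)"
    by (subst nn_integral_fst_count_space) (simp add: infsum_ennreal_eq_nn_integral)
  also have "\<dots> = (\<integral>\<^sup>+k. \<integral>\<^sup>+t. ennreal (inverse (b k) * (cmod (go k t))\<^sup>2) * ennreal ((cmod (f t))\<^sup>2) \<partial>lebesgue \<partial>count_space UNIV)"
  proof (rule nn_integral_cong)
    fix k
    show "(\<integral>\<^sup>+l. ennreal ((cmod (L2_inner f (nsg_atoms b go (k, l))))\<^sup>2) \<partial>count_space UNIV)
      = (\<integral>\<^sup>+t. ennreal (inverse (b k) * (cmod (go k t))\<^sup>2) * ennreal ((cmod (f t))\<^sup>2) \<partial>lebesgue)"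
      unfolding go nsg_atoms_def prod.case
      by (subst painless_coeff_sum[OF b f g C, symmetric]) (simp add: infsum_ennreal_eq_nn_integral)
  qed
  also have "\<dots> = (\<integral>\<^sup>+t. \<integral>\<^sup>+k. ennreal (inverse (b k) * (cmod (go k t))\<^sup>2) * ennreal ((cmod (f t))\<^sup>2) \<partial>count_space UNIV \<partial>lebesgue)"
    by (rule nn_integral_count_space_nn_integral[symmetric]) auto
  also have "\<dots> = (\<integral>\<^sup>+t. nsg_G b go go 0 t * ennreal ((cmod (f t))\<^sup>2) \<partial>lebesgue)"
    by (simp add: nn_integral_multc nsg_G_def infsum_ennreal_eq_nn_integral power2_eq_square mult.assoc)
  finally show ?thesis by (simp add: go_def)
qed

text \<open>On indicators of bounded sets the frame inequalities compare integrals of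
  \<open>G0\<close> with integrals of constants over arbitrary bounded measurable sets, which
  determines the pointwise bounds.\<close>

lemma painless_frame_bounds:
  fixes a b :: "int \<Rightarrow> real" and g :: "int \<Rightarrow> real \<Rightarrow> complex"
  defines "G0 \<equiv> nsg_G b (nsg_core a b g) (nsg_core a b g) 0"
  assumes b: "\<And>k. 0 < b k" and g: "\<And>k. g k \<in> borel_measurable lebesgue"
    and C: "\<And>k. 0 \<le> C k" "\<And>k. AE t in lebesgue. cmod (g k t) \<le> C k"
    and fr: "\<And>f. f \<in> L2 \<Longrightarrow> ennreal A * (L2_norm f)\<^sup>2 \<le> (\<Sum>\<^sub>\<infinity>i. ennreal ((cmod (L2_inner f (nsg_atoms b (nsg_core a b g) i)))\<^sup>2))"
      "\<And>f. f \<in> L2 \<Longrightarrow> (\<Sum>\<^sub>\<infinity>i. ennreal ((cmod (L2_inner f (nsg_atoms b (nsg_core a b g) i)))\<^sup>2)) \<le> ennreal B * (L2_norm f)\<^sup>2"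
  shows "G0 \<in> borel_measurable lebesgue" "AE t in lebesgue. ennreal A \<le> G0 t" "AE t in lebesgue. G0 t \<le> ennreal B"
proof -
  have gom: "nsg_core a b g k \<in> borel_measurable lebesgue" for k
    unfolding nsg_core_def[abs_def] nsg_interval_def by (rule borel_measurable_mult_indicator[OF g]) simp
  interpret window_pair b "nsg_core a b g" "nsg_core a b g"
    by unfold_locales (use b gom in auto)
  have "G0 = (\<lambda>t. \<integral>\<^sup>+i. ennreal (cross_weight b (nsg_core a b g) (nsg_core a b g) i t) \<partial>count_space (UNIV \<times> {0}))"
    unfolding nsg_G_sum[symmetric] G0_def by simp
  also have "\<dots> \<in> borel_measurable lebesgue"
    by (rule borel_measurable_nn_integral_count_space) auto
  finally show Gm[measurable]: "G0 \<in> borel_measurable lebesgue" .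
  have ind: "(\<lambda>t. indicator E t) \<in> L2" "(L2_norm (\<lambda>t. indicator E t))\<^sup>2 = emeasure lebesgue E"
    "(\<integral>\<^sup>+t. G0 t * ennreal ((cmod (indicator E t :: complex))\<^sup>2) \<partial>lebesgue) = (\<integral>\<^sup>+t. G0 t * indicator E t \<partial>lebesgue)"
    if E: "E \<in> sets lebesgue" "E \<subseteq> {- real n..real n}" for E n
  proof -
    have n: "(\<integral>\<^sup>+t. ennreal ((cmod (indicator E t :: complex))\<^sup>2) \<partial>lebesgue) = emeasure lebesgue E"
      by (subst nn_integral_indicator[symmetric, OF E(1)]) (auto intro!: nn_integral_cong simp: indicator_def)
    have "emeasure lebesgue E \<le> emeasure lebesgue {- real n..real n}" using E by (intro emeasure_mono) auto
    also have "\<dots> = ennreal (2 * real n)" by simp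
    finally have "emeasure lebesgue E \<le> ennreal (2 * real n)" .
    then show "(\<lambda>t. indicator E t) \<in> L2" using E by (intro L2I) (auto simp: n)
    show "(L2_norm (\<lambda>t. indicator E t))\<^sup>2 = emeasure lebesgue E"
      unfolding L2_norm_def ennsqrt_power2 n ..
    show "(\<integral>\<^sup>+t. G0 t * ennreal ((cmod (indicator E t :: complex))\<^sup>2) \<partial>lebesgue) = (\<integral>\<^sup>+t. G0 t * indicator E t \<partial>lebesgue)"
      by (auto intro!: nn_integral_cong simp: indicator_def)
  qed
  have op: "(\<Sum>\<^sub>\<infinity>i. ennreal ((cmod (L2_inner f (nsg_atoms b (nsg_core a b g) i)))\<^sup>2))
    = (\<integral>\<^sup>+t. G0 t * ennreal ((cmod (f t))\<^sup>2) \<partial>lebesgue)" if "f \<in> L2" for f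
    unfolding G0_def by (rule painless_frame_operator[OF b g C that])
  show "AE t in lebesgue. ennreal A \<le> G0 t"
  proof (rule AE_le_if_integrals_le[where c = "ennreal A"])
    fix E n assume E: "E \<in> sets lebesgue" "E \<subseteq> {- real n..real n}"
    show "(\<integral>\<^sup>+t. ennreal A * indicator E t \<partial>lebesgue) \<le> (\<integral>\<^sup>+t. G0 t * indicator E t \<partial>lebesgue)"
      using fr(1)[OF ind(1)[OF E]]
      by (simp only: op[OF ind(1)[OF E]] ind(2,3)[OF E] nn_integral_cmult_indicator[OF E(1)])
  qed auto
  show "AE t in lebesgue. G0 t \<le> ennreal B"
  proof (rule AE_le_if_integrals_le[where c = "ennreal B"])
    fix E n assume E: "E \<in> sets lebesgue" "E \<subseteq> {- real n..real n}"
    show "(\<integral>\<^sup>+t. G0 t * indicator E t \<partial>lebesgue) \<le> (\<integral>\<^sup>+t. ennreal B * indicator E t \<partial>lebesgue)"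
      using fr(2)[OF ind(1)[OF E]]
      by (simp only: op[OF ind(1)[OF E]] ind(2,3)[OF E] nn_integral_cmult_indicator[OF E(1)])
  qed auto
qed

subsection \<open>Error of the approximate dual\<close>

text \<open>Turns unordered sums over the integers into limits of sequences, the form in which
  dominated convergence applies.\<close>

lemma filterlim_symmetric_int_intervals:
  "filterlim (\<lambda>n::nat. {- int n..int n}) (finite_subsets_at_top UNIV) sequentially"
  unfolding filterlim_finite_subsets_at_top
proof (intro allI impI)
  fix X :: "int set" assume "finite X \<and> X \<subseteq> UNIV"
  then have "finite (abs ` X)" by simp
  then obtain m where m: "\<And>x. x \<in> X \<Longrightarrow> \<bar>x\<bar> \<le> m" by (metis finite_abs_int_segment finite_imageI bdd_above_finite bdd_above.unfold imageI)
  show "\<forall>\<^sub>F n in sequentially. finite {- int n..int n} \<and> X \<subseteq> {- int n..int n} \<and> {- int n..int n} \<subseteq> UNIV"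
    using eventually_ge_at_top[of "nat m"]
  proof eventually_elim
    case (elim n)
    have "x \<in> {- int n..int n}" if "x \<in> X" for x using m[OF that] elim by auto
    then show ?case by auto
  qed
qed

lemma bessel_form_exists:
  assumes A: "bessel_bound \<phi> A" and B: "bessel_bound \<psi> B" and f: "f \<in> L2" and h: "h \<in> L2"
  obtains s where "((\<lambda>i. L2_inner f (\<phi> i) * L2_inner (\<psi> i) h) has_sum s) UNIV"
proof -
  have \<psi>: "\<psi> i \<in> L2" for i using B by (simp add: bessel_bound_def)
  obtain S where S: "L2_has_sum (\<lambda>i t. L2_inner f (\<phi> i) * \<psi> i t) S"
    using bessel_synthesis_summable[OF B bessel_coeffs_summable[OF A f]] by (auto simp: L2_summable_def)
  show ?thesis
    using L2_has_sum_inner[OF _ S h] by (intro that) (simp add: L2_cmult \<psi> L2_inner_cmult_left)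
qed

section \<open>Reduction to compact support\<close>

definition truncate :: "nat \<Rightarrow> (real \<Rightarrow> complex) \<Rightarrow> real \<Rightarrow> complex" where
  "truncate N f t = f t * indicator {- real N..real N} t"

lemma truncate_L2: "f \<in> L2 \<Longrightarrow> truncate N f \<in> L2"
  unfolding truncate_def[abs_def] by (rule L2_indicator) auto

lemma truncate_L2n: "f \<in> L2 \<Longrightarrow> L2n (truncate N f) \<le> L2n f"
  unfolding truncate_def[abs_def] by (rule L2_indicator) auto

lemma truncate_tendsto: "(\<lambda>N. truncate N f t) \<longlonglongrightarrow> f t"
proof (rule tendsto_eventually)
  obtain n where n: "\<bar>t\<bar> \<le> real n" using real_arch_simple by blast
  show "\<forall>\<^sub>F N in sequentially. truncate N f t = f t"
    using eventually_ge_at_top[of n]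
    by eventually_elim (use n in \<open>auto simp: truncate_def indicator_def\<close>)
qed

lemma norm_truncate_le: "cmod (truncate N f t) \<le> cmod (f t)"
  by (auto simp: truncate_def indicator_def)

lemma truncate_L2n_tendsto:
  assumes f: "f \<in> L2"
  shows "(\<lambda>N. L2n (\<lambda>t. f t - truncate N f t)) \<longlonglongrightarrow> 0"
proof -
  have [measurable]: "f \<in> borel_measurable lebesgue" "\<And>N. truncate N f \<in> borel_measurable lebesgue"
    using f by (auto intro: L2_measurable truncate_L2)
  have "(\<lambda>N. LINT t|lebesgue. (cmod (f t - truncate N f t))\<^sup>2) \<longlonglongrightarrow> (LINT t|(lebesgue::real measure). 0)"
  proof (rule integral_dominated_convergence[where w = "\<lambda>t. (cmod (f t))\<^sup>2"])
    show "AE t in lebesgue. (\<lambda>N. (cmod (f t - truncate N f t))\<^sup>2) \<longlonglongrightarrow> 0"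
    proof (rule AE_I2)
      fix t
      have "(\<lambda>N. (cmod (f t - truncate N f t))\<^sup>2) \<longlonglongrightarrow> (cmod (f t - f t))\<^sup>2"
        by (intro tendsto_intros truncate_tendsto)
      then show "(\<lambda>N. (cmod (f t - truncate N f t))\<^sup>2) \<longlonglongrightarrow> 0" by simp
    qed
    show "AE t in lebesgue. norm ((cmod (f t - truncate N f t))\<^sup>2) \<le> (cmod (f t))\<^sup>2" for N
      by (rule AE_I2) (auto simp: truncate_def indicator_def)
    show "integrable lebesgue (\<lambda>t. (cmod (f t))\<^sup>2)" using f by (simp add: L2_iff)
  qed measurable
  then have "(\<lambda>N. sqrt (LINT t|lebesgue. (cmod (f t - truncate N f t))\<^sup>2)) \<longlonglongrightarrow> sqrt 0"
    by (intro tendsto_real_sqrt) simp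
  then show ?thesis by (simp add: L2n_def)
qed

text \<open>The arguments are changed one at a time: the difference is the form at
  \<open>f - truncate N f\<close> and \<open>h\<close> plus the form at \<open>truncate N f\<close>
  and \<open>h - truncate N h\<close>. Both are small by boundedness of the form.\<close>

lemma bessel_form_continuous:
  assumes A: "bessel_bound \<phi> A" and B: "bessel_bound \<psi> B" and f: "f \<in> L2" and h: "h \<in> L2"
    and s: "((\<lambda>i. L2_inner f (\<phi> i) * L2_inner (\<psi> i) h) has_sum s) UNIV"
    and sN: "\<And>N. ((\<lambda>i. L2_inner (truncate N f) (\<phi> i) * L2_inner (\<psi> i) (truncate N h)) has_sum sN N) UNIV"
  shows "sN \<longlonglongrightarrow> s"
proof -
  have \<phi>: "\<phi> i \<in> L2" for i using A by (simp add: bessel_bound_def)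
  have \<psi>: "\<psi> i \<in> L2" for i using B by (simp add: bessel_bound_def)
  note fN = truncate_L2[OF f] and hN = truncate_L2[OF h]
  define e where "e = (\<lambda>N. sqrt (A * B) * L2n (\<lambda>t. f t - truncate N f t) * L2n h
      + sqrt (A * B) * L2n f * L2n (\<lambda>t. h t - truncate N h t))"
  have "e \<longlonglongrightarrow> sqrt (A * B) * 0 * L2n h + sqrt (A * B) * L2n f * 0"
    unfolding e_def by (intro tendsto_intros truncate_L2n_tendsto f h)
  then have e: "e \<longlonglongrightarrow> 0" by simp
  have "(\<lambda>N. s - sN N) \<longlonglongrightarrow> 0"
  proof (rule Lim_null_comparison[OF always_eventually e], rule allI)
    fix N
    obtain s1 where s1: "((\<lambda>i. L2_inner (\<lambda>t. f t - truncate N f t) (\<phi> i) * L2_inner (\<psi> i) h) has_sum s1) UNIV"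
      by (rule bessel_form_exists[OF A B L2_diff[OF f fN] h]) (rule that)
    obtain s2 where s2: "((\<lambda>i. L2_inner (truncate N f) (\<phi> i) * L2_inner (\<psi> i) (\<lambda>t. h t - truncate N h t)) has_sum s2) UNIV"
      by (rule bessel_form_exists[OF A B fN L2_diff[OF h hN]]) (rule that)
    have "((\<lambda>i. L2_inner (\<lambda>t. f t - truncate N f t) (\<phi> i) * L2_inner (\<psi> i) h
        + L2_inner (truncate N f) (\<phi> i) * L2_inner (\<psi> i) (\<lambda>t. h t - truncate N h t)
        + L2_inner (truncate N f) (\<phi> i) * L2_inner (\<psi> i) (truncate N h)) has_sum s1 + s2 + sN N) UNIV"
      by (intro has_sum_add s1 s2 sN)
    then have "((\<lambda>i. L2_inner f (\<phi> i) * L2_inner (\<psi> i) h) has_sum s1 + s2 + sN N) UNIV"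
      by (simp add: L2_inner_diff_left L2_inner_diff_right f fN h hN \<phi> \<psi> algebra_simps)
    with s have "s = s1 + s2 + sN N" by (rule has_sum_unique)
    then have "norm (s - sN N) \<le> cmod s1 + cmod s2" by (simp add: norm_triangle_ineq)
    also have "cmod s1 \<le> sqrt (A * B) * L2n (\<lambda>t. f t - truncate N f t) * L2n h"
      by (rule bessel_form_bound[OF A B L2_diff[OF f fN] h s1])
    also have "cmod s2 \<le> sqrt (A * B) * L2n (truncate N f) * L2n (\<lambda>t. h t - truncate N h t)"
      by (rule bessel_form_bound[OF A B fN L2_diff[OF h hN] s2])
    also have "\<dots> \<le> sqrt (A * B) * L2n f * L2n (\<lambda>t. h t - truncate N h t)"
      using A B by (intro mult_right_mono mult_left_mono truncate_L2n f) (auto simp: bessel_bound_def)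
    finally show "norm (s - sN N) \<le> e N" by (simp add: e_def)
  qed
  then have "(\<lambda>N. s - (s - sN N)) \<longlonglongrightarrow> s - 0" by (intro tendsto_intros)
  then show ?thesis by simp
qed

text \<open>The cases \<open>\<gamma> = go\<close> and \<open>\<gamma> = g\<close> give parts (i) and (ii); the weight \<open>1/G\<^sub>0\<close> is introduced only afterwards.\<close>

locale painless_pair =
  fixes a b :: "int \<Rightarrow> real" and g \<gamma> :: "int \<Rightarrow> real \<Rightarrow> complex" and A B B1 B2 :: real and C :: "int \<Rightarrow> real"
    and go gr \<gamma>r :: "int \<Rightarrow> real \<Rightarrow> complex" and G0 :: "real \<Rightarrow> ennreal"
  assumes b: "\<And>k. 0 < b k" and g[measurable]: "\<And>k. g k \<in> borel_measurable lebesgue"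
    and \<gamma>[measurable]: "\<And>k. \<gamma> k \<in> borel_measurable lebesgue"
    and C: "\<And>k. 0 \<le> C k" "\<And>k. AE t in lebesgue. cmod (g k t) \<le> C k" "\<And>k. AE t in lebesgue. cmod (\<gamma> k t) \<le> C k"
    and go: "go = nsg_core a b g" and core: "nsg_core a b \<gamma> = go"
    and gr: "gr = (\<lambda>k t. g k t - g k t * indicator (nsg_interval a b k) t)"
    and \<gamma>r: "\<gamma>r = (\<lambda>k t. \<gamma> k t - \<gamma> k t * indicator (nsg_interval a b k) t)"
    and G0: "G0 = nsg_G b go go 0"
    and bessel_g: "bessel_bound (nsg_atoms b g) B1" and bessel_\<gamma>: "bessel_bound (nsg_atoms b \<gamma>) B2"
    and A: "0 < A" and G0m[measurable]: "G0 \<in> borel_measurable lebesgue"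
    and lower: "AE t in lebesgue. ennreal A \<le> G0 t" and upper: "AE t in lebesgue. G0 t \<le> ennreal B"
begin

text \<open>Otherwise \<open>G0\<close> would almost everywhere be both 0 and at least
  \<open>A > 0\<close>, although the real line is not a null set.\<close>

lemma B: "0 < B"
proof (rule ccontr)
  assume "\<not> 0 < B"
  then have z: "ennreal B = 0" by (simp add: ennreal_neg)
  have "AE t in lebesgue. G0 t \<noteq> G0 t"
    using upper lower by eventually_elim (use A z in \<open>auto simp: ennreal_eq_0_iff\<close>)
  then have "ae_filter (lebesgue :: real measure) = bot" by (simp add: trivial_limit_def)
  then show False by (simp add: ae_filter_eq_bot_iff)
qed

definition "G t = enn2real (G0 t)"

lemma G_meas[measurable]: "G \<in> borel_measurable lebesgue"
  unfolding G_def[abs_def] by measurable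

lemma G_bounds: "AE t in lebesgue. A \<le> G t \<and> G t \<le> B \<and> G0 t = ennreal (G t)"
  using lower upper
proof eventually_elim
  case (elim t)
  have fin: "G0 t < \<infinity>" using elim(2) by (simp add: le_less_trans)
  then have eq: "G0 t = ennreal (G t)" by (simp add: G_def)
  have "0 \<le> G t" by (simp add: G_def)
  with elim eq A B show ?case by (auto simp: ennreal_le_iff)
qed

text \<open>All products other than the unshifted core-core one. The mixed pairs omit shift 0, since
  core and tail of one index live on complementary sets; two tails can overlap without a
  shift.\<close>

definition "cross f h = shift_total b go \<gamma>r f h (UNIV - {0}) + shift_total b gr go f h (UNIV - {0}) + shift_total b gr \<gamma>r f h UNIV"

lemma go_meas[measurable]: "go k \<in> borel_measurable lebesgue"
  unfolding go nsg_core_def[abs_def] nsg_interval_def by (rule borel_measurable_mult_indicator[OF g]) simp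

definition "D f h k = of_real (inverse (b k)) * (LINT t|lebesgue. f t * cnj (h t) * of_real ((cmod (go k t))\<^sup>2))"

lemma window_bound:
  assumes f: "f \<in> L2" and h: "h \<in> L2" and supp: "\<And>t. N < \<bar>t\<bar> \<Longrightarrow> f t = 0 \<and> h t = 0"
  shows "\<exists>Q. ((\<lambda>l. L2_inner f (nsg_atoms b g (k, l)) * L2_inner (nsg_atoms b \<gamma> (k, l)) h) has_sum Q) UNIV \<and>
    ennreal (cmod (Q - D f h k)) \<le> ennreal (inverse (b k)) *
      ((\<integral>\<^sup>+l. shift_term (b k) (go k) (\<gamma>r k) f h l \<partial>count_space (UNIV - {0}))
     + (\<integral>\<^sup>+l. shift_term (b k) (gr k) (go k) f h l \<partial>count_space (UNIV - {0}))
     + (\<integral>\<^sup>+l. shift_term (b k) (gr k) (\<gamma>r k) f h l \<partial>count_space UNIV))"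
proof -
  define \<alpha> where "\<alpha> = a k - inverse (2 * b k)"
  define T where "T = inverse (b k)"
  have T: "0 < T" using b by (simp add: T_def)
  \<comment> \<open>Points of the tile have modulus at most \<open>\<bar>\<alpha>\<bar> + T\<close>,
    so a translation by more than \<open>n\<close> periods carries them beyond
    \<open>N\<close>.\<close>
  obtain n :: nat where n: "(N + \<bar>\<alpha>\<bar> + T) / T < real n" using reals_Archimedean2 by blast
  interpret w: single_window "b k" \<alpha> f h "g k" "\<gamma> k" n "C k"
  proof
    fix t and j :: int assume t: "t \<in> {\<alpha>..\<alpha> + inverse (b k)}" and j: "int n < \<bar>j\<bar>"
    have "N + \<bar>\<alpha>\<bar> + T < real n * T" using n T by (simp add: field_simps)
    also have "\<dots> \<le> \<bar>of_int j\<bar> * T" using j T by (intro mult_right_mono) linarith+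
    also have "\<dots> = \<bar>of_int j * T\<bar>" using T by (simp add: abs_mult)
    finally have "N < \<bar>t + of_int j * T\<bar>" using t T by (auto simp: T_def)
    then show "f (t + of_int j * inverse (b k)) = 0 \<and> h (t + of_int j * inverse (b k)) = 0"
      using supp by (simp add: T_def)
  qed (use b f h g \<gamma> C in auto)
  have I: "w.I = nsg_interval a b k"
  proof -
    have "nsg_interval a b k = {\<alpha>..\<alpha> + inverse (b k)}"
      using b[of k] by (simp add: nsg_interval_eq \<alpha>_def)
    then show ?thesis by (simp only: w.I_def w.T_def)
  qed
  \<comment> \<open>The two windows share their core, which turns the diagonal product into the
    squared modulus of \<open>go k\<close>, with no phase left.\<close>
  have \<gamma>g: "\<gamma> k t * indicator (nsg_interval a b k) t = g k t * indicator (nsg_interval a b k) t" for t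
    using fun_cong[OF fun_cong[OF core], of k t] by (simp add: go nsg_core_def)
  have po: "w.po = go k" and qo: "w.qo = go k" and pr: "w.pr = gr k" and qr: "w.qr = \<gamma>r k"
    by (simp_all add: fun_eq_iff w.po_def w.qo_def w.pr_def w.qr_def I go nsg_core_def gr \<gamma>r \<gamma>g)
  have "w.u t * cnj (w.v t) * indicator w.I t = f t * cnj (h t) * of_real ((cmod (go k t))\<^sup>2)" for t
  proof -
    have "w.u t * cnj (w.v t) * indicator w.I t = f t * cnj (h t) * (w.qo t * cnj (w.po t))"
      by (simp add: w.u_def w.v_def w.po_def w.qo_def indicator_def)
    then show ?thesis unfolding po qo complex_norm_square .
  qed
  then have D: "w.D = D f h k" by (simp add: w.D_def D_def w.T_def)
  show ?thesis
    using w.has_sum_Q w.Q_minus_D unfolding D po qo pr qr w.T_def nsg_atoms_def prod.case by blast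
qed

text \<open>The diagonal terms are integrals against the partial sums \<open>S n\<close> of
  \<open>G0\<close>. Almost everywhere these stay below \<open>G\<close> and hence below
  \<open>B\<close>, which provides the dominating function.\<close>

lemma partial_D_tendsto:
  assumes f: "f \<in> L2" and h: "h \<in> L2"
  shows "(\<lambda>n. \<Sum>k\<in>{- int n..int n}. D f h k) \<longlonglongrightarrow> (LINT t|lebesgue. f t * cnj (h t) * of_real (G t))"
proof -
  define S where "S = (\<lambda>n t. \<Sum>k\<in>{- int n..int n}. inverse (b k) * (cmod (go k t))\<^sup>2)"
  have Sm[measurable]: "S n \<in> borel_measurable lebesgue" for n unfolding S_def by measurable
  have S0: "0 \<le> S n t" for n t using b by (auto simp: S_def less_imp_le intro!: sum_nonneg)
  note fhm[measurable] = borel_measurable_integrable[OF L2_integrable[OF f h]]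
  have SG: "AE t in lebesgue. (\<lambda>n. S n t) \<longlonglongrightarrow> G t \<and> (\<forall>n. S n t \<le> B)"
    using G_bounds
  proof eventually_elim
    case (elim t)
    have G0eq: "(\<Sum>\<^sub>\<infinity>k. ennreal (inverse (b k) * (cmod (go k t))\<^sup>2)) = ennreal (G t)"
      using elim by (simp add: G0 nsg_G_def power2_eq_square mult.assoc)
    have Sn: "ennreal (S n t) = (\<Sum>k\<in>{- int n..int n}. ennreal (inverse (b k) * (cmod (go k t))\<^sup>2))" for n
      unfolding S_def using b by (subst sum_ennreal) (auto simp: less_imp_le)
    have "((\<lambda>k. ennreal (inverse (b k) * (cmod (go k t))\<^sup>2)) has_sum ennreal (G t)) UNIV"
      unfolding G0eq[symmetric] by (intro has_sum_infsum nonneg_summable_on_complete) simp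
    then have "(\<lambda>n. ennreal (S n t)) \<longlonglongrightarrow> ennreal (G t)"
      unfolding Sn has_sum_def by (rule filterlim_compose[OF _ filterlim_symmetric_int_intervals])
    then have 1: "(\<lambda>n. S n t) \<longlonglongrightarrow> G t"
      using elim A S0 by (subst (asm) tendsto_ennreal_iff) auto
    have "S n t \<le> B" for n
    proof -
      have "ennreal (S n t) \<le> ennreal (G t)"
        unfolding Sn G0eq[symmetric] by (rule ennreal_sum_le_infsum) auto
      also have "\<dots> \<le> ennreal B" using elim by (intro ennreal_leI) simp
      finally show ?thesis using B by (simp add: ennreal_le_iff)
    qed
    with 1 show ?case by blast
  qed
  have "(\<lambda>n. LINT t|lebesgue. f t * cnj (h t) * of_real (S n t)) \<longlonglongrightarrow> (LINT t|lebesgue. f t * cnj (h t) * of_real (G t))"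
  proof (rule integral_dominated_convergence[where w = "\<lambda>t. cmod (f t * cnj (h t)) * B"])
    show "integrable lebesgue (\<lambda>t. cmod (f t * cnj (h t)) * B)"
      by (intro integrable_mult_left integrable_norm L2_integrable f h)
    show "AE t in lebesgue. (\<lambda>n. f t * cnj (h t) * of_real (S n t)) \<longlonglongrightarrow> f t * cnj (h t) * of_real (G t)"
      using SG by eventually_elim (auto intro!: tendsto_intros)
    fix n
    show "AE t in lebesgue. norm (f t * cnj (h t) * of_real (S n t)) \<le> cmod (f t * cnj (h t)) * B"
      using SG
    proof eventually_elim
      case (elim t)
      have "\<bar>S n t\<bar> \<le> B" using elim S0[of n t] by auto
      then show ?case unfolding norm_mult norm_of_real by (intro mult_left_mono) auto
    qed
  qed measurable
  moreover have "(LINT t|lebesgue. f t * cnj (h t) * of_real (S n t)) = (\<Sum>k\<in>{- int n..int n}. D f h k)" for n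
  proof -
    have "integrable lebesgue (\<lambda>t. f t * cnj (h t) * of_real ((cmod (go k t))\<^sup>2))" for k
    proof (rule Bochner_Integration.integrable_bound)
      show "integrable lebesgue (\<lambda>t. f t * cnj (h t) * of_real ((C k)\<^sup>2))"
        by (intro integrable_mult_left L2_integrable f h)
      show "AE t in lebesgue. norm (f t * cnj (h t) * of_real ((cmod (go k t))\<^sup>2)) \<le> norm (f t * cnj (h t) * of_real ((C k)\<^sup>2))"
        using C(2)[of k]
      proof eventually_elim
        case (elim t)
        have "(cmod (go k t))\<^sup>2 \<le> (C k)\<^sup>2"
          using elim C(1)[of k] by (intro power_mono) (auto simp: go nsg_core_def indicator_def)
        then show ?case unfolding norm_mult norm_of_real by (intro mult_left_mono) auto
      qed
    qed measurable
    then have "(\<Sum>k\<in>{- int n..int n}. D f h k) = (LINT t|lebesgue. (\<Sum>k\<in>{- int n..int n}. of_real (inverse (b k)) * (f t * cnj (h t) * of_real ((cmod (go k t))\<^sup>2))))"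
      unfolding D_def by (subst Bochner_Integration.integral_sum) auto
    also have "\<dots> = (LINT t|lebesgue. f t * cnj (h t) * of_real (S n t))"
      by (rule Bochner_Integration.integral_cong) (auto simp: S_def sum_distrib_left mult_ac)
    finally show ?thesis by simp
  qed
  ultimately show ?thesis by simp
qed

lemma compact_bound:
  assumes f: "f \<in> L2" and h: "h \<in> L2" and supp: "\<And>t. N < \<bar>t\<bar> \<Longrightarrow> f t = 0 \<and> h t = 0"
    and s: "((\<lambda>i. L2_inner f (nsg_atoms b g i) * L2_inner (nsg_atoms b \<gamma> i) h) has_sum s) UNIV"
    and c: "cross f h \<le> ennreal c" "0 \<le> c"
  shows "cmod (s - (LINT t|lebesgue. f t * cnj (h t) * of_real (G t))) \<le> c"
proof -
  define R where "R = (\<lambda>k. ennreal (inverse (b k)) *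
      ((\<integral>\<^sup>+l. shift_term (b k) (go k) (\<gamma>r k) f h l \<partial>count_space (UNIV - {0}))
     + (\<integral>\<^sup>+l. shift_term (b k) (gr k) (go k) f h l \<partial>count_space (UNIV - {0}))
     + (\<integral>\<^sup>+l. shift_term (b k) (gr k) (\<gamma>r k) f h l \<partial>count_space UNIV)))"
  have "\<forall>k. \<exists>Q. ((\<lambda>l. L2_inner f (nsg_atoms b g (k, l)) * L2_inner (nsg_atoms b \<gamma> (k, l)) h) has_sum Q) UNIV \<and>
    ennreal (cmod (Q - D f h k)) \<le> R k"
    unfolding R_def by (intro allI window_bound f h) (rule supp)
  from choice[OF this] obtain Q where Q: "\<And>k. ((\<lambda>l. L2_inner f (nsg_atoms b g (k, l)) * L2_inner (nsg_atoms b \<gamma> (k, l)) h) has_sum Q k) UNIV"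
    "\<And>k. ennreal (cmod (Q k - D f h k)) \<le> R k"
    by blast
  \<comment> \<open>The sum over pairs is unconditional, so it may be carried out over
    \<open>l\<close> within each window before \<open>k\<close>.\<close>
  have "(Q has_sum s) UNIV"
    by (rule has_sum_SigmaD[where B = "\<lambda>_. UNIV", OF _ Q(1)]) (use s in simp)
  then have "(\<lambda>n. \<Sum>k\<in>{- int n..int n}. Q k) \<longlonglongrightarrow> s"
    unfolding has_sum_def by (rule filterlim_compose[OF _ filterlim_symmetric_int_intervals])
  then have lim: "(\<lambda>n. cmod ((\<Sum>k\<in>{- int n..int n}. Q k) - (\<Sum>k\<in>{- int n..int n}. D f h k)))
    \<longlonglongrightarrow> cmod (s - (LINT t|lebesgue. f t * cnj (h t) * of_real (G t)))"
    by (intro tendsto_intros partial_D_tendsto f h)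
  have R: "(\<integral>\<^sup>+k. R k \<partial>count_space UNIV) = cross f h"
    unfolding R_def cross_def shift_total_def distrib_left
    by (simp add: nn_integral_add)
  have "cmod ((\<Sum>k\<in>{- int n..int n}. Q k) - (\<Sum>k\<in>{- int n..int n}. D f h k)) \<le> c" for n
  proof -
    have "ennreal (cmod ((\<Sum>k\<in>{- int n..int n}. Q k) - (\<Sum>k\<in>{- int n..int n}. D f h k)))
      \<le> ennreal (\<Sum>k\<in>{- int n..int n}. cmod (Q k - D f h k))"
      unfolding sum_subtractf[symmetric] by (intro ennreal_leI norm_sum)
    also have "\<dots> = (\<Sum>k\<in>{- int n..int n}. ennreal (cmod (Q k - D f h k)))" by (simp add: sum_ennreal)
    also have "\<dots> \<le> (\<Sum>k\<in>{- int n..int n}. R k)" by (intro sum_mono Q)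
    also have "\<dots> \<le> (\<integral>\<^sup>+k. R k \<partial>count_space UNIV)" by (rule sum_le_nn_integral_count_space) auto
    also have "\<dots> \<le> ennreal c" using c R by simp
    finally show ?thesis using c by (simp add: ennreal_le_iff)
  qed
  then show ?thesis by (intro LIMSEQ_le_const2[OF lim]) auto
qed

text \<open>The constant \<open>c\<close> is uniform in both arguments and truncation does not
  increase norms, so the compactly supported estimate survives the limit. The form converges by
  Bessel continuity, the integral by domination with \<open>B\<close>.\<close>

lemma form_bound:
  assumes f: "f \<in> L2" and h: "h \<in> L2"
    and s: "((\<lambda>i. L2_inner f (nsg_atoms b g i) * L2_inner (nsg_atoms b \<gamma> i) h) has_sum s) UNIV"
    and c: "\<And>f h. f \<in> L2 \<Longrightarrow> h \<in> L2 \<Longrightarrow> cross f h \<le> ennreal (c * L2n f * L2n h)" "0 \<le> c"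
  shows "cmod (s - (LINT t|lebesgue. f t * cnj (h t) * of_real (G t))) \<le> c * L2n f * L2n h"
proof -
  note fN = truncate_L2[OF f] and hN = truncate_L2[OF h]
  have "\<exists>s. ((\<lambda>i. L2_inner (truncate N f) (nsg_atoms b g i) * L2_inner (nsg_atoms b \<gamma> i) (truncate N h)) has_sum s) UNIV" for N
    using bessel_form_exists[OF bessel_g bessel_\<gamma> fN hN] by metis
  then obtain sN where sN: "\<And>N. ((\<lambda>i. L2_inner (truncate N f) (nsg_atoms b g i) * L2_inner (nsg_atoms b \<gamma> i) (truncate N h)) has_sum sN N) UNIV"
    by metis
  have lims: "sN \<longlonglongrightarrow> s" by (rule bessel_form_continuous[OF bessel_g bessel_\<gamma> f h s sN])
  note fhm[measurable] = borel_measurable_integrable[OF L2_integrable[OF f h]] borel_measurable_integrable[OF L2_integrable[OF fN hN]]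
  have limG: "(\<lambda>N. LINT t|lebesgue. truncate N f t * cnj (truncate N h t) * of_real (G t)) \<longlonglongrightarrow> (LINT t|lebesgue. f t * cnj (h t) * of_real (G t))"
  proof (rule integral_dominated_convergence[where w = "\<lambda>t. cmod (f t * cnj (h t)) * B"])
    show "integrable lebesgue (\<lambda>t. cmod (f t * cnj (h t)) * B)"
      by (intro integrable_mult_left integrable_norm L2_integrable f h)
    show "AE t in lebesgue. (\<lambda>N. truncate N f t * cnj (truncate N h t) * of_real (G t)) \<longlonglongrightarrow> f t * cnj (h t) * of_real (G t)"
      by (intro AE_I2 tendsto_intros truncate_tendsto)
    fix N
    show "AE t in lebesgue. norm (truncate N f t * cnj (truncate N h t) * of_real (G t)) \<le> cmod (f t * cnj (h t)) * B"
      using G_bounds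
    proof eventually_elim
      case (elim t)
      have "\<bar>G t\<bar> \<le> B" using elim A by auto
      then show ?case
        unfolding norm_mult norm_of_real complex_mod_cnj
        by (intro mult_mono norm_truncate_le) auto
    qed
  qed measurable
  have "(\<lambda>N. cmod (sN N - (LINT t|lebesgue. truncate N f t * cnj (truncate N h t) * of_real (G t))))
    \<longlonglongrightarrow> cmod (s - (LINT t|lebesgue. f t * cnj (h t) * of_real (G t)))"
    by (intro tendsto_intros lims limG)
  moreover have "cmod (sN N - (LINT t|lebesgue. truncate N f t * cnj (truncate N h t) * of_real (G t))) \<le> c * L2n f * L2n h" for N
  proof -
    have "cmod (sN N - (LINT t|lebesgue. truncate N f t * cnj (truncate N h t) * of_real (G t))) \<le> c * L2n (truncate N f) * L2n (truncate N h)"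
      by (rule compact_bound[OF fN hN _ sN c(1)[OF fN hN], where N = "real N"])
        (use c in \<open>auto simp: truncate_def indicator_def\<close>)
    also have "\<dots> \<le> c * L2n f * L2n h"
      using c by (intro mult_mono truncate_L2n f h order_refl mult_nonneg_nonneg) auto
    finally show ?thesis .
  qed
  ultimately show ?thesis by (intro LIMSEQ_le_const2) auto
qed

end

section \<open>Square roots and means of extended nonnegative reals\<close>

lemma ennreal_power2_le_imp_le:
  fixes x y :: ennreal
  assumes "x\<^sup>2 \<le> y\<^sup>2"
  shows "x \<le> y"
proof (cases x)
  case x: (real r)
  show ?thesis
  proof (cases y)
    case (real s)
    with assms x show ?thesis by (auto simp: ennreal_power intro: power2_le_imp_le)
  qed simp
next
  case top
  with assms show ?thesis by (cases y) (auto simp: ennreal_power top_unique)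
qed

lemma le_ennsqrt_mult:
  assumes "x\<^sup>2 \<le> (r * ennreal (u\<^sup>2)) * (s * ennreal (v\<^sup>2))" "0 \<le> u" "0 \<le> v"
  shows "x \<le> ennsqrt (r * s) * ennreal (u * v)"
proof (rule ennreal_power2_le_imp_le)
  have "(ennsqrt (r * s) * ennreal (u * v))\<^sup>2 = r * s * ennreal ((u * v)\<^sup>2)"
    using assms(2,3) by (simp add: power_mult_distrib ennsqrt_power2 ennreal_power)
  also have "\<dots> = (r * ennreal (u\<^sup>2)) * (s * ennreal (v\<^sup>2))"
    by (simp add: power_mult_distrib ennreal_mult mult_ac)
  finally show "x\<^sup>2 \<le> (ennsqrt (r * s) * ennreal (u * v))\<^sup>2" using assms(1) by simp
qed

lemma ennsqrt_mult_self: "ennsqrt (r * r) = r"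
proof (rule antisym)
  show "ennsqrt (r * r) \<le> r" "r \<le> ennsqrt (r * r)"
    by (rule ennreal_power2_le_imp_le, simp add: ennsqrt_power2, simp add: power2_eq_square)+
qed

text \<open>The inequality of arithmetic and geometric means, used to turn the two mixed terms of
  the second estimate into the sum of the two constants. An infinite argument makes the right side
  infinite.\<close>

lemma ennsqrt_AM_GM: "ennsqrt (r * s) + ennsqrt (r * s) \<le> r + s"
proof (rule ennreal_power2_le_imp_le)
  have "(ennsqrt (r * s) + ennsqrt (r * s))\<^sup>2 = 4 * (ennsqrt (r * s))\<^sup>2"
    by (simp add: mult_2[symmetric] power_mult_distrib)
  also have "\<dots> = 4 * (r * s)" by (simp add: ennsqrt_power2)
  also have "\<dots> \<le> (r + s)\<^sup>2"
  proof (cases "r = top \<or> s = top")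
    case True
    then show ?thesis by (auto simp: power2_eq_square ennreal_top_mult ennreal_mult_top)
  next
    case False
    then obtain x y where "r = ennreal x" "0 \<le> x" "s = ennreal y" "0 \<le> y"
      by (metis ennreal_cases)
    moreover have "4 * (x * y) \<le> (x + y)\<^sup>2" for x y :: real
      using zero_le_power2[of "x - y"] by (simp add: power2_eq_square algebra_simps)
    ultimately show ?thesis
      by (simp add: ennreal_plus[symmetric] ennreal_power ennreal_mult[symmetric] ennreal_numeral[symmetric] ennreal_leI
        del: ennreal_plus ennreal_numeral)
  qed
  finally show "(ennsqrt (r * s) + ennsqrt (r * s))\<^sup>2 \<le> (r + s)\<^sup>2" .
qed

lemma shift_total_le:
  assumes p: "window_pair b p q" and f: "f \<in> L2" and h: "h \<in> L2" and L: "uminus ` L = L"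
  shows "shift_total b p q f h L \<le> ennsqrt (esssup lebesgue (\<lambda>t. \<Sum>\<^sub>\<infinity>l\<in>L. nsg_G b q p l t) * esssup lebesgue (\<lambda>t. \<Sum>\<^sub>\<infinity>l\<in>L. nsg_G b p q l t))
    * ennreal (L2n f * L2n h)"
  using Schur_test[OF p L2_measurable[OF f] L2_measurable[OF h] L]
  unfolding nn_integral_L2n[OF f] nn_integral_L2n[OF h]
  by (intro le_ennsqrt_mult) auto

lemma nsg_atoms_mult: "nsg_atoms b (\<lambda>k t. w t * \<gamma> k t) i = (\<lambda>t. w t * nsg_atoms b \<gamma> i t)"
  by (auto simp: nsg_atoms_def modulation_expo fun_eq_iff split: prod.split)

section \<open>Weighted dual windows and their error\<close>

context painless_pair
begin

definition "w t = complex_of_real (inverse (enn2real (G0 t)))"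

lemma w_meas[measurable]: "w \<in> borel_measurable lebesgue"
  unfolding w_def[abs_def] by measurable

lemma w_bound: "AE t in lebesgue. cmod (w t) \<le> inverse A"
  using G_bounds by eventually_elim (use A in \<open>auto simp: w_def G_def norm_inverse intro!: le_imp_inverse_le\<close>)

lemma w_L2:
  assumes "h \<in> L2"
  shows "(\<lambda>t. w t * h t) \<in> L2" "L2n (\<lambda>t. w t * h t) \<le> inverse A * L2n h"
  using L2_mult_bounded[OF assms w_meas w_bound] A by auto

lemma inner_w: "L2_inner (nsg_atoms b (\<lambda>k t. w t * \<gamma> k t) i) h = L2_inner (nsg_atoms b \<gamma> i) (\<lambda>t. w t * h t)"
  unfolding L2_inner_def nsg_atoms_mult
  by (rule Bochner_Integration.integral_cong) (auto simp: w_def)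

text \<open>A bounded multiplier moved onto \<open>f\<close> changes its norm by at most the factor
  \<open>1/A\<close>. The weighted system is therefore Bessel, and the series defining the operator
  converge unconditionally.\<close>

lemma bessel_w: "bessel_bound (nsg_atoms b (\<lambda>k t. w t * \<gamma> k t)) (B2 * (inverse A)\<^sup>2)"
  unfolding bessel_bound_def
proof (intro conjI allI ballI impI)
  show "nsg_atoms b (\<lambda>k t. w t * \<gamma> k t) i \<in> L2" for i
    unfolding nsg_atoms_mult by (intro w_L2 bessel_bound_L2[OF bessel_\<gamma>])
  have B2: "0 \<le> B2" using bessel_\<gamma> by (simp add: bessel_bound_def)
  then show "0 \<le> B2 * (inverse A)\<^sup>2" by simp
  fix f :: "real \<Rightarrow> complex" and F :: "(int \<times> int) set" assume f: "f \<in> L2" and F: "finite F"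
  have "(\<Sum>i\<in>F. (cmod (L2_inner f (nsg_atoms b (\<lambda>k t. w t * \<gamma> k t) i)))\<^sup>2)
    = (\<Sum>i\<in>F. (cmod (L2_inner (\<lambda>t. w t * f t) (nsg_atoms b \<gamma> i)))\<^sup>2)"
    by (simp add: cmod_L2_inner_commute[of f] inner_w cmod_L2_inner_commute[of "nsg_atoms b \<gamma> _"])
  also have "\<dots> \<le> B2 * (L2n (\<lambda>t. w t * f t))\<^sup>2"
    using bessel_\<gamma> w_L2(1)[OF f] F by (simp add: bessel_bound_def)
  also have "\<dots> \<le> B2 * (inverse A * L2n f)\<^sup>2"
    using B2 by (intro mult_left_mono power_mono w_L2 f) auto
  finally show "(\<Sum>i\<in>F. (cmod (L2_inner f (nsg_atoms b (\<lambda>k t. w t * \<gamma> k t) i)))\<^sup>2) \<le> B2 * (inverse A)\<^sup>2 * (L2n f)\<^sup>2"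
    by (simp add: power_mult_distrib mult.assoc)
qed

lemma dual_converges: "nsg_op_converges b g (\<lambda>k t. w t * \<gamma> k t)"
  unfolding nsg_op_converges_def
  by (intro ballI bessel_synthesis_summable[OF bessel_w] bessel_coeffs_summable[OF bessel_g])

lemma dual_error:
  assumes f: "f \<in> L2"
    and c: "\<And>f h. f \<in> L2 \<Longrightarrow> h \<in> L2 \<Longrightarrow> cross f h \<le> ennreal (c * L2n f * L2n h)" "0 \<le> c"
  shows "L2_norm (\<lambda>t. f t - nsg_op b g (\<lambda>k t. w t * \<gamma> k t) f t) \<le> ennreal (inverse A * c * L2n f)"
proof -
  define \<phi> where "\<phi> = nsg_atoms b g"
  define \<psi> where "\<psi> = nsg_atoms b (\<lambda>k t. w t * \<gamma> k t)"
  define S where "S = nsg_op b g (\<lambda>k t. w t * \<gamma> k t) f"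
  have \<psi>: "\<psi> i \<in> L2" for i unfolding \<psi>_def by (rule bessel_bound_L2[OF bessel_w])
  \<comment> \<open>\<open>nsg_op\<close> selects some limit by choice; convergence is what makes
    the selected function an actual limit.\<close>
  have "L2_has_sum (\<lambda>i t. L2_inner f (\<phi> i) * \<psi> i t) S"
    using dual_converges f unfolding nsg_op_converges_def L2_summable_def S_def nsg_op_def L2_sum_def \<phi>_def \<psi>_def
    by (metis (mono_tags) someI_ex)
  then have S: "L2_has_sum (\<lambda>i t. L2_inner f (\<phi> i) * \<psi> i t) S" "S \<in> L2" by (auto simp: L2_has_sum_def)
  define u where "u = (\<lambda>t. f t - S t)"
  have u: "u \<in> L2" unfolding u_def by (rule L2_diff[OF f S(2)])
  note wu = w_L2[OF u]
  have "((\<lambda>i. L2_inner (\<lambda>t. L2_inner f (\<phi> i) * \<psi> i t) u) has_sum L2_inner S u) UNIV"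
    by (rule L2_has_sum_inner[OF _ S(1) u]) (rule L2_cmult[OF \<psi>])
  then have "((\<lambda>i. L2_inner f (nsg_atoms b g i) * L2_inner (nsg_atoms b \<gamma> i) (\<lambda>t. w t * u t)) has_sum L2_inner S u) UNIV"
    by (simp add: L2_inner_cmult_left \<psi>_def inner_w \<phi>_def)
  from form_bound[OF f wu(1) this c]
  have "cmod (L2_inner S u - (LINT t|lebesgue. f t * cnj (w t * u t) * of_real (G t))) \<le> c * L2n f * L2n (\<lambda>t. w t * u t)" .
  also have "\<dots> \<le> c * L2n f * (inverse A * L2n u)" using c wu by (intro mult_left_mono) auto
  \<comment> \<open>The weight cancels \<open>G\<close> almost everywhere, as \<open>G\<close> is at
    least \<open>A\<close> there.\<close>
  also have "(LINT t|lebesgue. f t * cnj (w t * u t) * of_real (G t)) = L2_inner f u"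
    unfolding L2_inner_def
  proof (rule integral_cong_AE)
    show "AE t in lebesgue. f t * cnj (w t * u t) * of_real (G t) = f t * cnj (u t)"
      using G_bounds
    proof eventually_elim
      case (elim t)
      then have "G t \<noteq> 0" using A by auto
      then have "cnj (w t) * of_real (G t) = 1" by (simp add: w_def G_def)
      then show ?case by (simp add: mult_ac)
    qed
    show "(\<lambda>t. f t * cnj (w t * u t) * of_real (G t)) \<in> borel_measurable lebesgue"
      by (intro borel_measurable_times borel_measurable_integrable[OF L2_integrable[OF f wu(1)]]) measurable
    show "(\<lambda>t. f t * cnj (u t)) \<in> borel_measurable lebesgue"
      by (rule borel_measurable_integrable[OF L2_integrable[OF f u]])
  qed
  also have "cmod (L2_inner S u - L2_inner f u) = (L2n u)\<^sup>2"
  proof -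
    have "L2_inner f u - L2_inner S u = L2_inner u u"
      unfolding u_def by (rule L2_inner_diff_left[symmetric, OF f S(2) u[unfolded u_def]])
    also have "cmod (L2_inner u u) = (L2n u)\<^sup>2" by (simp add: L2_inner_self[OF u] norm_power)
    finally show ?thesis by (simp add: norm_minus_commute)
  qed
  finally have *: "L2n u * L2n u \<le> (inverse A * c * L2n f) * L2n u" by (simp add: power2_eq_square mult_ac)
  have "L2n u \<le> inverse A * c * L2n f"
  proof (cases "L2n u = 0")
    case True
    then show ?thesis using A c by simp
  next
    case False
    then have "0 < L2n u" by (simp add: less_le)
    with * show ?thesis by (rule mult_right_le_imp_le)
  qed
  then show ?thesis using L2_norm_eq[OF u] by (simp add: u_def S_def ennreal_leI)
qed

text \<open>The real estimate \<open>dual_error\<close> covers finite \<open>K\<close>; for infinite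
  \<open>K\<close> the right side is infinite, because the inverse of the finite number
  \<open>A\<close> is not 0.\<close>

lemma dual_opnorm:
  assumes K: "\<And>f h. f \<in> L2 \<Longrightarrow> h \<in> L2 \<Longrightarrow> cross f h \<le> K * ennreal (L2n f * L2n h)"
  shows "L2_opnorm (\<lambda>f t. f t - nsg_op b g (\<lambda>k t. w t * \<gamma> k t) f t) \<le> inverse (ennreal A) * K"
proof (cases K)
  case (real c)
  have "L2_norm (\<lambda>t. f t - nsg_op b g (\<lambda>k t. w t * \<gamma> k t) f t) \<le> inverse (ennreal A) * K"
    if f: "f \<in> L2" "L2_norm f \<le> 1" for f
  proof -
    have "L2n f \<le> 1" using f by (simp add: L2_norm_eq)
    then have le: "inverse A * c * L2n f \<le> inverse A * c"
      using A real by (intro mult_left_le) auto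
    have "L2_norm (\<lambda>t. f t - nsg_op b g (\<lambda>k t. w t * \<gamma> k t) f t) \<le> ennreal (inverse A * c * L2n f)"
      by (rule dual_error[OF f(1)]) (use K real in \<open>auto simp: ennreal_mult mult.assoc\<close>)
    also have "\<dots> \<le> ennreal (inverse A * c)" by (rule ennreal_leI[OF le])
    also have "\<dots> = inverse (ennreal A) * K" using A real by (simp add: ennreal_mult inverse_ennreal)
    finally show ?thesis .
  qed
  then show ?thesis unfolding L2_opnorm_def by (intro SUP_least) auto
next
  case top
  then show ?thesis using A by (simp add: inverse_ennreal ennreal_mult_top)
qed

end

section \<open>From the window hypotheses to the two operator bounds\<close>

lemma wiener_space_bounded:
  assumes "g \<in> wiener_space"
  shows "g \<in> borel_measurable lebesgue" "\<exists>c\<ge>0. AE t in lebesgue. cmod (g t) \<le> c"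
proof -
  show "g \<in> borel_measurable lebesgue" using assms by (simp add: wiener_space_def)
  define M where "M = esssup lebesgue (\<lambda>t. ennreal (cmod (g t)))"
  have M: "M = ennreal (enn2real M)" using assms by (simp add: wiener_space_def M_def)
  have "AE t in lebesgue. ennreal (cmod (g t)) \<le> M" unfolding M_def by (rule esssup_AE)
  then have "AE t in lebesgue. cmod (g t) \<le> enn2real M"
    by (subst (asm) M) simp
  then show "\<exists>c\<ge>0. AE t in lebesgue. cmod (g t) \<le> c" by (intro exI[of _ "enn2real M"]) simp
qed

lemma nsg_core_idem: "nsg_core a b (nsg_core a b g) = nsg_core a b g"
  by (auto simp: nsg_core_def fun_eq_iff indicator_def)

text \<open>When the synthesis windows equal their cores, their tails are 0, and two of the three
  groups in \<open>cross\<close> disappear.\<close>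

lemma shift_total_zero: "shift_total b p (\<lambda>k t. 0) f h L = 0"
  by (simp add: shift_total_def shift_term_def)

theorem corollary4p3:
  fixes a b :: "int \<Rightarrow> real"
    and g go gr \<gamma>1 \<gamma>2 :: "int \<Rightarrow> real \<Rightarrow> complex"
    and A0 :: ennreal
  assumes painless: "almost_painless a b g"
    and bessel: "L2_bessel (nsg_atoms b g)"
    and go: "go = nsg_core a b g"
    and gr: "gr = (\<lambda>k t. g k t - g k t * indicator (nsg_interval a b k) t)"
    and A0: "A0 = essinf lebesgue (nsg_G b go go 0)"
    and \<gamma>1: "\<gamma>1 = (\<lambda>k t. complex_of_real (inverse (enn2real (nsg_G b go go 0 t))) * go k t)"
    and \<gamma>2: "\<gamma>2 = (\<lambda>k t. complex_of_real (inverse (enn2real (nsg_G b go go 0 t))) * g k t)"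
  shows "(nsg_op_converges b g \<gamma>1 \<and>
          L2_opnorm (\<lambda>f t. f t - nsg_op b g \<gamma>1 f t)
            \<le> inverse A0 * ennsqrt (nsg_R b gr go * nsg_R b go gr)) \<and>
         (nsg_op_converges b g \<gamma>2 \<and>
          L2_opnorm (\<lambda>f t. f t - nsg_op b g \<gamma>2 f t)
            \<le> inverse A0 * (nsg_R b gr go + nsg_R b go gr
                 + esssup lebesgue (\<lambda>t. \<Sum>\<^sub>\<infinity>l. nsg_G b gr gr l t)))"
proof -
  define G0 where "G0 = nsg_G b go go 0"
  have sys: "nsg_system a b g" and frame: "L2_frame (nsg_atoms b go)"
    using painless by (simp_all add: almost_painless_def go)
  have b: "0 < b k" for k
    using sys by (auto simp: nsg_system_def) (metis less_le_trans)
  have wiener: "g k \<in> wiener_space" for k using sys by (simp add: nsg_system_def)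
  note gm = wiener_space_bounded(1)[OF wiener]
  obtain C where C: "\<And>k. 0 \<le> C k" "\<And>k. AE t in lebesgue. cmod (g k t) \<le> C k"
    using wiener_space_bounded(2)[OF wiener] by metis
  have Co: "AE t in lebesgue. cmod (go k t) \<le> C k" for k
    using C(2)[of k] by eventually_elim (use C(1)[of k] in \<open>auto simp: go nsg_core_def indicator_def\<close>)
  have gom: "go k \<in> borel_measurable lebesgue" for k
    unfolding go nsg_core_def[abs_def] nsg_interval_def by (rule borel_measurable_mult_indicator[OF gm]) simp
  have grm: "gr k \<in> borel_measurable lebesgue" for k
    unfolding gr nsg_interval_def by (intro borel_measurable_diff borel_measurable_mult_indicator gm) simp
  obtain B1 where B1: "bessel_bound (nsg_atoms b g) B1"
    using bessel bessel_boundI[of "nsg_atoms b g"] unfolding L2_bessel_def by blast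
  obtain A B where A: "0 < A" and fr:
      "\<And>f. f \<in> L2 \<Longrightarrow> ennreal A * (L2_norm f)\<^sup>2 \<le> (\<Sum>\<^sub>\<infinity>i. ennreal ((cmod (L2_inner f (nsg_atoms b go i)))\<^sup>2))"
      "\<And>f. f \<in> L2 \<Longrightarrow> (\<Sum>\<^sub>\<infinity>i. ennreal ((cmod (L2_inner f (nsg_atoms b go i)))\<^sup>2)) \<le> ennreal B * (L2_norm f)\<^sup>2"
    using frame unfolding L2_frame_def by blast
  \<comment> \<open>The upper frame constant is an arbitrary real, hence the maximum with 0.\<close>
  have B2: "bessel_bound (nsg_atoms b go) (max 0 B)"
    by (rule bessel_boundI) (use frame fr in \<open>auto simp: L2_frame_def\<close>)
  have G0m: "G0 \<in> borel_measurable lebesgue" and lowerA: "AE t in lebesgue. ennreal A \<le> G0 t"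
    and upper: "AE t in lebesgue. G0 t \<le> ennreal B"
    unfolding G0_def go by (rule painless_frame_bounds[OF b gm C fr[unfolded go]]; assumption)+
  have lower: "AE t in lebesgue. A0 \<le> G0 t"
    unfolding A0 G0_def[symmetric] by (rule essinf_AE[OF G0m])
  \<comment> \<open>The constant \<open>A\<close> from the frame inequality shows that the optimal
    lower bound \<open>A0\<close> is positive; the estimates run with \<open>A0\<close> itself, as a
    smaller constant would weaken the factor.\<close>
  have "ennreal A \<le> A0"
    unfolding A0 G0_def[symmetric] by (rule essinf_greatest[OF G0m lowerA])
  then have A0pos: "0 < A0" using A by (auto simp: zero_less_iff_neq_zero)
  have "A0 \<noteq> top"
  proof
    assume "A0 = top"
    have "AE t in lebesgue. G0 t \<noteq> G0 t"
      using lower upper by eventually_elim (use \<open>A0 = top\<close> in \<open>auto simp: top_unique\<close>)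
    then have "ae_filter (lebesgue :: real measure) = bot" by (simp add: trivial_limit_def)
    then show False by (simp add: ae_filter_eq_bot_iff)
  qed
  then obtain \<alpha> where \<alpha>: "A0 = ennreal \<alpha>" "0 < \<alpha>"
    using A0pos by (cases A0) auto
  \<comment> \<open>The synthesis window is the core itself, so its tail is 0.\<close>
  interpret pp1: painless_pair a b g go \<alpha> B B1 "max 0 B" C go gr "\<lambda>k t. 0" G0
    by unfold_locales (use b gm gom C Co B1 B2 \<alpha> G0m lower upper in
      \<open>auto simp: go nsg_core_idem gr G0_def nsg_core_def fun_eq_iff indicator_def\<close>)
  interpret pp2: painless_pair a b g g \<alpha> B B1 B1 C go gr gr G0
    by unfold_locales (use b gm C B1 \<alpha> G0m lower upper in \<open>auto simp: go gr G0_def\<close>)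
  have \<gamma>1': "\<gamma>1 = (\<lambda>k t. pp1.w t * go k t)" and \<gamma>2': "\<gamma>2 = (\<lambda>k t. pp2.w t * g k t)"
    unfolding \<gamma>1 \<gamma>2 G0_def[symmetric] by (simp_all only: pp1.w_def pp2.w_def)
  have LU: "uminus ` UNIV = (UNIV :: int set)"
    by (rule surjI[of _ uminus]) simp
  have L0: "uminus ` (UNIV - {0}) = UNIV - {0 :: int}"
    by (simp add: image_set_diff LU)
  have Wro: "window_pair b gr go" and Wor: "window_pair b go gr" and Wrr: "window_pair b gr gr"
    by (unfold_locales; use b gom grm in simp)+
  \<comment> \<open>The two mixed totals produce their constants in opposite order, and the product
    under the root is symmetric.\<close>
  have ro: "shift_total b gr go f h (UNIV - {0}) \<le> ennsqrt (nsg_R b gr go * nsg_R b go gr) * ennreal (L2n f * L2n h)"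
    and or: "shift_total b go gr f h (UNIV - {0}) \<le> ennsqrt (nsg_R b gr go * nsg_R b go gr) * ennreal (L2n f * L2n h)"
    and rr: "shift_total b gr gr f h UNIV \<le> esssup lebesgue (\<lambda>t. \<Sum>\<^sub>\<infinity>l. nsg_G b gr gr l t) * ennreal (L2n f * L2n h)"
    if "f \<in> L2" "h \<in> L2" for f h
    using shift_total_le[OF Wro that L0] shift_total_le[OF Wor that L0] shift_total_le[OF Wrr that LU]
    by (simp_all add: nsg_R_def mult.commute ennsqrt_mult_self)
  have "pp1.cross f h \<le> ennsqrt (nsg_R b gr go * nsg_R b go gr) * ennreal (L2n f * L2n h)" if "f \<in> L2" "h \<in> L2" for f h
    using ro[OF that] by (simp add: pp1.cross_def shift_total_zero)
  then have 1: "L2_opnorm (\<lambda>f t. f t - nsg_op b g \<gamma>1 f t) \<le> inverse A0 * ennsqrt (nsg_R b gr go * nsg_R b go gr)"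
    unfolding \<gamma>1' \<alpha>(1) by (rule pp1.dual_opnorm)
  have "pp2.cross f h \<le> (nsg_R b gr go + nsg_R b go gr + esssup lebesgue (\<lambda>t. \<Sum>\<^sub>\<infinity>l. nsg_G b gr gr l t)) * ennreal (L2n f * L2n h)"
    if "f \<in> L2" "h \<in> L2" for f h
  proof -
    have "pp2.cross f h \<le> (ennsqrt (nsg_R b gr go * nsg_R b go gr) + ennsqrt (nsg_R b gr go * nsg_R b go gr)
        + esssup lebesgue (\<lambda>t. \<Sum>\<^sub>\<infinity>l. nsg_G b gr gr l t)) * ennreal (L2n f * L2n h)"
      unfolding pp2.cross_def distrib_right by (intro add_mono ro or rr that)
    also have "\<dots> \<le> (nsg_R b gr go + nsg_R b go gr + esssup lebesgue (\<lambda>t. \<Sum>\<^sub>\<infinity>l. nsg_G b gr gr l t)) * ennreal (L2n f * L2n h)"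
      by (intro mult_right_mono add_mono ennsqrt_AM_GM) auto
    finally show ?thesis .
  qed
  then have 2: "L2_opnorm (\<lambda>f t. f t - nsg_op b g \<gamma>2 f t) \<le> inverse A0 * (nsg_R b gr go + nsg_R b go gr
                 + esssup lebesgue (\<lambda>t. \<Sum>\<^sub>\<infinity>l. nsg_G b gr gr l t))"
    unfolding \<gamma>2' \<alpha>(1) by (rule pp2.dual_opnorm)
  show ?thesis
    using 1 2 pp1.dual_converges pp2.dual_converges unfolding \<gamma>1' \<gamma>2' by blast
qed

end
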